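(* There is a category $\int\mathrm{Mod}$ (the Grothendieck construction of the functor $\mathrm{Mod}\colon\mathsf{Enr}\to\mathsf{Cat}$) in which: - An object is a choice of cartesian closed category $\mathsf V$ with chosen finite coproducts of the terminal object, a $\mathsf V$-theory $\mathsf T$, a $\mathsf V$-category $\mathsf C$ with finite $\mathsf V$-products, and a model $\mu\colon\mathsf T\to\mathsf C$. - A morphism from $(\mathsf V,\mathsf T,\mathsf C,\mu)$ to $(\mathsf W,\mathsf T',\mathsf C',\mu')$ is a functor $F\colon\mathsf V\to\mathsf W$ preserving finite products and preserving the chosen finite coproducts of the terminal object, together with a morphism $(f,g,\alpha)\colon(F_*(\mathsf T),F_*(\mathsf C),F_*(\mu))\to(\mathsf T',\mathsf C',\mu')$ in $\int\mathsf W\mathrm{Mod}$.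
   Context: Let $\mathsf V$ be cartesian closed with chosen finite coproducts $n_{\mathsf V}=\sum_{i\in n}1_{\mathsf V}$ of its terminal object. $\mathsf A_{\mathsf V}$ is the opposite of the $\mathsf V$-category $\underline{\mathsf N}_{\mathsf V}$ with one object $n_{\mathsf V}$ for each $n\in\mathbb N$ and hom-objects $\underline{\mathsf N}_{\mathsf V}(m_{\mathsf V},n_{\mathsf V})=n_{\mathsf V}^{m_{\mathsf V}}$, canonically identified with $(n^m)_{\mathsf V}$. A universal cone exhibiting $b$ as the $\mathsf V$-product of $b_1,\dots,b_n$ in a $\mathsf V$-category $\mathsf C$ is a morphism $p\colon1_{\mathsf V}\to\prod_i\mathsf C(b,b_i)$ whose induced $\mathsf V$-natural transformation $\mathsf C(-,b)\to\prod_i\mathsf C(-,b_i)$ is an isomorphism; a $\mathsf V$-functor preserves finite $\mathsf V$-products if it sends such universal cones to universal cones. A $\mathsf V$-theory $(\mathsf T,\tau)$ is a $\mathsf V$-category $\mathsf T$ with an identity-on-objects $\mathsf V$-functor $\tau\colon\mathsf A_{\mathsf V}\to\mathsf T$ preserving finite $\mathsf V$-products; a morphism $(\mathsf T,\tau)\to(\mathsf T',\tau')$ of $\mathsf V$-theories is a $\mathsf V$-functor $f\colon\mathsf T\to\mathsf T'$ preserving finite $\mathsf V$-products with $f\tau=\tau'$; these form the category $\mathsf V\mathsf{Law}$. $\mathsf V\mathsf{Con}$ is the category of $\mathsf V$-categories with finite $\mathsf V$-products and $\mathsf V$-functors preserving them. $\mathsf V\mathrm{Mod}(\mathsf T,\mathsf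 C)$ is the category of models (finite-$\mathsf V$-product-preserving $\mathsf V$-functors $\mathsf T\to\mathsf C$) and $\mathsf V$-natural transformations. Grothendieck construction: for a functor $G\colon\mathsf D\to\mathsf{Cat}$, $\int G$ has objects pairs $(d,x)$ with $d\in\mathsf D$, $x\in G(d)$, morphisms $(d,x)\to(d',x')$ the pairs $(h\colon d\to d',\ a\colon G(h)(x)\to x')$, and composition $(h,a)\circ(h',a')=(h\circ h',\ a\circ G(h)(a'))$. $\int\mathsf V\mathrm{Mod}$ is the Grothendieck construction of $\mathsf V\mathrm{Mod}\colon\mathsf V\mathsf{Law}^{\mathrm{op}}\times\mathsf V\mathsf{Con}\to\mathsf{Cat}$, which acts on morphisms by precomposition with $f$ and postcomposition with $g$. Its objects are triples $(\mathsf T,\mathsf C,\mu)$ with $\mu\colon\mathsf T\to\mathsf C$ a model; a morphism $(f,g,\alpha)\colon(\mathsf T,\mathsf C,\mu)\to(\mathsf T',\mathsf C',\mu')$ consists of a morphism of $\mathsf V$-theories $f\colon\mathsf T'\to\mathsf T$, a finite-$\mathsf V$-product-preserving $\mathsf V$-functor $g\colon\mathsf C\to\mathsf C'$, and a $\mathsf V$-natural transformation $\alpha\colon g\circ\mu\circ f\Rightarrow\mu'$. $\mathsf{Enr}$ is the category whose objects are cartesian closed categories with chosen finite coproducts of the terminal object and whose morphisms $F\colon\mathsf V\to\mathsf W$ are functors preserving finite products and these chosen coproducts ($F(n_{\mathsf V})=n_{\mathsf W}$ as coproducts). $F_*$ denotes change of base: $F_*(\mathsf C)$ has the objects of $\mathsf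 C$ and hom-objects $F(\mathsf C(a,b))$, with the evident structure, and similarly on $\mathsf V$-functors and $\mathsf V$-natural transformations. For a $\mathsf V$-theory $(\mathsf T,\tau)$, $F_*(\mathsf T)$ is a $\mathsf W$-theory via $F_*(\tau)\circ\tilde F$, where $\tilde F\colon\mathsf A_{\mathsf W}\to F_*(\mathsf A_{\mathsf V})$ is the isomorphism sending $n_{\mathsf W}$ to $n_{\mathsf V}$ and given by the canonical identity $m_{\mathsf W}^{n_{\mathsf W}}=(m^n)_{\mathsf W}=F((m^n)_{\mathsf V})=F(m_{\mathsf V}^{n_{\mathsf V}})$ on hom-objects. ("Identity on objects" is understood via $n_{\mathsf W}\leftrightarrow n_{\mathsf V}$.) The functor $\mathrm{Mod}\colon\mathsf{Enr}\to\mathsf{Cat}$ sends $\mathsf V$ to $\int\mathsf V\mathrm{Mod}$ and $F\colon\mathsf V\to\mathsf W$ to the functor $(\mathsf T,\mathsf C,\mu)\mapsto(F_*(\mathsf T),F_*(\mathsf C),F_*(\mu))$, $(f,g,\alpha)\mapsto(F_*(f),F_*(g),F_*(\alpha))$. (Here $\mathsf{Cat}$ is a category of sufficiently large categories.) *)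

theory Defs
  imports Main
begin

(* Conventions.  A category consists of a set of objects, hom-sets indexed by pairs of objects, and
   identities and composition indexed by objects; hom-sets need not be disjoint, so a morphism is
   bare data without a tagged domain and codomain.  Cmp C a b c g f is g after f, for f : a -> b
   and g : b -> c.  Every structure is required to be "undefined" outside its carrier, so that
   equality in HOL of categories, functors, V-categories, V-functors etc. is the usual equality. *)

section \<open>Categories and functors\<close>

record ('o, 'a) cat =
  Ob :: "'o set"
  Hom :: "'o \<Rightarrow> 'o \<Rightarrow> 'a set"
  Idt :: "'o \<Rightarrow> 'a"
  Cmp :: "'o \<Rightarrow> 'o \<Rightarrow> 'o \<Rightarrow> 'a \<Rightarrow> 'a \<Rightarrow> 'a"

definition category :: "('o, 'a, 'z) cat_scheme \<Rightarrow> bool" where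
  "category C \<longleftrightarrow>
     (\<forall>a\<in>Ob C. Idt C a \<in> Hom C a a) \<and>
     (\<forall>a b c f g. f \<in> Hom C a b \<longrightarrow> g \<in> Hom C b c \<longrightarrow> Cmp C a b c g f \<in> Hom C a c) \<and>
     (\<forall>a b f. f \<in> Hom C a b \<longrightarrow> Cmp C a b b (Idt C b) f = f \<and> Cmp C a a b f (Idt C a) = f) \<and>
     (\<forall>a b c d f g h. f \<in> Hom C a b \<longrightarrow> g \<in> Hom C b c \<longrightarrow> h \<in> Hom C c d \<longrightarrow>
        Cmp C a c d h (Cmp C a b c g f) = Cmp C a b d (Cmp C b c d h g) f) \<and>
     (\<forall>a b. \<not> (a \<in> Ob C \<and> b \<in> Ob C) \<longrightarrow> Hom C a b = {}) \<and>
     (\<forall>a. a \<notin> Ob C \<longrightarrow> Idt C a = undefined) \<and>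
     (\<forall>a b c f g. \<not> (f \<in> Hom C a b \<and> g \<in> Hom C b c) \<longrightarrow> Cmp C a b c g f = undefined)"

definition mk_cat ::
  "'o set \<Rightarrow> ('o \<Rightarrow> 'o \<Rightarrow> 'a set) \<Rightarrow> ('o \<Rightarrow> 'a) \<Rightarrow> ('o \<Rightarrow> 'o \<Rightarrow> 'o \<Rightarrow> 'a \<Rightarrow> 'a \<Rightarrow> 'a) \<Rightarrow> ('o, 'a) cat" where
  "mk_cat O' H I K =
     \<lparr>Ob = O',
      Hom = (\<lambda>a b. if a \<in> O' \<and> b \<in> O' then H a b else {}),
      Idt = (\<lambda>a. if a \<in> O' then I a else undefined),
      Cmp = (\<lambda>a b c g f. if a \<in> O' \<and> b \<in> O' \<and> c \<in> O' \<and> f \<in> H a b \<and> g \<in> H b c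
                         then K a b c g f else undefined)\<rparr>"

record ('o, 'a, 'p, 'b) fnctr =
  fob :: "'o \<Rightarrow> 'p"
  far :: "'o \<Rightarrow> 'o \<Rightarrow> 'a \<Rightarrow> 'b"

definition is_functor ::
  "('o, 'a, 'y) cat_scheme \<Rightarrow> ('p, 'b, 'z) cat_scheme \<Rightarrow> ('o, 'a, 'p, 'b) fnctr \<Rightarrow> bool" where
  "is_functor A B F \<longleftrightarrow>
     category A \<and> category B \<and>
     (\<forall>a\<in>Ob A. fob F a \<in> Ob B) \<and>
     (\<forall>a b f. f \<in> Hom A a b \<longrightarrow> far F a b f \<in> Hom B (fob F a) (fob F b)) \<and>
     (\<forall>a\<in>Ob A. far F a a (Idt A a) = Idt B (fob F a)) \<and>
     (\<forall>a b c f g. f \<in> Hom A a b \<longrightarrow> g \<in> Hom A b c \<longrightarrow>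
        far F a c (Cmp A a b c g f) =
          Cmp B (fob F a) (fob F b) (fob F c) (far F b c g) (far F a b f)) \<and>
     (\<forall>a. a \<notin> Ob A \<longrightarrow> fob F a = undefined) \<and>
     (\<forall>a b f. f \<notin> Hom A a b \<longrightarrow> far F a b f = undefined)"

definition mk_fun ::
  "('o, 'a, 'z) cat_scheme \<Rightarrow> ('o \<Rightarrow> 'p) \<Rightarrow> ('o \<Rightarrow> 'o \<Rightarrow> 'a \<Rightarrow> 'b) \<Rightarrow> ('o, 'a, 'p, 'b) fnctr" where
  "mk_fun A ob ar =
     \<lparr>fob = (\<lambda>a. if a \<in> Ob A then ob a else undefined),
      far = (\<lambda>a b f. if f \<in> Hom A a b then ar a b f else undefined)\<rparr>"

definition id_fun :: "('o, 'a, 'z) cat_scheme \<Rightarrow> ('o, 'a, 'o, 'a) fnctr" where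
  "id_fun A = mk_fun A (\<lambda>a. a) (\<lambda>a b f. f)"

definition comp_fun ::
  "('o, 'a, 'z) cat_scheme \<Rightarrow> ('p, 'b, 'q, 'c) fnctr \<Rightarrow> ('o, 'a, 'p, 'b) fnctr \<Rightarrow>
   ('o, 'a, 'q, 'c) fnctr" where
  "comp_fun A G F =
     mk_fun A (\<lambda>a. fob G (fob F a)) (\<lambda>a b f. far G (fob F a) (fob F b) (far F a b f))"

definition Cat :: "(('o, 'a) cat, ('o, 'a, 'o, 'a) fnctr) cat" where
  "Cat = mk_cat {C. category C} (\<lambda>A B. {F. is_functor A B F}) id_fun (\<lambda>A B C G F. comp_fun A G F)"

definition op_cat :: "('o, 'a) cat \<Rightarrow> ('o, 'a) cat" where
  "op_cat C = mk_cat (Ob C) (\<lambda>a b. Hom C b a) (Idt C) (\<lambda>a b c g f. Cmp C c b a f g)"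

definition prod_cat :: "('o, 'a) cat \<Rightarrow> ('p, 'b) cat \<Rightarrow> ('o \<times> 'p, 'a \<times> 'b) cat" where
  "prod_cat C D =
     mk_cat (Ob C \<times> Ob D)
       (\<lambda>(a, a') (b, b'). Hom C a b \<times> Hom D a' b')
       (\<lambda>(a, a'). (Idt C a, Idt D a'))
       (\<lambda>(a, a') (b, b') (c, c') (g, g') (f, f'). (Cmp C a b c g f, Cmp D a' b' c' g' f'))"

definition groth ::
  "('d, 'e) cat \<Rightarrow> ('d, 'e, ('o, 'a) cat, ('o, 'a, 'o, 'a) fnctr) fnctr \<Rightarrow>
   ('d \<times> 'o, 'e \<times> 'a) cat" where
  "groth D G =
     mk_cat {(d, x). d \<in> Ob D \<and> x \<in> Ob (fob G d)}
       (\<lambda>(d, x) (d', x').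
          {(h, a). h \<in> Hom D d d' \<and> a \<in> Hom (fob G d') (fob (far G d d' h) x) x'})
       (\<lambda>(d, x). (Idt D d, Idt (fob G d) x))
       (\<lambda>(d0, x0) (d1, x1) (d2, x2) (h, a) (h', a').
          (Cmp D d0 d1 d2 h h',
           Cmp (fob G d2)
             (fob (far G d1 d2 h) (fob (far G d0 d1 h') x0)) (fob (far G d1 d2 h) x1) x2
             a (far (far G d1 d2 h) (fob (far G d0 d1 h') x0) x1 a')))"

definition inverse_in :: "('o, 'a, 'z) cat_scheme \<Rightarrow> 'o \<Rightarrow> 'o \<Rightarrow> 'a \<Rightarrow> 'a \<Rightarrow> bool" where
  "inverse_in C a b f g \<longleftrightarrow>
     f \<in> Hom C a b \<and> g \<in> Hom C b a \<and> Cmp C a b a g f = Idt C a \<and> Cmp C b a b f g = Idt C b"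

definition is_iso :: "('o, 'a, 'z) cat_scheme \<Rightarrow> 'o \<Rightarrow> 'o \<Rightarrow> 'a \<Rightarrow> bool" where
  "is_iso C a b f \<longleftrightarrow> (\<exists>g. inverse_in C a b f g)"

definition inv_in :: "('o, 'a, 'z) cat_scheme \<Rightarrow> 'o \<Rightarrow> 'o \<Rightarrow> 'a \<Rightarrow> 'a" where
  "inv_in C a b f = (THE g. inverse_in C a b f g)"

definition is_product ::
  "('o, 'a, 'z) cat_scheme \<Rightarrow> 'o list \<Rightarrow> 'o \<Rightarrow> (nat \<Rightarrow> 'a) \<Rightarrow> bool" where
  "is_product C xs p pr \<longleftrightarrow>
     set xs \<subseteq> Ob C \<and> p \<in> Ob C \<and> (\<forall>i<length xs. pr i \<in> Hom C p (xs ! i)) \<and>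
     (\<forall>c\<in>Ob C. \<forall>f. (\<forall>i<length xs. f i \<in> Hom C c (xs ! i)) \<longrightarrow>
        (\<exists>!u. u \<in> Hom C c p \<and> (\<forall>i<length xs. Cmp C c p (xs ! i) (pr i) u = f i)))"

definition is_coproduct ::
  "('o, 'a, 'z) cat_scheme \<Rightarrow> 'o list \<Rightarrow> 'o \<Rightarrow> (nat \<Rightarrow> 'a) \<Rightarrow> bool" where
  "is_coproduct C xs s inj' \<longleftrightarrow>
     set xs \<subseteq> Ob C \<and> s \<in> Ob C \<and> (\<forall>i<length xs. inj' i \<in> Hom C (xs ! i) s) \<and>
     (\<forall>c\<in>Ob C. \<forall>f. (\<forall>i<length xs. f i \<in> Hom C (xs ! i) c) \<longrightarrow>
        (\<exists>!u. u \<in> Hom C s c \<and> (\<forall>i<length xs. Cmp C (xs ! i) s c u (inj' i) = f i)))"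


section \<open>Cartesian closed categories with chosen finite coproducts of the terminal object\<close>

text \<open>
  Products are chosen for all finite lists of objects, so \<open>prd V []\<close> is the terminal object.
  \<open>expo V b a\<close> is the exponential \<open>b\<^sup>a\<close>, with evaluation \<open>ev V b a\<close> from \<open>b\<^sup>a \<times> a\<close> to \<open>b\<close>.
  \<open>num V n\<close> is the chosen coproduct of \<open>n\<close> copies of the terminal object, with injections
  \<open>inj V n i\<close> for \<open>i < n\<close>.
\<close>

record ('o, 'm) ebase = "('o, 'm) cat" +
  prd :: "'o list \<Rightarrow> 'o"
  prj :: "'o list \<Rightarrow> nat \<Rightarrow> 'm"
  expo :: "'o \<Rightarrow> 'o \<Rightarrow> 'o"
  ev :: "'o \<Rightarrow> 'o \<Rightarrow> 'm"
  num :: "nat \<Rightarrow> 'o"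
  inj :: "nat \<Rightarrow> nat \<Rightarrow> 'm"

abbreviation one :: "('o, 'm) ebase \<Rightarrow> 'o" where
  "one V \<equiv> prd V []"

text \<open>The morphism \<open>\<langle>f\<^sub>0, f\<^sub>1, \<dots>\<rangle>\<close> from \<open>c\<close> to the product of \<open>xs\<close>.\<close>

definition tuple :: "('o, 'm) ebase \<Rightarrow> 'o \<Rightarrow> 'o list \<Rightarrow> 'm list \<Rightarrow> 'm" where
  "tuple V c xs fs =
     (THE u. u \<in> Hom V c (prd V xs) \<and>
             (\<forall>i<length xs. Cmp V c (prd V xs) (xs ! i) (prj V xs i) u = fs ! i))"

definition bang :: "('o, 'm) ebase \<Rightarrow> 'o \<Rightarrow> 'm" where
  "bang V c = tuple V c [] []"

definition prod_map :: "('o, 'm) ebase \<Rightarrow> 'o list \<Rightarrow> 'o list \<Rightarrow> 'm list \<Rightarrow> 'm" where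
  "prod_map V xs ys fs =
     tuple V (prd V xs) ys
       (map (\<lambda>i. Cmp V (prd V xs) (xs ! i) (ys ! i) (fs ! i) (prj V xs i)) [0..<length xs])"

definition curried :: "('o, 'm) ebase \<Rightarrow> 'o \<Rightarrow> 'o \<Rightarrow> 'o \<Rightarrow> 'm \<Rightarrow> 'm \<Rightarrow> bool" where
  "curried V x a b f u \<longleftrightarrow>
     u \<in> Hom V x (expo V b a) \<and>
     Cmp V (prd V [x, a]) (prd V [expo V b a, a]) b (ev V b a)
       (prod_map V [x, a] [expo V b a, a] [u, Idt V a]) = f"

definition curry' :: "('o, 'm) ebase \<Rightarrow> 'o \<Rightarrow> 'o \<Rightarrow> 'o \<Rightarrow> 'm \<Rightarrow> 'm" where
  "curry' V x a b f = (THE u. curried V x a b f u)"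

definition enriching_base :: "('o, 'm) ebase \<Rightarrow> bool" where
  "enriching_base V \<longleftrightarrow>
     category V \<and>
     (\<forall>xs. set xs \<subseteq> Ob V \<longrightarrow> is_product V xs (prd V xs) (prj V xs)) \<and>
     (\<forall>a\<in>Ob V. \<forall>b\<in>Ob V.
        expo V b a \<in> Ob V \<and> ev V b a \<in> Hom V (prd V [expo V b a, a]) b \<and>
        (\<forall>x\<in>Ob V. \<forall>f\<in>Hom V (prd V [x, a]) b. \<exists>!u. curried V x a b f u)) \<and>
     (\<forall>n. is_coproduct V (replicate n (one V)) (num V n) (inj V n)) \<and>
     (\<forall>xs. \<not> set xs \<subseteq> Ob V \<longrightarrow> prd V xs = undefined) \<and>
     (\<forall>xs i. \<not> (set xs \<subseteq> Ob V \<and> i < length xs) \<longrightarrow> prj V xs i = undefined) \<and>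
     (\<forall>a b. \<not> (a \<in> Ob V \<and> b \<in> Ob V) \<longrightarrow> expo V b a = undefined \<and> ev V b a = undefined) \<and>
     (\<forall>n i. \<not> i < n \<longrightarrow> inj V n i = undefined)"

text \<open>The morphism \<open>[f\<^sub>0, \<dots>, f\<^sub>n\<^sub>-\<^sub>1]\<close> from \<open>num V n\<close> to \<open>c\<close>.\<close>

definition cotuple :: "('o, 'm) ebase \<Rightarrow> nat \<Rightarrow> 'o \<Rightarrow> (nat \<Rightarrow> 'm) \<Rightarrow> 'm" where
  "cotuple V n c f =
     (THE u. u \<in> Hom V (num V n) c \<and> (\<forall>i<n. Cmp V (one V) (num V n) c u (inj V n i) = f i))"


section \<open>Enriched categories, functors and natural transformations\<close>

record ('c, 'o, 'm) vcat =
  VOb :: "'c set"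
  VHom :: "'c \<Rightarrow> 'c \<Rightarrow> 'o"
  VIdt :: "'c \<Rightarrow> 'm"
  VCmp :: "'c \<Rightarrow> 'c \<Rightarrow> 'c \<Rightarrow> 'm"

text \<open>\<open>VCmp C a b c\<close> is the composition morphism from \<open>C(b,c) \<times> C(a,b)\<close> to \<open>C(a,c)\<close>.\<close>

definition assoc_iso :: "('o, 'm) ebase \<Rightarrow> 'o \<Rightarrow> 'o \<Rightarrow> 'o \<Rightarrow> 'm" where
  "assoc_iso V x y z =
     (let xy = prd V [x, y]; yz = prd V [y, z]; s = prd V [xy, z];
          p = prj V [xy, z] 0; q = prj V [xy, z] 1
      in tuple V s [x, yz]
           [Cmp V s xy x (prj V [x, y] 0) p,
            tuple V s [y, z] [Cmp V s xy y (prj V [x, y] 1) p, q]])"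

definition is_vcat :: "('o, 'm) ebase \<Rightarrow> ('c, 'o, 'm) vcat \<Rightarrow> bool" where
  "is_vcat V C \<longleftrightarrow>
     (let H = VHom C; M = VCmp C; j = VIdt C in
     (\<forall>a\<in>VOb C. \<forall>b\<in>VOb C. H a b \<in> Ob V) \<and>
     (\<forall>a\<in>VOb C. j a \<in> Hom V (one V) (H a a)) \<and>
     (\<forall>a\<in>VOb C. \<forall>b\<in>VOb C. \<forall>c\<in>VOb C. M a b c \<in> Hom V (prd V [H b c, H a b]) (H a c)) \<and>
     (\<forall>a\<in>VOb C. \<forall>b\<in>VOb C. \<forall>c\<in>VOb C. \<forall>d\<in>VOb C.
        Cmp V (prd V [prd V [H c d, H b c], H a b]) (prd V [H b d, H a b]) (H a d)
          (M a b d)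
          (prod_map V [prd V [H c d, H b c], H a b] [H b d, H a b] [M b c d, Idt V (H a b)])
        = Cmp V (prd V [prd V [H c d, H b c], H a b]) (prd V [H c d, H a c]) (H a d)
          (M a c d)
          (Cmp V (prd V [prd V [H c d, H b c], H a b]) (prd V [H c d, prd V [H b c, H a b]])
             (prd V [H c d, H a c])
             (prod_map V [H c d, prd V [H b c, H a b]] [H c d, H a c] [Idt V (H c d), M a b c])
             (assoc_iso V (H c d) (H b c) (H a b)))) \<and>
     (\<forall>a\<in>VOb C. \<forall>b\<in>VOb C.
        Cmp V (prd V [one V, H a b]) (prd V [H b b, H a b]) (H a b) (M a b b)
          (prod_map V [one V, H a b] [H b b, H a b] [j b, Idt V (H a b)])
        = prj V [one V, H a b] 1) \<and>
     (\<forall>a\<in>VOb C. \<forall>b\<in>VOb C.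
        Cmp V (prd V [H a b, one V]) (prd V [H a b, H a a]) (H a b) (M a a b)
          (prod_map V [H a b, one V] [H a b, H a a] [Idt V (H a b), j a])
        = prj V [H a b, one V] 0) \<and>
     (\<forall>a b. \<not> (a \<in> VOb C \<and> b \<in> VOb C) \<longrightarrow> H a b = undefined) \<and>
     (\<forall>a. a \<notin> VOb C \<longrightarrow> j a = undefined) \<and>
     (\<forall>a b c. \<not> (a \<in> VOb C \<and> b \<in> VOb C \<and> c \<in> VOb C) \<longrightarrow> M a b c = undefined))"

record ('c, 'd, 'm) vfun =
  vfob :: "'c \<Rightarrow> 'd"
  vfar :: "'c \<Rightarrow> 'c \<Rightarrow> 'm"

definition is_vfun ::
  "('o, 'm) ebase \<Rightarrow> ('c, 'o, 'm) vcat \<Rightarrow> ('d, 'o, 'm) vcat \<Rightarrow> ('c, 'd, 'm) vfun \<Rightarrow> bool" where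
  "is_vfun V C D f \<longleftrightarrow>
     is_vcat V C \<and> is_vcat V D \<and>
     (let H = VHom C; K = (\<lambda>a b. VHom D (vfob f a) (vfob f b)); f1 = vfar f in
     (\<forall>a\<in>VOb C. vfob f a \<in> VOb D) \<and>
     (\<forall>a\<in>VOb C. \<forall>b\<in>VOb C. f1 a b \<in> Hom V (H a b) (K a b)) \<and>
     (\<forall>a\<in>VOb C. Cmp V (one V) (H a a) (K a a) (f1 a a) (VIdt C a) = VIdt D (vfob f a)) \<and>
     (\<forall>a\<in>VOb C. \<forall>b\<in>VOb C. \<forall>c\<in>VOb C.
        Cmp V (prd V [H b c, H a b]) (H a c) (K a c) (f1 a c) (VCmp C a b c)
        = Cmp V (prd V [H b c, H a b]) (prd V [K b c, K a b]) (K a c)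
            (VCmp D (vfob f a) (vfob f b) (vfob f c))
            (prod_map V [H b c, H a b] [K b c, K a b] [f1 b c, f1 a b])) \<and>
     (\<forall>a. a \<notin> VOb C \<longrightarrow> vfob f a = undefined) \<and>
     (\<forall>a b. \<not> (a \<in> VOb C \<and> b \<in> VOb C) \<longrightarrow> f1 a b = undefined))"

definition mk_vfun ::
  "('c, 'o, 'm) vcat \<Rightarrow> ('c \<Rightarrow> 'd) \<Rightarrow> ('c \<Rightarrow> 'c \<Rightarrow> 'm) \<Rightarrow> ('c, 'd, 'm) vfun" where
  "mk_vfun C ob ar =
     \<lparr>vfob = (\<lambda>a. if a \<in> VOb C then ob a else undefined),
      vfar = (\<lambda>a b. if a \<in> VOb C \<and> b \<in> VOb C then ar a b else undefined)\<rparr>"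

definition id_vfun :: "('o, 'm) ebase \<Rightarrow> ('c, 'o, 'm) vcat \<Rightarrow> ('c, 'c, 'm) vfun" where
  "id_vfun V C = mk_vfun C (\<lambda>a. a) (\<lambda>a b. Idt V (VHom C a b))"

definition comp_vfun ::
  "('o, 'm) ebase \<Rightarrow> ('c, 'o, 'm) vcat \<Rightarrow> ('d, 'o, 'm) vcat \<Rightarrow> ('e, 'o, 'm) vcat \<Rightarrow>
   ('d, 'e, 'm) vfun \<Rightarrow> ('c, 'd, 'm) vfun \<Rightarrow> ('c, 'e, 'm) vfun" where
  "comp_vfun V A B C g f =
     mk_vfun A (\<lambda>a. vfob g (vfob f a))
       (\<lambda>a b. Cmp V (VHom A a b) (VHom B (vfob f a) (vfob f b))
                (VHom C (vfob g (vfob f a)) (vfob g (vfob f b)))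
                (vfar g (vfob f a) (vfob f b)) (vfar f a b))"

text \<open>
  Naturality is the usual hexagon, with \<open>C(a,b) \<cong> 1 \<times> C(a,b)\<close> and \<open>C(a,b) \<cong> C(a,b) \<times> 1\<close>
  absorbed into the pairings.
\<close>

definition is_vnat ::
  "('o, 'm) ebase \<Rightarrow> ('c, 'o, 'm) vcat \<Rightarrow> ('d, 'o, 'm) vcat \<Rightarrow>
   ('c, 'd, 'm) vfun \<Rightarrow> ('c, 'd, 'm) vfun \<Rightarrow> ('c \<Rightarrow> 'm) \<Rightarrow> bool" where
  "is_vnat V C D f g \<alpha> \<longleftrightarrow>
     is_vfun V C D f \<and> is_vfun V C D g \<and>
     (let H = VHom C; K = VHom D; f0 = vfob f; g0 = vfob g in
     (\<forall>a\<in>VOb C. \<alpha> a \<in> Hom V (one V) (K (f0 a) (g0 a))) \<and>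
     (\<forall>a\<in>VOb C. \<forall>b\<in>VOb C.
        Cmp V (H a b) (prd V [K (f0 b) (g0 b), K (f0 a) (f0 b)]) (K (f0 a) (g0 b))
          (VCmp D (f0 a) (f0 b) (g0 b))
          (tuple V (H a b) [K (f0 b) (g0 b), K (f0 a) (f0 b)]
             [Cmp V (H a b) (one V) (K (f0 b) (g0 b)) (\<alpha> b) (bang V (H a b)), vfar f a b])
        = Cmp V (H a b) (prd V [K (g0 a) (g0 b), K (f0 a) (g0 a)]) (K (f0 a) (g0 b))
          (VCmp D (f0 a) (g0 a) (g0 b))
          (tuple V (H a b) [K (g0 a) (g0 b), K (f0 a) (g0 a)]
             [vfar g a b, Cmp V (H a b) (one V) (K (f0 a) (g0 a)) (\<alpha> a) (bang V (H a b))])) \<and>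
     (\<forall>a. a \<notin> VOb C \<longrightarrow> \<alpha> a = undefined))"


section \<open>Finite enriched products\<close>

text \<open>
  For a morphism \<open>p\<close> from \<open>1\<close> to the product of the \<open>C(b,b\<^sub>i)\<close>, \<open>induced\<close> is the component at
  \<open>x\<close> of the V-natural transformation that \<open>p\<close> induces from \<open>C(-,b)\<close> to the product of the
  \<open>C(-,b\<^sub>i)\<close>.
\<close>

definition induced ::
  "('o, 'm) ebase \<Rightarrow> ('c, 'o, 'm) vcat \<Rightarrow> 'c list \<Rightarrow> 'c \<Rightarrow> 'm \<Rightarrow> 'c \<Rightarrow> 'm" where
  "induced V C bs b p x =
     (let H = VHom C; Hb = map (H b) bs in
      tuple V (H x b) (map (H x) bs)
        (map (\<lambda>i.
           Cmp V (H x b) (prd V [H b (bs ! i), H x b]) (H x (bs ! i)) (VCmp C x b (bs ! i))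
             (tuple V (H x b) [H b (bs ! i), H x b]
                [Cmp V (H x b) (one V) (H b (bs ! i))
                   (Cmp V (one V) (prd V Hb) (H b (bs ! i)) (prj V Hb i) p)
                   (bang V (H x b)),
                 Idt V (H x b)]))
           [0..<length bs]))"

text \<open>An isomorphism of V-valued V-functors is a V-natural transformation with invertible components.\<close>

definition universal_cone ::
  "('o, 'm) ebase \<Rightarrow> ('c, 'o, 'm) vcat \<Rightarrow> 'c list \<Rightarrow> 'c \<Rightarrow> 'm \<Rightarrow> bool" where
  "universal_cone V C bs b p \<longleftrightarrow>
     set bs \<subseteq> VOb C \<and> b \<in> VOb C \<and>
     p \<in> Hom V (one V) (prd V (map (VHom C b) bs)) \<and>
     (\<forall>x\<in>VOb C. is_iso V (VHom C x b) (prd V (map (VHom C x) bs)) (induced V C bs b p x))"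

definition has_vproducts :: "('o, 'm) ebase \<Rightarrow> ('c, 'o, 'm) vcat \<Rightarrow> bool" where
  "has_vproducts V C \<longleftrightarrow> (\<forall>bs. set bs \<subseteq> VOb C \<longrightarrow> (\<exists>b p. universal_cone V C bs b p))"

definition image_cone ::
  "('o, 'm) ebase \<Rightarrow> ('c, 'o, 'm) vcat \<Rightarrow> ('d, 'o, 'm) vcat \<Rightarrow> ('c, 'd, 'm) vfun \<Rightarrow>
   'c list \<Rightarrow> 'c \<Rightarrow> 'm \<Rightarrow> 'm" where
  "image_cone V C D f bs b p =
     (let xs = map (VHom C b) bs; ys = map (\<lambda>b'. VHom D (vfob f b) (vfob f b')) bs in
      Cmp V (one V) (prd V xs) (prd V ys) (prod_map V xs ys (map (vfar f b) bs)) p)"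

definition preserves_vproducts ::
  "('o, 'm) ebase \<Rightarrow> ('c, 'o, 'm) vcat \<Rightarrow> ('d, 'o, 'm) vcat \<Rightarrow> ('c, 'd, 'm) vfun \<Rightarrow> bool" where
  "preserves_vproducts V C D f \<longleftrightarrow>
     (\<forall>bs b p. universal_cone V C bs b p \<longrightarrow>
        universal_cone V D (map (vfob f) bs) (vfob f b) (image_cone V C D f bs b p))"

definition is_pvfun ::
  "('o, 'm) ebase \<Rightarrow> ('c, 'o, 'm) vcat \<Rightarrow> ('d, 'o, 'm) vcat \<Rightarrow> ('c, 'd, 'm) vfun \<Rightarrow> bool" where
  "is_pvfun V C D f \<longleftrightarrow> is_vfun V C D f \<and> preserves_vproducts V C D f"


section \<open>Enriched Lawvere theories\<close>

text \<open>
  The object \<open>n\<^sub>V\<close> of the category \<open>A\<^sub>V\<close> is represented by the natural number \<open>n\<close>, so that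
  \<open>A\<^sub>V\<close> has distinct objects even where \<^const>\<open>num\<close> is not injective.
\<close>

definition N_vcat :: "('o, 'm) ebase \<Rightarrow> (nat, 'o, 'm) vcat" where
  "N_vcat V =
     \<lparr>VOb = UNIV,
      VHom = (\<lambda>m n. expo V (num V n) (num V m)),
      VIdt = (\<lambda>n. curry' V (one V) (num V n) (num V n) (prj V [one V, num V n] 1)),
      VCmp = (\<lambda>k l n.
        let K = num V k; L = num V l; N = num V n; NL = expo V N L; LK = expo V L K;
            P = prd V [NL, LK]; S = prd V [P, K]; p = prj V [P, K] 0; q = prj V [P, K] 1
        in curry' V P K N
             (Cmp V S (prd V [NL, L]) N (ev V N L)
               (tuple V S [NL, L]
                 [Cmp V S P NL (prj V [NL, LK] 0) p,
                  Cmp V S (prd V [LK, K]) L (ev V L K)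
                    (tuple V S [LK, K] [Cmp V S P LK (prj V [NL, LK] 1) p, q])])))\<rparr>"

definition op_vcat :: "('o, 'm) ebase \<Rightarrow> ('c, 'o, 'm) vcat \<Rightarrow> ('c, 'o, 'm) vcat" where
  "op_vcat V C =
     \<lparr>VOb = VOb C,
      VHom = (\<lambda>a b. VHom C b a),
      VIdt = VIdt C,
      VCmp = (\<lambda>a b c.
        if a \<in> VOb C \<and> b \<in> VOb C \<and> c \<in> VOb C then
          let x = VHom C c b; y = VHom C b a in
          Cmp V (prd V [x, y]) (prd V [y, x]) (VHom C c a) (VCmp C c b a)
            (tuple V (prd V [x, y]) [y, x] [prj V [x, y] 1, prj V [x, y] 0])
        else undefined)\<rparr>"

definition A_vcat :: "('o, 'm) ebase \<Rightarrow> (nat, 'o, 'm) vcat" where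
  "A_vcat V = op_vcat V (N_vcat V)"

type_synonym ('o, 'm) theory_data = "(nat, 'o, 'm) vcat \<times> (nat, nat, 'm) vfun"

definition is_theory :: "('o, 'm) ebase \<Rightarrow> ('o, 'm) theory_data \<Rightarrow> bool" where
  "is_theory V = (\<lambda>(T, \<tau>).
     VOb T = UNIV \<and> vfob \<tau> = (\<lambda>n. n) \<and> is_pvfun V (A_vcat V) T \<tau>)"

definition VLaw :: "('o, 'm) ebase \<Rightarrow> (('o, 'm) theory_data, (nat, nat, 'm) vfun) cat" where
  "VLaw V =
     mk_cat {t. is_theory V t}
       (\<lambda>(T, \<tau>) (T', \<tau>'). {f. is_pvfun V T T' f \<and> comp_vfun V (A_vcat V) T T' f \<tau> = \<tau>'})
       (\<lambda>(T, \<tau>). id_vfun V T)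
       (\<lambda>(T0, \<tau>0) (T1, \<tau>1) (T2, \<tau>2) g f. comp_vfun V T0 T1 T2 g f)"

definition VCon :: "('o, 'm) ebase \<Rightarrow> (('c, 'o, 'm) vcat, ('c, 'c, 'm) vfun) cat" where
  "VCon V =
     mk_cat {C. is_vcat V C \<and> has_vproducts V C}
       (\<lambda>C D. {f. is_pvfun V C D f})
       (id_vfun V)
       (comp_vfun V)"


section \<open>Models\<close>

definition VMod_cat ::
  "('o, 'm) ebase \<Rightarrow> (nat, 'o, 'm) vcat \<Rightarrow> ('c, 'o, 'm) vcat \<Rightarrow>
   ((nat, 'c, 'm) vfun, nat \<Rightarrow> 'm) cat" where
  "VMod_cat V T C =
     mk_cat {\<mu>. is_pvfun V T C \<mu>}
       (\<lambda>\<mu> \<nu>. {\<alpha>. is_vnat V T C \<mu> \<nu> \<alpha>})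
       (\<lambda>\<mu> n. if n \<in> VOb T then VIdt C (vfob \<mu> n) else undefined)
       (\<lambda>\<mu>0 \<mu>1 \<mu>2 \<beta> \<alpha> n.
          if n \<in> VOb T then
            let a = vfob \<mu>0 n; b = vfob \<mu>1 n; c = vfob \<mu>2 n in
            Cmp V (one V) (prd V [VHom C b c, VHom C a b]) (VHom C a c) (VCmp C a b c)
              (tuple V (one V) [VHom C b c, VHom C a b] [\<beta> n, \<alpha> n])
          else undefined)"

definition whisker ::
  "('o, 'm) ebase \<Rightarrow> (nat, 'o, 'm) vcat \<Rightarrow> ('c, 'o, 'm) vcat \<Rightarrow> ('c, 'o, 'm) vcat \<Rightarrow>
   (nat, nat, 'm) vfun \<Rightarrow> ('c, 'c, 'm) vfun \<Rightarrow>
   (nat, 'c, 'm) vfun \<Rightarrow> (nat, 'c, 'm) vfun \<Rightarrow> (nat \<Rightarrow> 'm) \<Rightarrow> nat \<Rightarrow> 'm" where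
  "whisker V T' C C' f g \<mu> \<nu> \<alpha> n =
     (if n \<in> VOb T' then
        let a = vfob \<mu> (vfob f n); b = vfob \<nu> (vfob f n) in
        Cmp V (one V) (VHom C a b) (VHom C' (vfob g a) (vfob g b)) (vfar g a b) (\<alpha> (vfob f n))
      else undefined)"

type_synonym ('c, 'o, 'm) VMod_dom_ob = "('o, 'm) theory_data \<times> ('c, 'o, 'm) vcat"
type_synonym ('c, 'm) VMod_dom_ar = "(nat, nat, 'm) vfun \<times> ('c, 'c, 'm) vfun"
type_synonym ('c, 'm) VMod_cat_t = "((nat, 'c, 'm) vfun, nat \<Rightarrow> 'm) cat"
type_synonym ('c, 'm) VMod_fun_t =
  "((nat, 'c, 'm) vfun, nat \<Rightarrow> 'm, (nat, 'c, 'm) vfun, nat \<Rightarrow> 'm) fnctr"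

definition VMod_dom ::
  "('o, 'm) ebase \<Rightarrow> (('c, 'o, 'm) VMod_dom_ob, ('c, 'm) VMod_dom_ar) cat" where
  "VMod_dom V = prod_cat (op_cat (VLaw V)) (VCon V)"

definition VMod ::
  "('o, 'm) ebase \<Rightarrow>
   (('c, 'o, 'm) VMod_dom_ob, ('c, 'm) VMod_dom_ar, ('c, 'm) VMod_cat_t, ('c, 'm) VMod_fun_t) fnctr"
  where
  "VMod V =
     mk_fun (VMod_dom V)
       (\<lambda>((T, \<tau>), C). VMod_cat V T C)
       (\<lambda>((T, \<tau>), C) ((T', \<tau>'), C') (f, g).
          mk_fun (VMod_cat V T C)
            (\<lambda>\<mu>. comp_vfun V T' C C' g (comp_vfun V T' T C \<mu> f))
            (\<lambda>\<mu> \<nu> \<alpha>. whisker V T' C C' f g \<mu> \<nu> \<alpha>))"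

type_synonym ('c, 'o, 'm) int_VMod_ob = "('c, 'o, 'm) VMod_dom_ob \<times> (nat, 'c, 'm) vfun"
type_synonym ('c, 'm) int_VMod_ar = "('c, 'm) VMod_dom_ar \<times> (nat \<Rightarrow> 'm)"
type_synonym ('c, 'o, 'm) int_VMod_t = "(('c, 'o, 'm) int_VMod_ob, ('c, 'm) int_VMod_ar) cat"

definition int_VMod :: "('o, 'm) ebase \<Rightarrow> ('c, 'o, 'm) int_VMod_t" where
  "int_VMod V = groth (VMod_dom V) (VMod V)"


section \<open>Change of base\<close>

text \<open>
  \<open>prod_cmp V W F xs\<close> is the canonical comparison from the product of the \<open>F x\<close> to \<open>F\<close> of the
  product of \<open>xs\<close>; for \<open>xs = []\<close> it goes from the terminal object of \<open>W\<close> to \<open>F 1\<close>.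
\<close>

definition prod_cmp ::
  "('o, 'm) ebase \<Rightarrow> ('o, 'm) ebase \<Rightarrow> ('o, 'm, 'o, 'm) fnctr \<Rightarrow> 'o list \<Rightarrow> 'm" where
  "prod_cmp V W F xs =
     (THE u. u \<in> Hom W (prd W (map (fob F) xs)) (fob F (prd V xs)) \<and>
        (\<forall>i<length xs.
           Cmp W (prd W (map (fob F) xs)) (fob F (prd V xs)) (fob F (xs ! i))
             (far F (prd V xs) (xs ! i) (prj V xs i)) u
           = prj W (map (fob F) xs) i))"

definition preserves_products ::
  "('o, 'm) ebase \<Rightarrow> ('o, 'm) ebase \<Rightarrow> ('o, 'm, 'o, 'm) fnctr \<Rightarrow> bool" where
  "preserves_products V W F \<longleftrightarrow>
     (\<forall>xs p pr. is_product V xs p pr \<longrightarrow>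
        is_product W (map (fob F) xs) (fob F p) (\<lambda>i. far F p (xs ! i) (pr i)))"

text \<open>
  The chosen coproducts are preserved strictly, injections included.  A functor preserving finite
  products need not send \<open>1\<close> to the chosen terminal object on the nose, so the image of an
  injection is precomposed with the comparison isomorphism.
\<close>

definition preserves_nums ::
  "('o, 'm) ebase \<Rightarrow> ('o, 'm) ebase \<Rightarrow> ('o, 'm, 'o, 'm) fnctr \<Rightarrow> bool" where
  "preserves_nums V W F \<longleftrightarrow>
     (\<forall>n. fob F (num V n) = num W n \<and>
       (\<forall>i<n. Cmp W (one W) (fob F (one V)) (num W n)
                 (far F (one V) (num V n) (inj V n i)) (prod_cmp V W F [])
               = inj W n i))"

definition is_base_functor ::
  "('o, 'm) ebase \<Rightarrow> ('o, 'm) ebase \<Rightarrow> ('o, 'm, 'o, 'm) fnctr \<Rightarrow> bool" where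
  "is_base_functor V W F \<longleftrightarrow>
     is_functor V W F \<and> preserves_products V W F \<and> preserves_nums V W F"

definition Enr :: "(('o, 'm) ebase, ('o, 'm, 'o, 'm) fnctr) cat" where
  "Enr =
     mk_cat {V. enriching_base V}
       (\<lambda>V W. {F. is_base_functor V W F})
       id_fun
       (\<lambda>U V W G F. comp_fun U G F)"

definition bc_point ::
  "('o, 'm) ebase \<Rightarrow> ('o, 'm) ebase \<Rightarrow> ('o, 'm, 'o, 'm) fnctr \<Rightarrow> 'o \<Rightarrow> 'm \<Rightarrow> 'm" where
  "bc_point V W F x p =
     Cmp W (one W) (fob F (one V)) (fob F x) (far F (one V) x p) (prod_cmp V W F [])"

definition bc_vcat ::
  "('o, 'm) ebase \<Rightarrow> ('o, 'm) ebase \<Rightarrow> ('o, 'm, 'o, 'm) fnctr \<Rightarrow>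
   ('c, 'o, 'm) vcat \<Rightarrow> ('c, 'o, 'm) vcat" where
  "bc_vcat V W F C =
     \<lparr>VOb = VOb C,
      VHom = (\<lambda>a b. if a \<in> VOb C \<and> b \<in> VOb C then fob F (VHom C a b) else undefined),
      VIdt = (\<lambda>a. if a \<in> VOb C then bc_point V W F (VHom C a a) (VIdt C a) else undefined),
      VCmp = (\<lambda>a b c.
        if a \<in> VOb C \<and> b \<in> VOb C \<and> c \<in> VOb C then
          let xs = [VHom C b c, VHom C a b] in
          Cmp W (prd W (map (fob F) xs)) (fob F (prd V xs)) (fob F (VHom C a c))
            (far F (prd V xs) (VHom C a c) (VCmp C a b c)) (prod_cmp V W F xs)
        else undefined)\<rparr>"

definition bc_vfun ::
  "('o, 'm, 'o, 'm) fnctr \<Rightarrow> ('c, 'o, 'm) vcat \<Rightarrow> ('d, 'o, 'm) vcat \<Rightarrow>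
   ('c, 'd, 'm) vfun \<Rightarrow> ('c, 'd, 'm) vfun" where
  "bc_vfun F C D f =
     mk_vfun C (vfob f)
       (\<lambda>a b. far F (VHom C a b) (VHom D (vfob f a) (vfob f b)) (vfar f a b))"

definition bc_vnat ::
  "('o, 'm) ebase \<Rightarrow> ('o, 'm) ebase \<Rightarrow> ('o, 'm, 'o, 'm) fnctr \<Rightarrow>
   ('c, 'o, 'm) vcat \<Rightarrow> ('d, 'o, 'm) vcat \<Rightarrow> ('c, 'd, 'm) vfun \<Rightarrow> ('c, 'd, 'm) vfun \<Rightarrow>
   ('c \<Rightarrow> 'm) \<Rightarrow> 'c \<Rightarrow> 'm" where
  "bc_vnat V W F C D f g \<alpha> a =
     (if a \<in> VOb C then bc_point V W F (VHom D (vfob f a) (vfob g a)) (\<alpha> a) else undefined)"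

text \<open>
  The canonical isomorphism from \<open>(n\<^sup>m)\<^sub>V\<close> to the exponential of \<open>n\<^sub>V\<close> by \<open>m\<^sub>V\<close>.  Functions from
  \<open>m\<close> to \<open>n\<close> are enumerated by \<open>k < n ^ m\<close> through the base-\<open>n\<close> digits of \<open>k\<close>; the \<open>k\<close>-th injection
  goes to the name of the morphism from \<open>m\<^sub>V\<close> to \<open>n\<^sub>V\<close> given by the \<open>k\<close>-th function.
\<close>

definition num_expo :: "('o, 'm) ebase \<Rightarrow> nat \<Rightarrow> nat \<Rightarrow> 'm" where
  "num_expo V m n =
     (let M = num V m; N = num V n in
      cotuple V (n ^ m) (expo V N M)
        (\<lambda>k. curry' V (one V) M N
               (Cmp V (prd V [one V, M]) M N
                 (cotuple V m N (\<lambda>i. inj V n (k div n ^ i mod n)))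
                 (prj V [one V, M] 1))))"

text \<open>
  The isomorphism from \<open>A\<^sub>W\<close> to the base change of \<open>A\<^sub>V\<close>, which uses
  that \<open>F\<close> sends \<open>(n\<^sup>m)\<^sub>V\<close> to \<open>(n\<^sup>m)\<^sub>W\<close>.  The hom-object of \<^const>\<open>A_vcat\<close> from \<open>n\<close> to \<open>m\<close> is the
  exponential of \<open>n\<^sub>V\<close> by \<open>m\<^sub>V\<close>.
\<close>

definition A_cmp ::
  "('o, 'm) ebase \<Rightarrow> ('o, 'm) ebase \<Rightarrow> ('o, 'm, 'o, 'm) fnctr \<Rightarrow> (nat, nat, 'm) vfun" where
  "A_cmp V W F =
     \<lparr>vfob = (\<lambda>n. n),
      vfar = (\<lambda>n m.
        let EV = expo V (num V n) (num V m); EW = expo W (num W n) (num W m) in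
        Cmp W EW (num W (n ^ m)) (fob F EV)
          (far F (num V (n ^ m)) EV (num_expo V m n))
          (inv_in W (num W (n ^ m)) EW (num_expo W m n)))\<rparr>"

definition bc_theory ::
  "('o, 'm) ebase \<Rightarrow> ('o, 'm) ebase \<Rightarrow> ('o, 'm, 'o, 'm) fnctr \<Rightarrow>
   ('o, 'm) theory_data \<Rightarrow> ('o, 'm) theory_data" where
  "bc_theory V W F = (\<lambda>(T, \<tau>).
     (bc_vcat V W F T,
      comp_vfun W (A_vcat W) (bc_vcat V W F (A_vcat V)) (bc_vcat V W F T)
        (bc_vfun F (A_vcat V) T \<tau>) (A_cmp V W F)))"

definition bc_model ::
  "('o, 'm) ebase \<Rightarrow> ('o, 'm) ebase \<Rightarrow> ('o, 'm, 'o, 'm) fnctr \<Rightarrow>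
   ('c, 'o, 'm) int_VMod_ob \<Rightarrow> ('c, 'o, 'm) int_VMod_ob" where
  "bc_model V W F = (\<lambda>(((T, \<tau>), C), \<mu>).
     ((bc_theory V W F (T, \<tau>), bc_vcat V W F C), bc_vfun F T C \<mu>))"

definition bc_model_ar ::
  "('o, 'm) ebase \<Rightarrow> ('o, 'm) ebase \<Rightarrow> ('o, 'm, 'o, 'm) fnctr \<Rightarrow>
   ('c, 'o, 'm) int_VMod_ob \<Rightarrow> ('c, 'o, 'm) int_VMod_ob \<Rightarrow>
   ('c, 'm) int_VMod_ar \<Rightarrow> ('c, 'm) int_VMod_ar" where
  "bc_model_ar V W F = (\<lambda>(((T, \<tau>), C), \<mu>) (((T', \<tau>'), C'), \<mu>') ((f, g), \<alpha>).
     ((bc_vfun F T' T f, bc_vfun F C C' g),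
      bc_vnat V W F T' C' (comp_vfun V T' C C' g (comp_vfun V T' T C \<mu> f)) \<mu>' \<alpha>))"

type_synonym ('c, 'o, 'm) int_VMod_fun_t =
  "(('c, 'o, 'm) int_VMod_ob, ('c, 'm) int_VMod_ar,
    ('c, 'o, 'm) int_VMod_ob, ('c, 'm) int_VMod_ar) fnctr"

definition Mod ::
  "(('o, 'm) ebase, ('o, 'm, 'o, 'm) fnctr, ('c, 'o, 'm) int_VMod_t, ('c, 'o, 'm) int_VMod_fun_t) fnctr"
  where
  "Mod =
     mk_fun Enr int_VMod
       (\<lambda>V W F. mk_fun (int_VMod V) (bc_model V W F) (bc_model_ar V W F))"

end

theory Submission
  imports Defs
begin

text \<open>
  All enriched notions are read off generalized elements: for a \<open>V\<close>-category \<open>C\<close> and an object \<open>y\<close>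
  of \<open>V\<close>, the sets \<open>V(y, C(a, b))\<close> form an ordinary category, and by the Yoneda lemma associativity,
  naturality and universality of cones are equations and bijections in these categories. A functor
  \<open>F\<close> that preserves finite products transports such equations, because finitely many elements
  \<open>y \<rightarrow> F(X\<^sub>i)\<close> factor through a common \<open>y \<rightarrow> F(X\<^sub>1 \<times> \<dots> \<times> X\<^sub>n)\<close>. Product cones in \<open>F\<^sub>*(C)\<close> need
  not come from cones in \<open>C\<close>, but if \<open>C\<close> has the product of a list, then every product cone over it in \<open>F\<^sub>*(C)\<close> is isomorphic
  to the image of one in \<open>C\<close>; as a theory inherits products from \<open>A\<^sub>V\<close>, all functors involved keep
  preserving products. Finally, in a cartesian closed category \<open>n\<^sup>m\<close> is again a copower of \<open>1\<close>, with the
  names of the functions from \<open>m\<close> to \<open>n\<close> as injections, so the comparison of \<open>A\<^sub>W\<close> with \<open>F\<^sub>*(A\<^sub>V)\<close> can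
  be checked on names, where composition is composition of functions.
\<close>

section \<open>Categories and the Grothendieck construction\<close>

text \<open>\<open>Mod\<close> has to preserve identities and composites of base functors up to
  equality, although a base functor need not send the chosen products and exponentials of one base
  to those of the next. Two facts make this possible. The comparison \<open>prod_cmp\<close> is
  determined by its projections, so the comparison for a composite is the composite of the
  comparisons and the base changes agree exactly. The copowers \<open>num\<close> are preserved
  strictly, whereas the exponentials \<open>npow\<close> are not; \<open>A_cmp\<close> therefore
  passes through \<open>num\<close> by means of \<open>num_expo\<close>, and in a composite of two
  such maps the middle copies of \<open>num_expo\<close> cancel. The values \<open>undefined\<close>
  off the carriers then turn componentwise agreement into equality. Composition of arrows of
  \<open>A_vcat\<close> is tested on pairs of names, which suffices because a product of two
  copowers of the terminal object is again such a copower. The base-\<open>n\<close> digits in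
  \<open>num_expo\<close> fit an induction on \<open>m\<close>: one more factor
  \<open>num V n\<close> contributes a new lowest digit.\<close>

lemma mk_cat_sel [simp]:
  "Ob (mk_cat O' H I K) = O'"
  "Hom (mk_cat O' H I K) a b = (if a \<in> O' \<and> b \<in> O' then H a b else {})"
  "a \<in> O' \<Longrightarrow> Idt (mk_cat O' H I K) a = I a"
  "\<lbrakk>a \<in> O'; b \<in> O'; c \<in> O'; f \<in> H a b; g \<in> H b c\<rbrakk> \<Longrightarrow> Cmp (mk_cat O' H I K) a b c g f = K a b c g f"
  by (simp_all add: mk_cat_def)

lemma category_mk_cat:
  assumes "\<And>a. a \<in> O' \<Longrightarrow> I a \<in> H a a"
    and "\<And>a b c f g. \<lbrakk>a \<in> O'; b \<in> O'; c \<in> O'; f \<in> H a b; g \<in> H b c\<rbrakk> \<Longrightarrow> K a b c g f \<in> H a c"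
    and "\<And>a b f. \<lbrakk>a \<in> O'; b \<in> O'; f \<in> H a b\<rbrakk> \<Longrightarrow> K a b b (I b) f = f"
    and "\<And>a b f. \<lbrakk>a \<in> O'; b \<in> O'; f \<in> H a b\<rbrakk> \<Longrightarrow> K a a b f (I a) = f"
    and "\<And>a b c d f g h. \<lbrakk>a \<in> O'; b \<in> O'; c \<in> O'; d \<in> O'; f \<in> H a b; g \<in> H b c; h \<in> H c d\<rbrakk>
      \<Longrightarrow> K a c d h (K a b c g f) = K a b d (K b c d h g) f"
  shows "category (mk_cat O' H I K)"
  using assms unfolding category_def by (auto simp: mk_cat_def)

lemma category_Idt: "category C \<Longrightarrow> a \<in> Ob C \<Longrightarrow> Idt C a \<in> Hom C a a"
  unfolding category_def by metis

lemma category_Cmp: "category C \<Longrightarrow> f \<in> Hom C a b \<Longrightarrow> g \<in> Hom C b c \<Longrightarrow> Cmp C a b c g f \<in> Hom C a c"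
  unfolding category_def by metis

lemma category_unit:
  "category C \<Longrightarrow> f \<in> Hom C a b \<Longrightarrow> Cmp C a b b (Idt C b) f = f"
  "category C \<Longrightarrow> f \<in> Hom C a b \<Longrightarrow> Cmp C a a b f (Idt C a) = f"
  unfolding category_def by metis+

lemma category_assoc:
  "category C \<Longrightarrow> f \<in> Hom C a b \<Longrightarrow> g \<in> Hom C b c \<Longrightarrow> h \<in> Hom C c d \<Longrightarrow>
    Cmp C a b d (Cmp C b c d h g) f = Cmp C a c d h (Cmp C a b c g f)"
  unfolding category_def by metis

lemma category_Hom_Ob:
  assumes "category C" "f \<in> Hom C a b"
  shows "a \<in> Ob C" "b \<in> Ob C"
  using assms unfolding category_def by (metis empty_iff)+

lemma mk_fun_sel [simp]:
  "a \<in> Ob A \<Longrightarrow> fob (mk_fun A ob ar) a = ob a"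
  "f \<in> Hom A a b \<Longrightarrow> far (mk_fun A ob ar) a b f = ar a b f"
  by (simp_all add: mk_fun_def)

lemma mk_fun_cong:
  assumes "\<And>a. a \<in> Ob A \<Longrightarrow> ob a = ob' a" "\<And>a b f. f \<in> Hom A a b \<Longrightarrow> ar a b f = ar' a b f"
  shows "mk_fun A ob ar = mk_fun A ob' ar'"
  using assms by (auto simp: mk_fun_def fun_eq_iff)

lemma is_functor_mk_fun:
  assumes "category A" "category B"
    and "\<And>a. a \<in> Ob A \<Longrightarrow> ob a \<in> Ob B"
    and "\<And>a b f. f \<in> Hom A a b \<Longrightarrow> ar a b f \<in> Hom B (ob a) (ob b)"
    and "\<And>a. a \<in> Ob A \<Longrightarrow> ar a a (Idt A a) = Idt B (ob a)"
    and "\<And>a b c f g. f \<in> Hom A a b \<Longrightarrow> g \<in> Hom A b c \<Longrightarrow>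
      ar a c (Cmp A a b c g f) = Cmp B (ob a) (ob b) (ob c) (ar b c g) (ar a b f)"
  shows "is_functor A B (mk_fun A ob ar)"
  unfolding is_functor_def
proof (intro conjI allI ballI impI)
  fix a b f assume f: "f \<in> Hom A a b"
  then show "far (mk_fun A ob ar) a b f \<in> Hom B (fob (mk_fun A ob ar) a) (fob (mk_fun A ob ar) b)"
    using assms category_Hom_Ob[OF assms(1) f] by simp
next
  fix a b c f g assume fg: "f \<in> Hom A a b" "g \<in> Hom A b c"
  then show "far (mk_fun A ob ar) a c (Cmp A a b c g f) =
     Cmp B (fob (mk_fun A ob ar) a) (fob (mk_fun A ob ar) b) (fob (mk_fun A ob ar) c)
       (far (mk_fun A ob ar) b c g) (far (mk_fun A ob ar) a b f)"
    using assms category_Hom_Ob[OF assms(1)] category_Cmp[OF assms(1)] by auto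
qed (use assms category_Idt[OF assms(1)] in \<open>auto simp: mk_fun_def\<close>)

lemma is_functor_cat: "is_functor A B F \<Longrightarrow> category A" "is_functor A B F \<Longrightarrow> category B"
  by (simp_all add: is_functor_def)

lemma is_functor_fob: "is_functor A B F \<Longrightarrow> a \<in> Ob A \<Longrightarrow> fob F a \<in> Ob B"
  by (simp add: is_functor_def)

lemma is_functor_far:
  "is_functor A B F \<Longrightarrow> f \<in> Hom A a b \<Longrightarrow> far F a b f \<in> Hom B (fob F a) (fob F b)"
  by (simp add: is_functor_def)

lemma is_functor_Idt: "is_functor A B F \<Longrightarrow> a \<in> Ob A \<Longrightarrow> far F a a (Idt A a) = Idt B (fob F a)"
  by (simp add: is_functor_def)

lemma is_functor_Cmp:
  "is_functor A B F \<Longrightarrow> f \<in> Hom A a b \<Longrightarrow> g \<in> Hom A b c \<Longrightarrow>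
    far F a c (Cmp A a b c g f) =
    Cmp B (fob F a) (fob F b) (fob F c) (far F b c g) (far F a b f)"
  by (simp add: is_functor_def)

text \<open>The values off the carriers are fixed by clauses of \<open>is_functor\<close> that speak
  of the source only, so the two codomains need not be known to agree.\<close>

lemma functor_eqI:
  assumes "is_functor A B F" "is_functor A B' G"
    and "\<And>a. a \<in> Ob A \<Longrightarrow> fob F a = fob G a"
    and "\<And>a b f. f \<in> Hom A a b \<Longrightarrow> far F a b f = far G a b f"
  shows "F = G"
proof -
  have "fob F = fob G" using assms unfolding is_functor_def fun_eq_iff by metis
  moreover have "far F = far G" using assms unfolding is_functor_def fun_eq_iff by metis
  ultimately show ?thesis by simp
qed

lemma is_functor_id_fun: "category A \<Longrightarrow> is_functor A A (id_fun A)"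
  unfolding id_fun_def by (rule is_functor_mk_fun) auto

lemma is_functor_comp_fun:
  assumes F: "is_functor A B F" and G: "is_functor B C G"
  shows "is_functor A C (comp_fun A G F)"
  unfolding comp_fun_def
  by (rule is_functor_mk_fun)
    (auto simp: is_functor_cat[OF F] is_functor_cat[OF G] is_functor_fob[OF F] is_functor_fob[OF G]
      is_functor_far[OF F] is_functor_far[OF G] is_functor_Idt[OF F] is_functor_Idt[OF G]
      is_functor_Cmp[OF F] is_functor_Cmp[OF G])

lemma id_fun_sel [simp]:
  "a \<in> Ob A \<Longrightarrow> fob (id_fun A) a = a"
  "f \<in> Hom A a b \<Longrightarrow> far (id_fun A) a b f = f"
  by (simp_all add: id_fun_def)

lemma comp_fun_sel [simp]:
  "a \<in> Ob A \<Longrightarrow> fob (comp_fun A G F) a = fob G (fob F a)"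
  "f \<in> Hom A a b \<Longrightarrow> far (comp_fun A G F) a b f = far G (fob F a) (fob F b) (far F a b f)"
  by (simp_all add: comp_fun_def)

lemma comp_fun_unit:
  assumes "is_functor A B F"
  shows "comp_fun A (id_fun B) F = F" "comp_fun A F (id_fun A) = F"
  using assms is_functor_cat[OF assms]
  by (auto intro!: functor_eqI[where A = A] is_functor_comp_fun[where A = A] is_functor_id_fun
      simp: is_functor_fob is_functor_far category_Hom_Ob)

lemma comp_fun_assoc:
  assumes "is_functor A B F" "is_functor B C G" "is_functor C D H"
  shows "comp_fun A H (comp_fun A G F) = comp_fun A (comp_fun B H G) F"
  using assms is_functor_cat[OF assms(1)]
  by (auto intro!: functor_eqI[where A = A] is_functor_comp_fun
      simp: is_functor_fob is_functor_far category_Hom_Ob)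

lemma category_Cat: "category Cat"
  unfolding Cat_def
  by (rule category_mk_cat)
    (auto simp: is_functor_id_fun comp_fun_unit intro: is_functor_comp_fun comp_fun_assoc)

lemma Cat_sel [simp]:
  "A \<in> Ob Cat \<longleftrightarrow> category A"
  "F \<in> Hom Cat A B \<longleftrightarrow> is_functor A B F"
  "category A \<Longrightarrow> Idt Cat A = id_fun A"
  "is_functor A B F \<Longrightarrow> is_functor B C G \<Longrightarrow> Cmp Cat A B C G F = comp_fun A G F"
  by (auto simp: Cat_def is_functor_cat)

lemma category_op_cat: "category C \<Longrightarrow> category (op_cat C)"
  unfolding op_cat_def
  by (rule category_mk_cat) (auto simp: category_Idt category_Cmp category_unit category_assoc)

lemma op_cat_sel:
  assumes "category C"
  shows "Ob (op_cat C) = Ob C" "Hom (op_cat C) a b = Hom C b a"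
    "a \<in> Ob C \<Longrightarrow> Idt (op_cat C) a = Idt C a"
    "f \<in> Hom C b a \<Longrightarrow> g \<in> Hom C c b \<Longrightarrow> Cmp (op_cat C) a b c g f = Cmp C c b a f g"
  using category_Hom_Ob[OF assms] by (auto simp: op_cat_def)

lemma category_prod_cat: "category C \<Longrightarrow> category D \<Longrightarrow> category (prod_cat C D)"
  unfolding prod_cat_def
  by (rule category_mk_cat) (auto simp: category_Idt category_Cmp category_unit category_assoc)

lemma prod_cat_sel:
  assumes "category C" "category D"
  shows "Ob (prod_cat C D) = Ob C \<times> Ob D"
    "Hom (prod_cat C D) (a, a') (b, b') = Hom C a b \<times> Hom D a' b'"
    "a \<in> Ob C \<Longrightarrow> a' \<in> Ob D \<Longrightarrow> Idt (prod_cat C D) (a, a') = (Idt C a, Idt D a')"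
    "f \<in> Hom C a b \<Longrightarrow> g \<in> Hom C b c \<Longrightarrow> f' \<in> Hom D a' b' \<Longrightarrow> g' \<in> Hom D b' c' \<Longrightarrow>
      Cmp (prod_cat C D) (a, a') (b, b') (c, c') (g, g') (f, f') = (Cmp C a b c g f, Cmp D a' b' c' g' f')"
  using category_Hom_Ob[OF assms(1)] category_Hom_Ob[OF assms(2)] by (auto simp: prod_cat_def)

text \<open>In the hom clause \<open>x\<close> must be listed as an object: off its source a functor
  takes the value \<open>undefined\<close>, which may happen to be an object of the target. The
  other memberships follow from \<open>h\<close> and \<open>a\<close>, since hom-sets off the
  carrier are empty.\<close>

lemma groth_sel:
  assumes G: "is_functor D Cat G"
  shows "(d, x) \<in> Ob (groth D G) \<longleftrightarrow> d \<in> Ob D \<and> x \<in> Ob (fob G d)"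
    "(h, a) \<in> Hom (groth D G) (d, x) (d', x') \<longleftrightarrow>
      x \<in> Ob (fob G d) \<and> h \<in> Hom D d d' \<and> a \<in> Hom (fob G d') (fob (far G d d' h) x) x'"
    "d \<in> Ob D \<Longrightarrow> x \<in> Ob (fob G d) \<Longrightarrow> Idt (groth D G) (d, x) = (Idt D d, Idt (fob G d) x)"
    "(h', a') \<in> Hom (groth D G) (d0, x0) (d1, x1) \<Longrightarrow> (h, a) \<in> Hom (groth D G) (d1, x1) (d2, x2) \<Longrightarrow>
      Cmp (groth D G) (d0, x0) (d1, x1) (d2, x2) (h, a) (h', a') =
          (Cmp D d0 d1 d2 h h',
           Cmp (fob G d2)
             (fob (far G d1 d2 h) (fob (far G d0 d1 h') x0)) (fob (far G d1 d2 h) x1) x2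
             a (far (far G d1 d2 h) (fob (far G d0 d1 h') x0) x1 a'))"
proof -
  have cat: "d \<in> Ob D \<Longrightarrow> category (fob G d)" for d
    using is_functor_fob[OF G] by simp
  show "(d, x) \<in> Ob (groth D G) \<longleftrightarrow> d \<in> Ob D \<and> x \<in> Ob (fob G d)"
    by (simp add: groth_def)
  show "(h, a) \<in> Hom (groth D G) (d, x) (d', x') \<longleftrightarrow>
      x \<in> Ob (fob G d) \<and> h \<in> Hom D d d' \<and> a \<in> Hom (fob G d') (fob (far G d d' h) x) x'"
    using category_Hom_Ob[OF is_functor_cat(1)[OF G]] category_Hom_Ob[OF cat]
    by (auto simp: groth_def)
  show "d \<in> Ob D \<Longrightarrow> x \<in> Ob (fob G d) \<Longrightarrow> Idt (groth D G) (d, x) = (Idt D d, Idt (fob G d) x)"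
    by (simp add: groth_def)
  show "(h', a') \<in> Hom (groth D G) (d0, x0) (d1, x1) \<Longrightarrow> (h, a) \<in> Hom (groth D G) (d1, x1) (d2, x2) \<Longrightarrow>
      Cmp (groth D G) (d0, x0) (d1, x1) (d2, x2) (h, a) (h', a') =
          (Cmp D d0 d1 d2 h h',
           Cmp (fob G d2)
             (fob (far G d1 d2 h) (fob (far G d0 d1 h') x0)) (fob (far G d1 d2 h) x1) x2
             a (far (far G d1 d2 h) (fob (far G d0 d1 h') x0) x1 a'))"
    by (auto simp: groth_def split: if_splits)
qed

text \<open>Because \<open>G\<close> is a strict functor, reindexing along a composite equals
  reindexing twice, so the second components to be compared lie in one hom-set of the last fibre.
  What remains is functoriality of the reindexing functors and the category laws of that
  fibre.\<close>

lemma category_groth: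
  assumes G: "is_functor D Cat G"
  shows "category (groth D G)"
proof -
  note D = is_functor_cat(1)[OF G]
  have cat: "d \<in> Ob D \<Longrightarrow> category (fob G d)" for d
    using is_functor_fob[OF G] by simp
  have fn: "h \<in> Hom D d d' \<Longrightarrow> is_functor (fob G d) (fob G d') (far G d d' h)" for h d d'
    using is_functor_far[OF G] by simp
  have idt: "d \<in> Ob D \<Longrightarrow> far G d d (Idt D d) = id_fun (fob G d)" for d
    using is_functor_Idt[OF G] cat by simp
  have cmp: "h \<in> Hom D d d' \<Longrightarrow> h' \<in> Hom D d' d'' \<Longrightarrow>
      far G d d'' (Cmp D d d' d'' h' h) = comp_fun (fob G d) (far G d' d'' h') (far G d d' h)"
    for h h' d d' d''
    using is_functor_Cmp[OF G] fn by simp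
  show ?thesis
    unfolding groth_def
  proof (rule category_mk_cat, goal_cases)
    case (1 a)
    then show ?case by (auto simp: cat category_Idt D idt)
  next
    case (2 a b c f g)
    then show ?case
      by (auto simp: cmp category_Cmp[OF D] category_Cmp[OF cat] is_functor_far[OF fn])
  next
    case (3 a b f)
    then show ?case
      by (auto simp: idt cat category_unit[OF D] category_unit[OF cat] is_functor_fob[OF fn])
  next
    case (4 a b f)
    then show ?case
      by (auto simp: idt category_unit[OF D] category_unit[OF cat] is_functor_fob[OF fn] is_functor_Idt[OF fn])
  next
    case (5 a b c d f g h)
    then show ?case
      by (auto simp: cmp category_assoc[OF D] category_Cmp[OF cat] category_assoc[OF cat]
          is_functor_fob[OF fn] is_functor_far[OF fn] is_functor_Cmp[OF fn])
  qed
qed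

section \<open>Cartesian closed categories\<close>

lemma less_Suc_Suc_0: "i < Suc (Suc 0) \<longleftrightarrow> i = 0 \<or> i = Suc 0"
  by auto

text \<open>The point \<open>p\<close> regarded as an element of \<open>x\<close> at stage
  \<open>y\<close>; by \<open>bang_Cmp\<close> a change of stage leaves it constant.\<close>

abbreviation const_elt :: "('o, 'm) ebase \<Rightarrow> 'o \<Rightarrow> 'o \<Rightarrow> 'm \<Rightarrow> 'm" where
  "const_elt V y x p \<equiv> Cmp V y (one V) x p (bang V y)"

lemma is_product_cong:
  assumes "xs = xs'" "p = p'" "\<And>i. i < length xs' \<Longrightarrow> pr i = pr' i"
  shows "is_product C xs p pr \<longleftrightarrow> is_product C xs' p' pr'"
  using assms unfolding is_product_def by simp

text \<open>Evaluation on generalized elements: \<open>u\<close> is a function and \<open>s\<close>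
  an argument, both at stage \<open>z\<close>. It commutes with change of stage
  (\<open>app_Cmp\<close>), so equations between maps into exponentials become equations between
  values.\<close>

definition app :: "('o, 'm) ebase \<Rightarrow> 'o \<Rightarrow> 'o \<Rightarrow> 'o \<Rightarrow> 'm \<Rightarrow> 'm \<Rightarrow> 'm" where
  "app V z a b u s = Cmp V z (prd V [expo V b a, a]) b (ev V b a) (tuple V z [expo V b a, a] [u, s])"

locale base =
  fixes V :: "('o, 'm) ebase"
  assumes enriching_base: "enriching_base V"
begin

lemma category: "category V"
  using enriching_base by (simp add: enriching_base_def)

lemmas Idt_in [simp, intro] = category_Idt[OF category]
  and Cmp_in [simp] = category_Cmp[OF category]
  and unit [simp] = category_unit[OF category]
  and assoc [simp] = category_assoc[OF category]
  and Hom_Ob = category_Hom_Ob[OF category]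

text \<open>The simplifier nests composites to the right by \<open>assoc\<close>, and there an
  equation for the composite of \<open>h\<close> and \<open>g\<close> no longer matches. This turns
  such an equation into a rule for the nested form.\<close>

lemma reassoc:
  assumes "Cmp V b c d h g = k" "g \<in> Hom V b c" "h \<in> Hom V c d" "f \<in> Hom V a b"
  shows "Cmp V a c d h (Cmp V a b c g f) = Cmp V a b d k f"
  using assms assoc by metis

lemma inv_unique:
  assumes "inverse_in V a b f g" "inverse_in V a b f g'"
  shows "g = g'"
proof -
  from assms have *: "f \<in> Hom V a b" "g \<in> Hom V b a" "g' \<in> Hom V b a" by (auto simp: inverse_in_def)
  have "g = Cmp V b a a (Cmp V a b a g' f) g"
    using assms * by (simp add: inverse_in_def)
  also have "\<dots> = Cmp V b b a g' (Cmp V b a b f g)" using * by (simp only: assoc)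
  also have "\<dots> = g'" using assms * by (simp add: inverse_in_def)
  finally show ?thesis .
qed

lemma inv_in_eq: "inverse_in V a b f g \<Longrightarrow> inv_in V a b f = g"
  unfolding inv_in_def using inv_unique by blast

section \<open>Finite products and tuples\<close>

lemma is_product_prd: "set xs \<subseteq> Ob V \<Longrightarrow> is_product V xs (prd V xs) (prj V xs)"
  using enriching_base by (simp add: enriching_base_def)

lemma prd_Ob [simp]: "set xs \<subseteq> Ob V \<Longrightarrow> prd V xs \<in> Ob V"
  using is_product_prd[of xs] by (simp add: is_product_def)

lemma prj_in [simp]: "set xs \<subseteq> Ob V \<Longrightarrow> i < length xs \<Longrightarrow> prj V xs i \<in> Hom V (prd V xs) (xs ! i)"
  using is_product_prd[of xs] by (simp add: is_product_def)

lemma is_product_Ob: "is_product V xs p pr \<Longrightarrow> p \<in> Ob V"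
  by (simp add: is_product_def)

lemma is_product_in: "is_product V xs p pr \<Longrightarrow> i < length xs \<Longrightarrow> pr i \<in> Hom V p (xs ! i)"
  by (simp add: is_product_def)

lemma is_product_ex1:
  assumes "is_product V xs p pr" "y \<in> Ob V" "\<And>i. i < length xs \<Longrightarrow> f i \<in> Hom V y (xs ! i)"
  shows "\<exists>!u. u \<in> Hom V y p \<and> (\<forall>i<length xs. Cmp V y p (xs ! i) (pr i) u = f i)"
  using assms by (simp add: is_product_def)

lemma is_product_ex:
  assumes "is_product V xs p pr" "y \<in> Ob V" "\<And>i. i < length xs \<Longrightarrow> f i \<in> Hom V y (xs ! i)"
  obtains u where "u \<in> Hom V y p" "\<And>i. i < length xs \<Longrightarrow> Cmp V y p (xs ! i) (pr i) u = f i"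
  using is_product_ex1[OF assms] by blast

lemma is_product_ext:
  assumes p: "is_product V xs p pr" and u: "u \<in> Hom V y p" "u' \<in> Hom V y p"
    and eq: "\<And>i. i < length xs \<Longrightarrow> Cmp V y p (xs ! i) (pr i) u = Cmp V y p (xs ! i) (pr i) u'"
  shows "u = u'"
proof -
  have "\<exists>!w. w \<in> Hom V y p \<and> (\<forall>i<length xs. Cmp V y p (xs ! i) (pr i) w = Cmp V y p (xs ! i) (pr i) u)"
    using Hom_Ob(1)[OF u(1)] u is_product_in[OF p] by (intro is_product_ex1[OF p]) auto
  then show ?thesis using u eq by auto
qed

lemma is_product_iso:
  assumes p: "is_product V xs p pr" and q: "is_product V xs q qr"
  obtains e e' where "inverse_in V p q e e'" "\<And>i. i < length xs \<Longrightarrow> Cmp V p q (xs ! i) (qr i) e = pr i"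
    "\<And>i. i < length xs \<Longrightarrow> Cmp V q p (xs ! i) (pr i) e' = qr i"
proof -
  note pq [simp] = is_product_Ob[OF p] is_product_Ob[OF q] is_product_in[OF p] is_product_in[OF q]
  obtain e where e: "e \<in> Hom V p q" "\<And>i. i < length xs \<Longrightarrow> Cmp V p q (xs ! i) (qr i) e = pr i"
    using is_product_ex[OF q, of p pr] by auto
  obtain e' where e': "e' \<in> Hom V q p" "\<And>i. i < length xs \<Longrightarrow> Cmp V q p (xs ! i) (pr i) e' = qr i"
    using is_product_ex[OF p, of q qr] by auto
  have "Cmp V p q p e' e = Idt V p"
    by (rule is_product_ext[OF p]) (use e e' in \<open>auto simp flip: assoc simp del: assoc\<close>)
  moreover have "Cmp V q p q e e' = Idt V q"
    by (rule is_product_ext[OF q]) (use e e' in \<open>auto simp flip: assoc simp del: assoc\<close>)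
  ultimately show ?thesis using that e e' by (auto simp: inverse_in_def)
qed

lemma tuple_spec:
  assumes "set xs \<subseteq> Ob V" "y \<in> Ob V" "\<And>i. i < length xs \<Longrightarrow> fs ! i \<in> Hom V y (xs ! i)"
  shows "tuple V y xs fs \<in> Hom V y (prd V xs) \<and>
    (\<forall>i<length xs. Cmp V y (prd V xs) (xs ! i) (prj V xs i) (tuple V y xs fs) = fs ! i)"
proof -
  have "\<exists>!u. u \<in> Hom V y (prd V xs) \<and> (\<forall>i<length xs. Cmp V y (prd V xs) (xs ! i) (prj V xs i) u = fs ! i)"
    using assms by (intro is_product_ex1[OF is_product_prd])
  then show ?thesis unfolding tuple_def by (rule theI')
qed

lemma tuple_in:
  assumes "set xs \<subseteq> Ob V" "y \<in> Ob V" "\<And>i. i < length xs \<Longrightarrow> fs ! i \<in> Hom V y (xs ! i)"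
  shows "tuple V y xs fs \<in> Hom V y (prd V xs)"
  using tuple_spec[OF assms] by simp

lemma prj_tuple:
  assumes "set xs \<subseteq> Ob V" "y \<in> Ob V" "\<And>i. i < length xs \<Longrightarrow> fs ! i \<in> Hom V y (xs ! i)" "i < length xs"
  shows "Cmp V y (prd V xs) (xs ! i) (prj V xs i) (tuple V y xs fs) = fs ! i"
  using tuple_spec[OF assms(1-3)] assms(4) by simp

lemma prd_ext:
  assumes "set xs \<subseteq> Ob V" "u \<in> Hom V y (prd V xs)" "u' \<in> Hom V y (prd V xs)"
    and "\<And>i. i < length xs \<Longrightarrow> Cmp V y (prd V xs) (xs ! i) (prj V xs i) u = Cmp V y (prd V xs) (xs ! i) (prj V xs i) u'"
  shows "u = u'"
  by (rule is_product_ext[OF is_product_prd]) (use assms in auto)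

lemma prj2_in [simp]:
  "a \<in> Ob V \<Longrightarrow> b \<in> Ob V \<Longrightarrow> prj V [a, b] 0 \<in> Hom V (prd V [a, b]) a"
  "a \<in> Ob V \<Longrightarrow> b \<in> Ob V \<Longrightarrow> prj V [a, b] (Suc 0) \<in> Hom V (prd V [a, b]) b"
  using prj_in[of "[a, b]" 0] prj_in[of "[a, b]" "Suc 0"] by simp_all

lemma tuple2_in [simp]:
  assumes "f \<in> Hom V y a" "g \<in> Hom V y b"
  shows "tuple V y [a, b] [f, g] \<in> Hom V y (prd V [a, b])"
  by (rule tuple_in) (use assms Hom_Ob in \<open>auto simp: less_Suc_Suc_0\<close>)

lemma prj_tuple2 [simp]:
  assumes "f \<in> Hom V y a" "g \<in> Hom V y b"
  shows "Cmp V y (prd V [a, b]) a (prj V [a, b] 0) (tuple V y [a, b] [f, g]) = f"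
    "Cmp V y (prd V [a, b]) b (prj V [a, b] (Suc 0)) (tuple V y [a, b] [f, g]) = g"
proof -
  have "a \<in> Ob V" "b \<in> Ob V" "y \<in> Ob V" using assms Hom_Ob by blast+
  moreover have "[f, g] ! i \<in> Hom V y ([a, b] ! i)" if "i < length [a, b]" for i
    using that assms by (auto simp: less_Suc_Suc_0)
  ultimately show "Cmp V y (prd V [a, b]) a (prj V [a, b] 0) (tuple V y [a, b] [f, g]) = f"
    "Cmp V y (prd V [a, b]) b (prj V [a, b] (Suc 0)) (tuple V y [a, b] [f, g]) = g"
    using prj_tuple[of "[a, b]" y "[f, g]" 0] prj_tuple[of "[a, b]" y "[f, g]" "Suc 0"] by auto
qed

lemma prd2_ext:
  assumes "a \<in> Ob V" "b \<in> Ob V" "u \<in> Hom V y (prd V [a, b])" "u' \<in> Hom V y (prd V [a, b])"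
    and "Cmp V y (prd V [a, b]) a (prj V [a, b] 0) u = Cmp V y (prd V [a, b]) a (prj V [a, b] 0) u'"
    and "Cmp V y (prd V [a, b]) b (prj V [a, b] (Suc 0)) u = Cmp V y (prd V [a, b]) b (prj V [a, b] (Suc 0)) u'"
  shows "u = u'"
  by (rule prd_ext[of "[a, b]"]) (use assms in \<open>auto simp: less_Suc_Suc_0\<close>)

lemma tuple2_Cmp [simp]:
  assumes [simp]: "u \<in> Hom V z y" "f \<in> Hom V y a" "g \<in> Hom V y b"
  shows "Cmp V z y (prd V [a, b]) (tuple V y [a, b] [f, g]) u = tuple V z [a, b] [Cmp V z y a f u, Cmp V z y b g u]"
proof -
  have [simp]: "a \<in> Ob V" "b \<in> Ob V" using Hom_Ob assms by blast+
  show ?thesis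
    by (rule prd2_ext[of a b _ z]) (auto simp: reassoc[OF prj_tuple2(1)] reassoc[OF prj_tuple2(2)])
qed

lemma tuple2_eta [simp]:
  assumes "u \<in> Hom V y (prd V [a, b])" "a \<in> Ob V" "b \<in> Ob V"
  shows "tuple V y [a, b] [Cmp V y (prd V [a, b]) a (prj V [a, b] 0) u, Cmp V y (prd V [a, b]) b (prj V [a, b] (Suc 0)) u] = u"
  by (rule prd2_ext[of a b]) (use assms in auto)

lemma tuple2_prj [simp]:
  "a \<in> Ob V \<Longrightarrow> b \<in> Ob V \<Longrightarrow> tuple V (prd V [a, b]) [a, b] [prj V [a, b] 0, prj V [a, b] (Suc 0)] = Idt V (prd V [a, b])"
  by (rule prd2_ext[of a b]) auto

lemma prod_map2:
  "prod_map V [a, b] ys [f, g] =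
    tuple V (prd V [a, b]) ys
      [Cmp V (prd V [a, b]) a (ys ! 0) f (prj V [a, b] 0), Cmp V (prd V [a, b]) b (ys ! Suc 0) g (prj V [a, b] (Suc 0))]"
  by (simp add: prod_map_def upt_rec)

lemma bang_in [simp]: "y \<in> Ob V \<Longrightarrow> bang V y \<in> Hom V y (one V)"
  unfolding bang_def by (rule tuple_in) auto

lemma bang_unique: "f \<in> Hom V y (one V) \<Longrightarrow> f = bang V y"
  by (rule prd_ext[of "[]"]) (use Hom_Ob(1) in auto)

lemma bang_Cmp [simp]: "u \<in> Hom V z y \<Longrightarrow> Cmp V z y (one V) (bang V y) u = bang V z"
  by (rule bang_unique) (use Hom_Ob in auto)

lemma bang_one [simp]: "bang V (one V) = Idt V (one V)"
  by (rule bang_unique[symmetric]) simp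

section \<open>Exponentials through evaluation of generalized elements\<close>

lemma expo_Ob [simp]: "a \<in> Ob V \<Longrightarrow> b \<in> Ob V \<Longrightarrow> expo V b a \<in> Ob V"
  and ev_in [simp]: "a \<in> Ob V \<Longrightarrow> b \<in> Ob V \<Longrightarrow> ev V b a \<in> Hom V (prd V [expo V b a, a]) b"
  and curried_ex1: "a \<in> Ob V \<Longrightarrow> b \<in> Ob V \<Longrightarrow> x \<in> Ob V \<Longrightarrow> f \<in> Hom V (prd V [x, a]) b \<Longrightarrow> \<exists>!u. curried V x a b f u"
  using enriching_base unfolding enriching_base_def by simp_all

lemma app_in [simp]:
  "u \<in> Hom V z (expo V b a) \<Longrightarrow> s \<in> Hom V z a \<Longrightarrow> b \<in> Ob V \<Longrightarrow> app V z a b u s \<in> Hom V z b"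
  using Hom_Ob unfolding app_def by simp

lemma app_Cmp [simp]:
  assumes "t \<in> Hom V w z" "u \<in> Hom V z (expo V b a)" "s \<in> Hom V z a" "b \<in> Ob V"
  shows "Cmp V w z b (app V z a b u s) t = app V w a b (Cmp V w z (expo V b a) u t) (Cmp V w z a s t)"
proof -
  have "a \<in> Ob V" using assms Hom_Ob by blast+
  then show ?thesis using assms unfolding app_def by simp
qed

lemma curried_iff:
  assumes "a \<in> Ob V" "b \<in> Ob V" "x \<in> Ob V"
  shows "curried V x a b f u \<longleftrightarrow> u \<in> Hom V x (expo V b a) \<and>
    app V (prd V [x, a]) a b (Cmp V (prd V [x, a]) x (expo V b a) u (prj V [x, a] 0)) (prj V [x, a] (Suc 0)) = f"
  using assms by (auto simp: curried_def app_def prod_map2)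

lemma curry_in [simp]:
  assumes "a \<in> Ob V" "b \<in> Ob V" "x \<in> Ob V" "f \<in> Hom V (prd V [x, a]) b"
  shows "curry' V x a b f \<in> Hom V x (expo V b a)"
  using theI'[OF curried_ex1[OF assms]] by (simp add: curry'_def curried_def)

text \<open>The beta law at an arbitrary stage: the defining equation of \<open>curry'\<close> holds
  at stage \<open>prd V [x, a]\<close> and is precomposed with the pair of \<open>u\<close> and
  \<open>s\<close>.\<close>

lemma app_curry [simp]:
  assumes "a \<in> Ob V" "b \<in> Ob V" "x \<in> Ob V" "f \<in> Hom V (prd V [x, a]) b" "u \<in> Hom V z x" "s \<in> Hom V z a"
  shows "app V z a b (Cmp V z x (expo V b a) (curry' V x a b f) u) s = Cmp V z (prd V [x, a]) b f (tuple V z [x, a] [u, s])"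
proof -
  have "curried V x a b f (curry' V x a b f)"
    unfolding curry'_def by (rule theI'[OF curried_ex1[OF assms(1-4)]])
  then have f: "f = app V (prd V [x, a]) a b (Cmp V (prd V [x, a]) x (expo V b a) (curry' V x a b f) (prj V [x, a] 0)) (prj V [x, a] (Suc 0))"
    using assms by (simp add: curried_iff)
  show ?thesis
    \<comment> \<open>Only the occurrence of \<open>f\<close> outside \<open>curry'\<close> is
      expanded.\<close>
    using assms by (subst (2) f) simp
qed

text \<open>Both sides are transposes of one and the same map on \<open>prd V [x, a]\<close>, and
  transposes are unique.\<close>

lemma expo_ext:
  assumes "a \<in> Ob V" "b \<in> Ob V" "u \<in> Hom V x (expo V b a)" "u' \<in> Hom V x (expo V b a)"
    and "app V (prd V [x, a]) a b (Cmp V (prd V [x, a]) x (expo V b a) u (prj V [x, a] 0)) (prj V [x, a] (Suc 0)) =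
      app V (prd V [x, a]) a b (Cmp V (prd V [x, a]) x (expo V b a) u' (prj V [x, a] 0)) (prj V [x, a] (Suc 0))"
  shows "u = u'"
proof -
  have [simp]: "x \<in> Ob V" using assms Hom_Ob by blast+
  let ?f = "app V (prd V [x, a]) a b (Cmp V (prd V [x, a]) x (expo V b a) u (prj V [x, a] 0)) (prj V [x, a] (Suc 0))"
  have "\<exists>!u. curried V x a b ?f u" using assms by (intro curried_ex1) auto
  then show ?thesis using assms by (auto simp: curried_iff)
qed

subsection \<open>Copowers of the terminal object\<close>

abbreviation copower :: "nat \<Rightarrow> 'o \<Rightarrow> (nat \<Rightarrow> 'm) \<Rightarrow> bool" where
  "copower k A p \<equiv> is_coproduct V (replicate k (one V)) A p"

lemma copower_num: "copower n (num V n) (inj V n)"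
  using enriching_base by (simp add: enriching_base_def)

lemma copower_Ob: "copower k A p \<Longrightarrow> A \<in> Ob V"
  and copower_in: "copower k A p \<Longrightarrow> i < k \<Longrightarrow> p i \<in> Hom V (one V) A"
  by (auto simp: is_coproduct_def)

lemma copower_ex1:
  assumes "copower k A p" "\<And>i. i < k \<Longrightarrow> g i \<in> Hom V (one V) X" "X \<in> Ob V"
  shows "\<exists>!h. h \<in> Hom V A X \<and> (\<forall>i<k. Cmp V (one V) A X h (p i) = g i)"
proof -
  have "\<exists>!u. u \<in> Hom V A X \<and> (\<forall>i<length (replicate k (one V)).
      Cmp V (replicate k (one V) ! i) A X u (p i) = g i)"
    using assms unfolding is_coproduct_def by auto
  moreover have "(\<forall>i<length (replicate k (one V)). Cmp V (replicate k (one V) ! i) A X u (p i) = g i) \<longleftrightarrow>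
      (\<forall>i<k. Cmp V (one V) A X u (p i) = g i)" for u by auto
  ultimately show ?thesis by simp
qed

lemma copower_ext:
  assumes "copower k A p" "h \<in> Hom V A X" "h' \<in> Hom V A X"
    "\<And>i. i < k \<Longrightarrow> Cmp V (one V) A X h (p i) = Cmp V (one V) A X h' (p i)"
  shows "h = h'"
  using copower_ex1[of k A p "\<lambda>i. Cmp V (one V) A X h (p i)" X] assms Hom_Ob copower_in[OF assms(1)]
  by (metis Cmp_in)

lemma copowerI:
  assumes "A \<in> Ob V" "\<And>i. i < k \<Longrightarrow> p i \<in> Hom V (one V) A"
    and "\<And>g X. X \<in> Ob V \<Longrightarrow> (\<And>i. i < k \<Longrightarrow> g i \<in> Hom V (one V) X) \<Longrightarrow>
      \<exists>h. h \<in> Hom V A X \<and> (\<forall>i<k. Cmp V (one V) A X h (p i) = g i)"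
    and "\<And>h h' X. h \<in> Hom V A X \<Longrightarrow> h' \<in> Hom V A X \<Longrightarrow>
       (\<And>i. i < k \<Longrightarrow> Cmp V (one V) A X h (p i) = Cmp V (one V) A X h' (p i)) \<Longrightarrow> h = h'"
  shows "copower k A p"
  unfolding is_coproduct_def
proof (intro conjI allI impI ballI)
  fix X f assume X: "X \<in> Ob V" and f: "\<forall>i<length (replicate k (one V)). f i \<in> Hom V (replicate k (one V) ! i) X"
  then have "\<exists>h. h \<in> Hom V A X \<and> (\<forall>i<k. Cmp V (one V) A X h (p i) = f i)"
    by (intro assms(3)) auto
  then show "\<exists>!u. u \<in> Hom V A X \<and> (\<forall>i<length (replicate k (one V)). Cmp V (replicate k (one V) ! i) A X u (p i) = f i)"
    using assms(4)[of _ X] by (auto 4 3)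
qed (use assms in auto)

lemma cotuple_spec:
  assumes "\<And>i. i < n \<Longrightarrow> f i \<in> Hom V (one V) X" "X \<in> Ob V"
  shows "cotuple V n X f \<in> Hom V (num V n) X \<and>
    (\<forall>i<n. Cmp V (one V) (num V n) X (cotuple V n X f) (inj V n i) = f i)"
  unfolding cotuple_def using copower_ex1[OF copower_num assms] by (rule theI')

lemmas cotuple_in = cotuple_spec[THEN conjunct1]
  and cotuple_inj = cotuple_spec[THEN conjunct2, rule_format]

lemma num_Ob [simp]: "num V n \<in> Ob V"
  using copower_num by (rule copower_Ob)

lemma inj_in [simp]: "i < n \<Longrightarrow> inj V n i \<in> Hom V (one V) (num V n)"
  using copower_num by (rule copower_in)

text \<open>Since products distribute over coproducts, \<open>A \<times> y\<close> is a copower of \<open>y\<close>.\<close>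

lemma copower_prd_ext:
  assumes A: "copower k A p" and y: "y \<in> Ob V"
    and h: "h \<in> Hom V (prd V [A, y]) X" "h' \<in> Hom V (prd V [A, y]) X"
    and eq: "\<And>i. i < k \<Longrightarrow>
      Cmp V y (prd V [A, y]) X h (tuple V y [A, y] [const_elt V y A (p i), Idt V y]) =
      Cmp V y (prd V [A, y]) X h' (tuple V y [A, y] [const_elt V y A (p i), Idt V y])"
  shows "h = h'"
proof -
  note [simp] = copower_Ob[OF A] copower_in[OF A] y h
  have X [simp]: "X \<in> Ob V" using Hom_Ob h by blast+
  have "curry' V A y X h = curry' V A y X h'"
  proof (rule copower_ext[OF A, of _ "expo V X y"])
    fix i assume i [simp]: "i < k"
    \<comment> \<open>The \<open>i\<close>-th slice of \<open>prd V [A, y]\<close>, reparametrised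
      from \<open>y\<close> to \<open>prd V [one V, y]\<close>, which is the stage at which two
      points of the exponential are compared.\<close>
    let ?s = "tuple V (prd V [one V, y]) [A, y]
      [const_elt V (prd V [one V, y]) A (p i), prj V [one V, y] (Suc 0)]"
    have 1: "prj V [one V, y] 0 = bang V (prd V [one V, y])"
      by (rule bang_unique) simp
    have s: "?s = Cmp V (prd V [one V, y]) y (prd V [A, y]) (tuple V y [A, y] [const_elt V y A (p i), Idt V y])
       (prj V [one V, y] (Suc 0))" by simp
    show "Cmp V (one V) A (expo V X y) (curry' V A y X h) (p i) = Cmp V (one V) A (expo V X y) (curry' V A y X h') (p i)"
    proof (rule expo_ext[of y X])
      have "Cmp V (prd V [one V, y]) (prd V [A, y]) X h ?s = Cmp V (prd V [one V, y]) (prd V [A, y]) X h' ?s"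
        unfolding s by (subst (1 2) assoc[symmetric]) (auto simp: eq)
      then show "app V (prd V [one V, y]) y X (Cmp V (prd V [one V, y]) (one V) (expo V X y)
          (Cmp V (one V) A (expo V X y) (curry' V A y X h) (p i)) (prj V [one V, y] 0)) (prj V [one V, y] (Suc 0)) =
        app V (prd V [one V, y]) y X (Cmp V (prd V [one V, y]) (one V) (expo V X y)
          (Cmp V (one V) A (expo V X y) (curry' V A y X h') (p i)) (prj V [one V, y] 0)) (prj V [one V, y] (Suc 0))"
        by (simp add: 1)
    qed auto
  qed auto
  then have "app V (prd V [A, y]) y X (Cmp V (prd V [A, y]) A (expo V X y) (curry' V A y X h) (prj V [A, y] 0)) (prj V [A, y] (Suc 0)) =
    app V (prd V [A, y]) y X (Cmp V (prd V [A, y]) A (expo V X y) (curry' V A y X h') (prj V [A, y] 0)) (prj V [A, y] (Suc 0))"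
    by simp
  then show ?thesis by simp
qed

lemma copower_prd_ex:
  assumes A: "copower k A p" and y: "y \<in> Ob V" "X \<in> Ob V" and g: "\<And>i. i < k \<Longrightarrow> g i \<in> Hom V y X"
  obtains h where "h \<in> Hom V (prd V [A, y]) X"
    "\<And>i z t. i < k \<Longrightarrow> t \<in> Hom V z y \<Longrightarrow>
      Cmp V z (prd V [A, y]) X h (tuple V z [A, y] [const_elt V z A (p i), t]) = Cmp V z y X (g i) t"
proof -
  note [simp] = copower_Ob[OF A] copower_in[OF A] y g
  \<comment> \<open>The transposes of the maps \<open>g i\<close>, as points of the exponential. The
    copower property of \<open>A\<close> glues them to one map, whose evaluation is the map
    sought.\<close>
  let ?c = "\<lambda>i. curry' V (one V) y X (Cmp V (prd V [one V, y]) y X (g i) (prj V [one V, y] (Suc 0)))"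
  obtain h where h [simp]: "h \<in> Hom V A (expo V X y)" "\<And>i. i < k \<Longrightarrow> Cmp V (one V) A (expo V X y) h (p i) = ?c i"
    using copower_ex1[OF A, of ?c "expo V X y"] by auto
  let ?h = "app V (prd V [A, y]) y X (Cmp V (prd V [A, y]) A (expo V X y) h (prj V [A, y] 0)) (prj V [A, y] (Suc 0))"
  show ?thesis
  proof
    fix i z t assume i [simp]: "i < k" and t [simp]: "t \<in> Hom V z y"
    have [simp]: "z \<in> Ob V" using Hom_Ob t by blast+
    have "Cmp V z A (expo V X y) h (const_elt V z A (p i)) = const_elt V z (expo V X y) (?c i)"
      by (subst assoc[symmetric]) (auto simp del: assoc)
    then show "Cmp V z (prd V [A, y]) X ?h (tuple V z [A, y] [const_elt V z A (p i), t]) = Cmp V z y X (g i) t"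
      by simp
  qed simp
qed

text \<open>A map out of \<open>prd V [A, B]\<close> is a family of \<open>k\<close> maps out of
  \<open>B\<close>, and each of these is a family of \<open>l\<close> points. The index of a pair
  carries the index in \<open>A\<close> as its lowest digit in base \<open>k\<close>, which is what
  produces digit expansions in \<open>power_copower\<close>.\<close>

lemma copower_prd:
  assumes A: "copower k A p" and B: "copower l B q"
  shows "copower (k * l) (prd V [A, B]) (\<lambda>j. tuple V (one V) [A, B] [p (j mod k), q (j div k)])"
proof (rule copowerI)
  note [simp] = copower_Ob[OF A] copower_in[OF A] copower_Ob[OF B] copower_in[OF B]
  show "prd V [A, B] \<in> Ob V" by simp
  have mod [simp]: "j mod k < k" "j div k < l" if "j < k * l" for j
    using that by (cases k; auto simp: less_mult_imp_div_less mult.commute)+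
  have idx: "i + k * j < k * l" if "i < k" "j < l" for i j
  proof -
    have "i + k * j < k * Suc j" using that by simp
    also have "\<dots> \<le> k * l" using that by (intro mult_le_mono2) simp
    finally show ?thesis .
  qed
  show "tuple V (one V) [A, B] [p (j mod k), q (j div k)] \<in> Hom V (one V) (prd V [A, B])" if "j < k * l" for j
    using that by simp
  show "\<exists>h. h \<in> Hom V (prd V [A, B]) X \<and> (\<forall>j<k * l. Cmp V (one V) (prd V [A, B]) X h
      (tuple V (one V) [A, B] [p (j mod k), q (j div k)]) = g j)"
    if [simp]: "X \<in> Ob V" "\<And>i. i < k * l \<Longrightarrow> g i \<in> Hom V (one V) X" for g X
  proof -
    have "\<forall>i\<in>{..<k}. \<exists>u. u \<in> Hom V B X \<and> (\<forall>j<l. Cmp V (one V) B X u (q j) = g (i + k * j))"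
    proof
      fix i assume "i \<in> {..<k}"
      then show "\<exists>u. u \<in> Hom V B X \<and> (\<forall>j<l. Cmp V (one V) B X u (q j) = g (i + k * j))"
        using copower_ex1[OF B, of "\<lambda>j. g (i + k * j)" X] idx by auto
    qed
    then obtain u where u [simp]: "\<And>i. i < k \<Longrightarrow> u i \<in> Hom V B X"
      "\<And>i j. i < k \<Longrightarrow> j < l \<Longrightarrow> Cmp V (one V) B X (u i) (q j) = g (i + k * j)"
      by (metis lessThan_iff)
    from copower_prd_ex[OF A, of B X u] obtain h where h: "h \<in> Hom V (prd V [A, B]) X"
      "\<And>i z t. i < k \<Longrightarrow> t \<in> Hom V z B \<Longrightarrow>
         Cmp V z (prd V [A, B]) X h (tuple V z [A, B] [const_elt V z A (p i), t]) = Cmp V z B X (u i) t"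
      by auto
    have "Cmp V (one V) (prd V [A, B]) X h (tuple V (one V) [A, B] [p (j mod k), q (j div k)]) = g j" if "j < k * l" for j
      using h(2)[of "j mod k" "q (j div k)" "one V"] that by simp
    then show ?thesis using h by auto
  qed
  show "h = h'"
    if [simp]: "h \<in> Hom V (prd V [A, B]) X" "h' \<in> Hom V (prd V [A, B]) X"
    and eq: "\<And>i. i < k * l \<Longrightarrow> Cmp V (one V) (prd V [A, B]) X h (tuple V (one V) [A, B] [p (i mod k), q (i div k)]) =
       Cmp V (one V) (prd V [A, B]) X h' (tuple V (one V) [A, B] [p (i mod k), q (i div k)])" for h h' X
  proof (rule copower_prd_ext[OF A, of B _ X])
    fix i assume i [simp]: "i < k"
    then have [simp]: "0 < k" by (rule le_less_trans[rotated]) simp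
    show "Cmp V B (prd V [A, B]) X h (tuple V B [A, B] [const_elt V B A (p i), Idt V B]) =
         Cmp V B (prd V [A, B]) X h' (tuple V B [A, B] [const_elt V B A (p i), Idt V B])"
    proof (rule copower_ext[OF B, of _ X])
      fix j assume [simp]: "j < l"
      from eq[OF idx[of i j]]
      show "Cmp V (one V) B X (Cmp V B (prd V [A, B]) X h (tuple V B [A, B] [const_elt V B A (p i), Idt V B])) (q j) =
        Cmp V (one V) B X (Cmp V B (prd V [A, B]) X h' (tuple V B [A, B] [const_elt V B A (p i), Idt V B])) (q j)"
        by (simp add: div_add1_eq mult.commute)
    qed auto
  qed auto
qed

lemma copower_iso:
  assumes A: "copower k A p" and e: "inverse_in V A B e e'" and q: "\<And>i. i < k \<Longrightarrow> q i = Cmp V (one V) A B e (p i)"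
  shows "copower k B q"
proof -
  note [simp] = copower_Ob[OF A] copower_in[OF A] q
  have e [simp]: "e \<in> Hom V A B" "e' \<in> Hom V B A" "Cmp V A B A e' e = Idt V A" "Cmp V B A B e e' = Idt V B"
    using e by (auto simp: inverse_in_def)
  have [simp]: "B \<in> Ob V" using Hom_Ob e by blast+
  have ee: "Cmp V y B A e' (Cmp V y A B e u) = u" if "u \<in> Hom V y A" for u y
    using that by (simp add: reassoc[OF e(3)])
  show ?thesis
  proof (rule copowerI)
    fix g X assume X [simp]: "X \<in> Ob V" "\<And>i. i < k \<Longrightarrow> g i \<in> Hom V (one V) X"
    from copower_ex1[OF A, of g X] obtain h where h: "h \<in> Hom V A X" "\<forall>i<k. Cmp V (one V) A X h (p i) = g i" by auto
    then show "\<exists>h. h \<in> Hom V B X \<and> (\<forall>i<k. Cmp V (one V) B X h (q i) = g i)"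
      by (intro exI[of _ "Cmp V B A X h e'"]) (simp add: ee)
  next
    fix h h' X assume h [simp]: "h \<in> Hom V B X" "h' \<in> Hom V B X"
      and eq: "\<And>i. i < k \<Longrightarrow> Cmp V (one V) B X h (q i) = Cmp V (one V) B X h' (q i)"
    have "Cmp V A B X h e = Cmp V A B X h' e"
      by (rule copower_ext[OF A, of _ X]) (use eq in auto)
    then have "Cmp V B A X (Cmp V A B X h e) e' = Cmp V B A X (Cmp V A B X h' e) e'" by simp
    then show "h = h'" by simp
  qed auto
qed

text \<open>After an exchange of factors \<open>u\<close> becomes a map out of
  \<open>prd V [A, y]\<close>. Such a map is determined by its slices at the points of
  \<open>A\<close>, and these slices are the values of \<open>u\<close> there.\<close>

lemma copower_expo_ext:
  assumes A: "copower k A p" and X: "X \<in> Ob V" and u: "u \<in> Hom V y (expo V X A)" "u' \<in> Hom V y (expo V X A)"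
    and eq: "\<And>i. i < k \<Longrightarrow> app V y A X u (const_elt V y A (p i)) = app V y A X u' (const_elt V y A (p i))"
  shows "u = u'"
proof (rule expo_ext[of A X])
  note [simp] = copower_Ob[OF A] copower_in[OF A] X u
  show "A \<in> Ob V" "X \<in> Ob V" "u \<in> Hom V y (expo V X A)" "u' \<in> Hom V y (expo V X A)" by simp_all
  have y [simp]: "y \<in> Ob V" using Hom_Ob u by blast+
  let ?h = "\<lambda>u. app V (prd V [A, y]) A X (Cmp V (prd V [A, y]) y (expo V X A) u (prj V [A, y] (Suc 0))) (prj V [A, y] 0)"
  let ?s = "tuple V (prd V [y, A]) [A, y] [prj V [y, A] (Suc 0), prj V [y, A] 0]"
  have "?h u = ?h u'"
    by (rule copower_prd_ext[OF A y, of _ X]) (auto simp: eq)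
  then have "Cmp V (prd V [y, A]) (prd V [A, y]) X (?h u) ?s = Cmp V (prd V [y, A]) (prd V [A, y]) X (?h u') ?s"
    by (simp only:)
  then show "app V (prd V [y, A]) A X (Cmp V (prd V [y, A]) y (expo V X A) u (prj V [y, A] 0)) (prj V [y, A] (Suc 0)) =
    app V (prd V [y, A]) A X (Cmp V (prd V [y, A]) y (expo V X A) u' (prj V [y, A] 0)) (prj V [y, A] (Suc 0))"
    by simp
qed

text \<open>The prescribed values are glued to a map out of \<open>prd V [A, y]\<close> by
  \<open>copower_prd_ex\<close>; since \<open>curry'\<close> binds the second factor, the factors
  are exchanged before transposing.\<close>

lemma copower_expo_ex:
  assumes A: "copower k A p" and X: "X \<in> Ob V" "y \<in> Ob V" and g: "\<And>i. i < k \<Longrightarrow> g i \<in> Hom V y X"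
  obtains u where "u \<in> Hom V y (expo V X A)"
    "\<And>i. i < k \<Longrightarrow> app V y A X u (const_elt V y A (p i)) = g i"
proof -
  note [simp] = copower_Ob[OF A] copower_in[OF A] X g
  obtain h where h [simp]: "h \<in> Hom V (prd V [A, y]) X"
    and hp: "\<And>i z t. i < k \<Longrightarrow> t \<in> Hom V z y \<Longrightarrow>
      Cmp V z (prd V [A, y]) X h (tuple V z [A, y] [const_elt V z A (p i), t]) = Cmp V z y X (g i) t"
    by (rule copower_prd_ex[OF A X(2,1) g]) blast+
  let ?s = "tuple V (prd V [y, A]) [A, y] [prj V [y, A] (Suc 0), prj V [y, A] 0]"
  let ?u = "curry' V y A X (Cmp V (prd V [y, A]) (prd V [A, y]) X h ?s)"
  show ?thesis
  proof
    fix i assume [simp]: "i < k"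
    have "app V y A X (Cmp V y y (expo V X A) ?u (Idt V y)) (const_elt V y A (p i)) = g i"
      by (subst app_curry) (auto simp: hp)
    then show "app V y A X ?u (const_elt V y A (p i)) = g i" by simp
  qed simp
qed

text \<open>The points of \<open>A\<close> make the exponential a \<open>k\<close>-fold power of
  \<open>X\<close>, with evaluation at the points as projections. In \<open>copower_num_name\<close>
  this is what relates exponentials to iterated binary products.\<close>

lemma copower_expo_product:
  assumes A: "copower k A p" and X: "X \<in> Ob V"
  shows "is_product V (replicate k X) (expo V X A)
    (\<lambda>i. app V (expo V X A) A X (Idt V (expo V X A)) (const_elt V (expo V X A) A (p i)))"
proof -
  note [simp] = copower_Ob[OF A] copower_in[OF A] X
  show ?thesis
    unfolding is_product_def
  proof (intro conjI ballI allI impI)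
    fix y f assume y [simp]: "y \<in> Ob V" and f: "\<forall>i<length (replicate k X). f i \<in> Hom V y (replicate k X ! i)"
    then obtain u where "u \<in> Hom V y (expo V X A)"
      "\<And>i. i < k \<Longrightarrow> app V y A X u (const_elt V y A (p i)) = f i"
      by (auto intro: copower_expo_ex[OF A X y, of f])
    then show "\<exists>!u. u \<in> Hom V y (expo V X A) \<and>
       (\<forall>i<length (replicate k X). Cmp V y (expo V X A) (replicate k X ! i)
          (app V (expo V X A) A X (Idt V (expo V X A)) (const_elt V (expo V X A) A (p i))) u = f i)"
      using copower_expo_ext[OF A X] by (auto intro!: ex1I[of _ u])
  qed auto
qed

end

section \<open>Enriched categories through generalized elements\<close>

definition vcomp ::
  "('o, 'm) ebase \<Rightarrow> ('c, 'o, 'm) vcat \<Rightarrow> 'o \<Rightarrow> 'c \<Rightarrow> 'c \<Rightarrow> 'c \<Rightarrow> 'm \<Rightarrow> 'm \<Rightarrow> 'm" where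
  "vcomp V C y a b c g f = Cmp V y (prd V [VHom C b c, VHom C a b]) (VHom C a c) (VCmp C a b c)
    (tuple V y [VHom C b c, VHom C a b] [g, f])"

abbreviation vact ::
  "('o, 'm) ebase \<Rightarrow> ('c, 'o, 'm) vcat \<Rightarrow> ('d, 'o, 'm) vcat \<Rightarrow> ('c, 'd, 'm) vfun \<Rightarrow> 'o \<Rightarrow> 'c \<Rightarrow> 'c \<Rightarrow> 'm \<Rightarrow> 'm" where
  "vact V C D F y a b u \<equiv> Cmp V y (VHom C a b) (VHom D (vfob F a) (vfob F b)) (vfar F a b) u"

abbreviation post ::
  "('o, 'm) ebase \<Rightarrow> ('c, 'o, 'm) vcat \<Rightarrow> 'o \<Rightarrow> 'c \<Rightarrow> 'c \<Rightarrow> 'c \<Rightarrow> 'm \<Rightarrow> 'm \<Rightarrow> 'm" where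
  "post V C y x b c p u \<equiv> vcomp V C y x b c (const_elt V y (VHom C b c) p) u"

text \<open>\<open>universal_cone\<close> unpacked twice: the point \<open>p\<close> is replaced by
  its legs \<open>q i\<close>, and invertibility of the induced map by unique existence at every
  stage \<open>y\<close>. The chosen product over the list \<open>bs\<close> no longer occurs, which
  lets cones pass through a base functor. \<open>universal_cone_iff\<close> and
  \<open>ucone_tuple\<close> give the translation in both directions.\<close>

definition ucone :: "('o, 'm) ebase \<Rightarrow> ('c, 'o, 'm) vcat \<Rightarrow> 'c list \<Rightarrow> 'c \<Rightarrow> (nat \<Rightarrow> 'm) \<Rightarrow> bool" where
  "ucone V C bs b q \<longleftrightarrow> set bs \<subseteq> VOb C \<and> b \<in> VOb C \<and>
    (\<forall>i<length bs. q i \<in> Hom V (one V) (VHom C b (bs ! i))) \<and>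
    (\<forall>x\<in>VOb C. \<forall>y\<in>Ob V. \<forall>v. (\<forall>i<length bs. v i \<in> Hom V y (VHom C x (bs ! i))) \<longrightarrow>
      (\<exists>!u. u \<in> Hom V y (VHom C x b) \<and>
        (\<forall>i<length bs. post V C y x b (bs ! i) (q i) u = v i)))"

lemma mk_vfun_sel [simp]:
  "a \<in> VOb C \<Longrightarrow> vfob (mk_vfun C ob ar) a = ob a"
  "a \<in> VOb C \<Longrightarrow> b \<in> VOb C \<Longrightarrow> vfar (mk_vfun C ob ar) a b = ar a b"
  by (simp_all add: mk_vfun_def)

lemma id_vfun_sel [simp]:
  "a \<in> VOb C \<Longrightarrow> vfob (id_vfun V C) a = a"
  "a \<in> VOb C \<Longrightarrow> b \<in> VOb C \<Longrightarrow> vfar (id_vfun V C) a b = Idt V (VHom C a b)"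
  by (simp_all add: id_vfun_def)

lemma comp_vfun_sel [simp]:
  "a \<in> VOb A \<Longrightarrow> vfob (comp_vfun V A B C g f) a = vfob g (vfob f a)"
  "a \<in> VOb A \<Longrightarrow> b \<in> VOb A \<Longrightarrow> vfar (comp_vfun V A B C g f) a b =
     vact V B C g (VHom A a b) (vfob f a) (vfob f b) (vfar f a b)"
  by (simp_all add: comp_vfun_def)

lemma is_vfun_vcat: "is_vfun V C D F \<Longrightarrow> is_vcat V C" "is_vfun V C D F \<Longrightarrow> is_vcat V D"
  by (simp_all add: is_vfun_def)

lemma is_pvfun_vfun: "is_pvfun V C D F \<Longrightarrow> is_vfun V C D F"
  by (simp add: is_pvfun_def)

lemma is_vnat_vfun: "is_vnat V C D F G \<alpha> \<Longrightarrow> is_vfun V C D F" "is_vnat V C D F G \<alpha> \<Longrightarrow> is_vfun V C D G"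
  by (simp_all add: is_vnat_def)

lemma vfun_eqI:
  assumes "is_vfun V C D F" "is_vfun V C D' G"
    and "\<And>a. a \<in> VOb C \<Longrightarrow> vfob F a = vfob G a"
    and "\<And>a b. a \<in> VOb C \<Longrightarrow> b \<in> VOb C \<Longrightarrow> vfar F a b = vfar G a b"
  shows "F = G"
proof -
  have "vfob F = vfob G" using assms unfolding is_vfun_def Let_def fun_eq_iff by metis
  moreover have "vfar F = vfar G" using assms unfolding is_vfun_def Let_def fun_eq_iff by metis
  ultimately show ?thesis by simp
qed

context base
begin

lemma vcat_Hom [simp]: "is_vcat V C \<Longrightarrow> a \<in> VOb C \<Longrightarrow> b \<in> VOb C \<Longrightarrow> VHom C a b \<in> Ob V"
  and vcat_Idt [simp]: "is_vcat V C \<Longrightarrow> a \<in> VOb C \<Longrightarrow> VIdt C a \<in> Hom V (one V) (VHom C a a)"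
  and vcat_Cmp [simp]: "is_vcat V C \<Longrightarrow> a \<in> VOb C \<Longrightarrow> b \<in> VOb C \<Longrightarrow> c \<in> VOb C \<Longrightarrow>
    VCmp C a b c \<in> Hom V (prd V [VHom C b c, VHom C a b]) (VHom C a c)"
  unfolding is_vcat_def Let_def by blast+

lemma vcomp_in [simp]:
  assumes "is_vcat V C" "a \<in> VOb C" "b \<in> VOb C" "c \<in> VOb C"
    "g \<in> Hom V y (VHom C b c)" "f \<in> Hom V y (VHom C a b)"
  shows "vcomp V C y a b c g f \<in> Hom V y (VHom C a c)"
  using assms by (simp add: vcomp_def)

lemma vcomp_Cmp [simp]:
  assumes "is_vcat V C" "a \<in> VOb C" "b \<in> VOb C" "c \<in> VOb C"
    "g \<in> Hom V y (VHom C b c)" "f \<in> Hom V y (VHom C a b)" "u \<in> Hom V z y"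
  shows "Cmp V z y (VHom C a c) (vcomp V C y a b c g f) u =
    vcomp V C z a b c (Cmp V z y (VHom C b c) g u) (Cmp V z y (VHom C a b) f u)"
  using assms by (simp add: vcomp_def)

text \<open>The step from elements back to diagrams: each diagram in \<open>is_vcat\<close> is one
  of the equations \<open>as\<close>, \<open>ul\<close>, \<open>ur\<close> at the generic elements,
  namely at the projections of the product on which the diagram starts.\<close>

lemma is_vcatI:
  assumes H [simp]: "\<And>a b. a \<in> VOb C \<Longrightarrow> b \<in> VOb C \<Longrightarrow> VHom C a b \<in> Ob V"
    and j [simp]: "\<And>a. a \<in> VOb C \<Longrightarrow> VIdt C a \<in> Hom V (one V) (VHom C a a)"
    and M [simp]: "\<And>a b c. a \<in> VOb C \<Longrightarrow> b \<in> VOb C \<Longrightarrow> c \<in> VOb C \<Longrightarrow>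
      VCmp C a b c \<in> Hom V (prd V [VHom C b c, VHom C a b]) (VHom C a c)"
    and as: "\<And>a b c d y h g f. a \<in> VOb C \<Longrightarrow> b \<in> VOb C \<Longrightarrow> c \<in> VOb C \<Longrightarrow> d \<in> VOb C \<Longrightarrow> y \<in> Ob V \<Longrightarrow>
      h \<in> Hom V y (VHom C c d) \<Longrightarrow> g \<in> Hom V y (VHom C b c) \<Longrightarrow> f \<in> Hom V y (VHom C a b) \<Longrightarrow>
      vcomp V C y a b d (vcomp V C y b c d h g) f = vcomp V C y a c d h (vcomp V C y a b c g f)"
    and ul: "\<And>a b y f. a \<in> VOb C \<Longrightarrow> b \<in> VOb C \<Longrightarrow> y \<in> Ob V \<Longrightarrow> f \<in> Hom V y (VHom C a b) \<Longrightarrow>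
      post V C y a b b (VIdt C b) f = f"
    and ur: "\<And>a b y f. a \<in> VOb C \<Longrightarrow> b \<in> VOb C \<Longrightarrow> y \<in> Ob V \<Longrightarrow> f \<in> Hom V y (VHom C a b) \<Longrightarrow>
      vcomp V C y a a b f (const_elt V y (VHom C a a) (VIdt C a)) = f"
    and undef: "\<And>a b. \<not> (a \<in> VOb C \<and> b \<in> VOb C) \<Longrightarrow> VHom C a b = undefined"
      "\<And>a. a \<notin> VOb C \<Longrightarrow> VIdt C a = undefined"
      "\<And>a b c. \<not> (a \<in> VOb C \<and> b \<in> VOb C \<and> c \<in> VOb C) \<Longrightarrow> VCmp C a b c = undefined"
  shows "is_vcat V C"
  unfolding is_vcat_def Let_def
proof (intro conjI ballI, goal_cases)
  case (4 a b c d)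
  note [simp] = 4
  let ?cd = "VHom C c d" let ?bc = "VHom C b c" let ?ab = "VHom C a b"
  let ?y = "prd V [prd V [?cd, ?bc], ?ab]"
  let ?p = "prj V [prd V [?cd, ?bc], ?ab] 0"
  show ?case
    using as[of a b c d ?y "Cmp V ?y (prd V [?cd, ?bc]) ?cd (prj V [?cd, ?bc] 0) ?p"
        "Cmp V ?y (prd V [?cd, ?bc]) ?bc (prj V [?cd, ?bc] (Suc 0)) ?p" "prj V [prd V [?cd, ?bc], ?ab] (Suc 0)"]
    by (simp add: vcomp_def prod_map2 assoc_iso_def Let_def)
next
  case (5 a b)
  have "prj V [one V, VHom C a b] 0 = bang V (prd V [one V, VHom C a b])"
    using 5 by (intro bang_unique) simp
  then show ?case
    using ul[of a b "prd V [one V, VHom C a b]" "prj V [one V, VHom C a b] (Suc 0)"] 5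
    by (simp add: vcomp_def prod_map2)
next
  case (6 a b)
  have "prj V [VHom C a b, one V] (Suc 0) = bang V (prd V [VHom C a b, one V])"
    using 6 by (intro bang_unique) simp
  then show ?case
    using ur[of a b "prd V [VHom C a b, one V]" "prj V [VHom C a b, one V] 0"] 6
    by (simp add: vcomp_def prod_map2)
qed (use undef in auto)

lemma vcomp_assoc [simp]:
  assumes C [simp]: "is_vcat V C" "a \<in> VOb C" "b \<in> VOb C" "c \<in> VOb C" "d \<in> VOb C"
    and hgf [simp]: "h \<in> Hom V y (VHom C c d)" "g \<in> Hom V y (VHom C b c)" "f \<in> Hom V y (VHom C a b)"
  shows "vcomp V C y a b d (vcomp V C y b c d h g) f = vcomp V C y a c d h (vcomp V C y a b c g f)"
proof -
  let ?cd = "VHom C c d" let ?bc = "VHom C b c" let ?ab = "VHom C a b"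
  let ?t = "tuple V y [prd V [?cd, ?bc], ?ab] [tuple V y [?cd, ?bc] [h, g], f]"
  note ax = C(1)[unfolded is_vcat_def Let_def, THEN conjunct2, THEN conjunct2, THEN conjunct2, THEN conjunct1, rule_format]
  \<comment> \<open>Both sides of the associativity diagram are evaluated at the triple formed by
    \<open>h\<close>, \<open>g\<close> and \<open>f\<close>.\<close>
  have "Cmp V y (prd V [prd V [?cd, ?bc], ?ab]) (VHom C a d) l ?t = Cmp V y (prd V [prd V [?cd, ?bc], ?ab]) (VHom C a d) r ?t"
    if "l = r" for l r
    using that by simp
  note this[OF ax[of a b c d]]
  then show ?thesis
    by (simp add: vcomp_def prod_map2 assoc_iso_def Let_def)
qed

lemma vcomp_unit [simp]:
  assumes C [simp]: "is_vcat V C" "a \<in> VOb C" "b \<in> VOb C" and f [simp]: "f \<in> Hom V y (VHom C a b)"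
  shows "post V C y a b b (VIdt C b) f = f"
    "vcomp V C y a a b f (const_elt V y (VHom C a a) (VIdt C a)) = f"
proof -
  have [simp]: "y \<in> Ob V" using Hom_Ob f by blast
  note ax = C(1)[unfolded is_vcat_def Let_def, THEN conjunct2, THEN conjunct2, THEN conjunct2, THEN conjunct2]
  have cong: "Cmp V y x z l t = Cmp V y x z r t" if "l = r" for l r x z t
    using that by simp
  show "post V C y a b b (VIdt C b) f = f"
    using cong[OF ax[THEN conjunct1, rule_format, of a b], of "prd V [one V, VHom C a b]" "VHom C a b" "tuple V y [one V, VHom C a b] [bang V y, f]"]
    by (simp add: vcomp_def prod_map2)
  show "vcomp V C y a a b f (const_elt V y (VHom C a a) (VIdt C a)) = f"
    using cong[OF ax[THEN conjunct2, THEN conjunct1, rule_format, of a b], of "prd V [VHom C a b, one V]" "VHom C a b" "tuple V y [VHom C a b, one V] [f, bang V y]"]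
    by (simp add: vcomp_def prod_map2)
qed

text \<open>Counterpart of \<open>reassoc\<close> for \<open>vcomp_assoc\<close>, which also nests
  to the right.\<close>

lemma vcomp_reassoc:
  assumes "vcomp V C y b c d h g = k" "is_vcat V C" "a \<in> VOb C" "b \<in> VOb C" "c \<in> VOb C" "d \<in> VOb C"
    "h \<in> Hom V y (VHom C c d)" "g \<in> Hom V y (VHom C b c)" "f \<in> Hom V y (VHom C a b)"
  shows "vcomp V C y a c d h (vcomp V C y a b c g f) = vcomp V C y a b d k f"
  using vcomp_assoc[OF assms(2-)] assms(1) by simp

lemma vcomp_unit_one [simp]:
  assumes "is_vcat V C" "a \<in> VOb C" "b \<in> VOb C" "f \<in> Hom V (one V) (VHom C a b)"
  shows "vcomp V C (one V) a b b (VIdt C b) f = f" "vcomp V C (one V) a a b f (VIdt C a) = f"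
  using vcomp_unit[OF assms] assms by simp_all

lemma vfun_ob: "is_vfun V C D F \<Longrightarrow> a \<in> VOb C \<Longrightarrow> vfob F a \<in> VOb D"
  and vfun_in [simp]: "is_vfun V C D F \<Longrightarrow> a \<in> VOb C \<Longrightarrow> b \<in> VOb C \<Longrightarrow>
    vfar F a b \<in> Hom V (VHom C a b) (VHom D (vfob F a) (vfob F b))"
  and vfun_Idt [simp]: "is_vfun V C D F \<Longrightarrow> a \<in> VOb C \<Longrightarrow>
    vact V C D F (one V) a a (VIdt C a) = VIdt D (vfob F a)"
  unfolding is_vfun_def Let_def by blast+

lemmas vfunD = is_vfun_vcat vfun_ob

lemma vfun_vcomp [simp]:
  assumes F [simp]: "is_vfun V C D F" "a \<in> VOb C" "b \<in> VOb C" "c \<in> VOb C"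
    "g \<in> Hom V y (VHom C b c)" "f \<in> Hom V y (VHom C a b)"
  shows "vact V C D F y a c (vcomp V C y a b c g f) =
    vcomp V D y (vfob F a) (vfob F b) (vfob F c)
      (vact V C D F y b c g)
      (vact V C D F y a b f)"
proof -
  note [simp] = vfunD[OF F(1)]
  note ax = F(1)[unfolded is_vfun_def Let_def, THEN conjunct2, THEN conjunct2, THEN conjunct2, THEN conjunct2, THEN conjunct2, THEN conjunct1, rule_format]
  have "Cmp V y x z l t = Cmp V y x z r t" if "l = r" for l r x z t
    using that by simp
  note this[OF ax[of a b c], of "prd V [VHom C b c, VHom C a b]" "VHom D (vfob F a) (vfob F c)" "tuple V y [VHom C b c, VHom C a b] [g, f]"]
  then show ?thesis by (simp add: vcomp_def prod_map2)
qed

lemma is_vfunI: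
  assumes C [simp]: "is_vcat V C" "is_vcat V D" and ob [simp]: "\<And>a. a \<in> VOb C \<Longrightarrow> vfob F a \<in> VOb D"
    and ar [simp]: "\<And>a b. a \<in> VOb C \<Longrightarrow> b \<in> VOb C \<Longrightarrow>
      vfar F a b \<in> Hom V (VHom C a b) (VHom D (vfob F a) (vfob F b))"
    and Idt: "\<And>a. a \<in> VOb C \<Longrightarrow>
      vact V C D F (one V) a a (VIdt C a) = VIdt D (vfob F a)"
    and Cmp: "\<And>a b c y g f. a \<in> VOb C \<Longrightarrow> b \<in> VOb C \<Longrightarrow> c \<in> VOb C \<Longrightarrow> y \<in> Ob V \<Longrightarrow>
      g \<in> Hom V y (VHom C b c) \<Longrightarrow> f \<in> Hom V y (VHom C a b) \<Longrightarrow>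
      vact V C D F y a c (vcomp V C y a b c g f) =
      vcomp V D y (vfob F a) (vfob F b) (vfob F c)
        (vact V C D F y b c g)
        (vact V C D F y a b f)"
    and undef: "\<And>a. a \<notin> VOb C \<Longrightarrow> vfob F a = undefined"
      "\<And>a b. \<not> (a \<in> VOb C \<and> b \<in> VOb C) \<Longrightarrow> vfar F a b = undefined"
  shows "is_vfun V C D F"
  unfolding is_vfun_def Let_def
proof (intro conjI ballI, goal_cases)
  case (6 a b c)
  then show ?case
    using Cmp[of a b c "prd V [VHom C b c, VHom C a b]" "prj V [VHom C b c, VHom C a b] 0" "prj V [VHom C b c, VHom C a b] (Suc 0)"]
    by (simp add: vcomp_def prod_map2)
qed (use Idt undef in auto)

lemma is_vfun_id [simp]: "is_vcat V C \<Longrightarrow> is_vfun V C C (id_vfun V C)"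
  by (rule is_vfunI) (auto simp: id_vfun_def mk_vfun_def)

lemma is_vfun_comp [simp]:
  assumes [simp]: "is_vfun V A B F" "is_vfun V B C G"
  shows "is_vfun V A C (comp_vfun V A B C G F)"
proof -
  note [simp] = vfunD[OF assms(1)] vfunD[OF assms(2)]
  show ?thesis by (rule is_vfunI) (auto simp: comp_vfun_def mk_vfun_def)
qed

lemma comp_vfun_unit:
  assumes [simp]: "is_vfun V A B F"
  shows "comp_vfun V A B B (id_vfun V B) F = F" "comp_vfun V A A B F (id_vfun V A) = F"
proof -
  note [simp] = vfunD[OF assms(1)]
  show "comp_vfun V A B B (id_vfun V B) F = F" "comp_vfun V A A B F (id_vfun V A) = F"
    by (rule vfun_eqI[where V = V and C = A and D = B and D' = B]; simp)+
qed

lemma comp_vfun_assoc: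
  assumes [simp]: "is_vfun V A B F" "is_vfun V B C G" "is_vfun V C D H"
  shows "comp_vfun V A C D H (comp_vfun V A B C G F) = comp_vfun V A B D (comp_vfun V B C D H G) F"
proof -
  note [simp] = vfunD[OF assms(1)] vfunD[OF assms(2)] vfunD[OF assms(3)]
  show ?thesis
    by (rule vfun_eqI[where V = V and C = A and D = D and D' = D]; simp)
qed

subsection \<open>Natural transformations\<close>

lemma vnat_in: "is_vnat V C D F G \<alpha> \<Longrightarrow> a \<in> VOb C \<Longrightarrow> \<alpha> a \<in> Hom V (one V) (VHom D (vfob F a) (vfob G a))"
  unfolding is_vnat_def Let_def by blast

lemmas vnatD = is_vnat_vfun is_vnat_vfun[THEN is_vfun_vcat(1)] is_vnat_vfun[THEN is_vfun_vcat(2)]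
  is_vnat_vfun(1)[THEN vfun_ob] is_vnat_vfun(2)[THEN vfun_ob] vnat_in

lemmas pvfunD = is_pvfun_vfun is_pvfun_vfun[THEN is_vfun_vcat(1)] is_pvfun_vfun[THEN is_vfun_vcat(2)]
  is_pvfun_vfun[THEN vfun_ob]

lemma vnat_undefined: "is_vnat V C D F G \<alpha> \<Longrightarrow> a \<notin> VOb C \<Longrightarrow> \<alpha> a = undefined"
  unfolding is_vnat_def Let_def by blast

text \<open>\<open>is_vnat\<close> contains only the case of the generic arrow, where
  \<open>y\<close> is the hom-object and \<open>u\<close> its identity; precomposing that case with
  \<open>u\<close> gives every stage.\<close>

lemma vnat_natural:
  assumes \<alpha> [simp]: "is_vnat V C D F G \<alpha>" "a \<in> VOb C" "b \<in> VOb C" "u \<in> Hom V y (VHom C a b)"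
  shows "post V D y (vfob F a) (vfob F b) (vfob G b) (\<alpha> b) (vact V C D F y a b u) =
    vcomp V D y (vfob F a) (vfob G a) (vfob G b)
      (vact V C D G y a b u)
      (const_elt V y (VHom D (vfob F a) (vfob G a)) (\<alpha> a))"
proof -
  note [simp] = vnatD[OF \<alpha>(1)]
  let ?H = "VHom C a b"
  have "post V D ?H (vfob F a) (vfob F b) (vfob G b) (\<alpha> b) (vfar F a b) =
    vcomp V D ?H (vfob F a) (vfob G a) (vfob G b) (vfar G a b) (const_elt V ?H (VHom D (vfob F a) (vfob G a)) (\<alpha> a))" (is "?l = ?r")
    using \<alpha> unfolding is_vnat_def Let_def vcomp_def by blast
  then have "Cmp V y ?H (VHom D (vfob F a) (vfob G b)) ?l u = Cmp V y ?H (VHom D (vfob F a) (vfob G b)) ?r u"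
    by (simp only:)
  then show ?thesis by simp
qed

lemma is_vnatI:
  assumes "is_vfun V C D F" "is_vfun V C D G"
    "\<And>a. a \<in> VOb C \<Longrightarrow> \<alpha> a \<in> Hom V (one V) (VHom D (vfob F a) (vfob G a))"
    "\<And>a b. a \<in> VOb C \<Longrightarrow> b \<in> VOb C \<Longrightarrow>
      post V D (VHom C a b) (vfob F a) (vfob F b) (vfob G b) (\<alpha> b) (vfar F a b) =
      vcomp V D (VHom C a b) (vfob F a) (vfob G a) (vfob G b) (vfar G a b)
        (const_elt V (VHom C a b) (VHom D (vfob F a) (vfob G a)) (\<alpha> a))"
    "\<And>a. a \<notin> VOb C \<Longrightarrow> \<alpha> a = undefined"
  shows "is_vnat V C D F G \<alpha>"
  using assms unfolding is_vnat_def Let_def vcomp_def by blast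

lemma is_vnat_id:
  assumes [simp]: "is_vfun V C D F"
  shows "is_vnat V C D F F (\<lambda>a. if a \<in> VOb C then VIdt D (vfob F a) else undefined)"
proof -
  note [simp] = vfunD[OF assms]
  show ?thesis by (rule is_vnatI) auto
qed

lemma is_vnat_comp:
  assumes \<alpha> [simp]: "is_vnat V C D F G \<alpha>" and \<beta> [simp]: "is_vnat V C D G H \<beta>"
  shows "is_vnat V C D F H (\<lambda>a. if a \<in> VOb C then
    vcomp V D (one V) (vfob F a) (vfob G a) (vfob H a) (\<beta> a) (\<alpha> a) else undefined)"
proof -
  note [simp] = vnatD[OF \<alpha>] vnatD[OF \<beta>]
  show ?thesis
  proof (rule is_vnatI, goal_cases)
    case (4 a b)
    note [simp] = 4
    let ?y = "VHom C a b"
    let ?k = "\<lambda>F G \<alpha> a. const_elt V ?y (VHom D (vfob F a) (vfob G a)) (\<alpha> a)"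
    have 1: "vcomp V D ?y (vfob F a) (vfob F b) (vfob G b) (?k F G \<alpha> b) (vfar F a b) =
      vcomp V D ?y (vfob F a) (vfob G a) (vfob G b) (vfar G a b) (?k F G \<alpha> a)"
      using vnat_natural[OF \<alpha>, of a b "Idt V ?y" ?y] by simp
    have 2: "vcomp V D ?y (vfob G a) (vfob G b) (vfob H b) (?k G H \<beta> b) (vfar G a b) =
      vcomp V D ?y (vfob G a) (vfob H a) (vfob H b) (vfar H a b) (?k G H \<beta> a)"
      using vnat_natural[OF \<beta>, of a b "Idt V ?y" ?y] by simp
    \<comment> \<open>Between the two naturality squares the middle factor \<open>vfar G a b\<close>
      has to change brackets, so that the left side of the square for \<open>\<beta>\<close> becomes
      visible.\<close>
    have "vcomp V D ?y (vfob F a) (vfob G b) (vfob H b) (?k G H \<beta> b)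
        (vcomp V D ?y (vfob F a) (vfob G a) (vfob G b) (vfar G a b) (?k F G \<alpha> a)) =
      vcomp V D ?y (vfob F a) (vfob G a) (vfob H b)
        (vcomp V D ?y (vfob G a) (vfob G b) (vfob H b) (?k G H \<beta> b) (vfar G a b)) (?k F G \<alpha> a)"
      by simp
    then show ?case by (simp add: 1 2)
  qed auto
qed

subsection \<open>Finite products\<close>

lemma ucone_ob: "ucone V C bs b q \<Longrightarrow> b \<in> VOb C" "ucone V C bs b q \<Longrightarrow> i < length bs \<Longrightarrow> bs ! i \<in> VOb C"
  and ucone_in: "ucone V C bs b q \<Longrightarrow> i < length bs \<Longrightarrow> q i \<in> Hom V (one V) (VHom C b (bs ! i))"
  and ucone_ex1: "ucone V C bs b q \<Longrightarrow> x \<in> VOb C \<Longrightarrow> y \<in> Ob V \<Longrightarrow> (\<And>i. i < length bs \<Longrightarrow> v i \<in> Hom V y (VHom C x (bs ! i))) \<Longrightarrow>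
   \<exists>!u. u \<in> Hom V y (VHom C x b) \<and>
        (\<forall>i<length bs. post V C y x b (bs ! i) (q i) u = v i)"
  unfolding ucone_def by auto

lemma ucone_ext:
  assumes C: "is_vcat V C" and q: "ucone V C bs b q" and x: "x \<in> VOb C" and u: "u \<in> Hom V y (VHom C x b)" "u' \<in> Hom V y (VHom C x b)"
    "\<And>i. i < length bs \<Longrightarrow> post V C y x b (bs ! i) (q i) u =
      post V C y x b (bs ! i) (q i) u'"
  shows "u = u'"
proof -
  have y: "y \<in> Ob V" using Hom_Ob u by blast
  let ?v = "\<lambda>i. post V C y x b (bs ! i) (q i) u"
  have "i < length bs \<Longrightarrow> ?v i \<in> Hom V y (VHom C x (bs ! i))" for i
    using ucone_in[OF q] ucone_ob[OF q] C x y u by simp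
  then have "\<exists>!w. w \<in> Hom V y (VHom C x b) \<and>
        (\<forall>i<length bs. post V C y x b (bs ! i) (q i) w = ?v i)"
    by (rule ucone_ex1[OF q x y])
  then show ?thesis using u by auto
qed

lemma uconeI:
  assumes "set bs \<subseteq> VOb C" "b \<in> VOb C" "\<And>i. i < length bs \<Longrightarrow> q i \<in> Hom V (one V) (VHom C b (bs ! i))"
    "\<And>x y v. x \<in> VOb C \<Longrightarrow> y \<in> Ob V \<Longrightarrow> (\<And>i. i < length bs \<Longrightarrow> v i \<in> Hom V y (VHom C x (bs ! i))) \<Longrightarrow>
      \<exists>u. u \<in> Hom V y (VHom C x b) \<and>
        (\<forall>i<length bs. post V C y x b (bs ! i) (q i) u = v i)"
    "\<And>x y u u'. x \<in> VOb C \<Longrightarrow> y \<in> Ob V \<Longrightarrow> u \<in> Hom V y (VHom C x b) \<Longrightarrow> u' \<in> Hom V y (VHom C x b) \<Longrightarrow>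
      (\<And>i. i < length bs \<Longrightarrow> post V C y x b (bs ! i) (q i) u =
        post V C y x b (bs ! i) (q i) u') \<Longrightarrow> u = u'"
  shows "ucone V C bs b q"
  unfolding ucone_def
proof (intro conjI ballI allI impI)
  fix x y v assume x: "x \<in> VOb C" "y \<in> Ob V" and v: "\<forall>i<length bs. v i \<in> Hom V y (VHom C x (bs ! i))"
  obtain u where u: "u \<in> Hom V y (VHom C x b)"
    "\<And>i. i<length bs \<Longrightarrow> post V C y x b (bs ! i) (q i) u = v i"
    using assms(4)[OF x, of v] v by auto
  show "\<exists>!u. u \<in> Hom V y (VHom C x b) \<and>
      (\<forall>i<length bs. post V C y x b (bs ! i) (q i) u = v i)"
    by (rule ex1I[of _ u]) (use u assms(5)[OF x] in auto)
qed (use assms in auto)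

lemma ucone_cong:
  assumes "bs = bs'" "b = b'" "\<And>i. i < length bs' \<Longrightarrow> q i = q' i"
  shows "ucone V C bs b q \<longleftrightarrow> ucone V C bs' b' q'"
  unfolding ucone_def using assms by simp

lemma VHom_list [simp]: "is_vcat V C \<Longrightarrow> set bs \<subseteq> VOb C \<Longrightarrow> b \<in> VOb C \<Longrightarrow> VHom C b ` set bs \<subseteq> Ob V"
  by auto

abbreviation hprd :: "('c, 'o, 'm) vcat \<Rightarrow> 'c \<Rightarrow> 'c list \<Rightarrow> 'o" where
  "hprd C x bs \<equiv> prd V (map (VHom C x) bs)"

abbreviation hprj :: "('c, 'o, 'm) vcat \<Rightarrow> 'c \<Rightarrow> 'c list \<Rightarrow> nat \<Rightarrow> 'm" where
  "hprj C x bs i \<equiv> prj V (map (VHom C x) bs) i"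

abbreviation leg :: "('c, 'o, 'm) vcat \<Rightarrow> 'c \<Rightarrow> 'c list \<Rightarrow> 'm \<Rightarrow> nat \<Rightarrow> 'm" where
  "leg C b bs p i \<equiv> Cmp V (one V) (hprd C b bs) (VHom C b (bs ! i)) (hprj C b bs i) p"

text \<open>An isomorphism transports the product structure of \<open>prd V Ys\<close> to
  \<open>X\<close>. Conversely, two products of the same list are isomorphic compatibly with the
  projections, and the isomorphism so obtained is \<open>f\<close> because it has the same
  components.\<close>

lemma is_iso_iff_product:
  assumes Y: "set Ys \<subseteq> Ob V" and f [simp]: "f \<in> Hom V X (prd V Ys)"
  shows "is_iso V X (prd V Ys) f \<longleftrightarrow>
    is_product V Ys X (\<lambda>i. Cmp V X (prd V Ys) (Ys ! i) (prj V Ys i) f)" (is "_ \<longleftrightarrow> is_product V Ys X ?pr")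
proof
  note [simp] = prj_in[OF Y] prd_Ob[OF Y]
  have X [simp]: "X \<in> Ob V" using Hom_Ob f by blast
  have Yi [simp]: "i < length Ys \<Longrightarrow> Ys ! i \<in> Ob V" for i using Y by auto
  { assume "is_iso V X (prd V Ys) f"
    then obtain g where g [simp]: "g \<in> Hom V (prd V Ys) X" "Cmp V X (prd V Ys) X g f = Idt V X"
      "Cmp V (prd V Ys) X (prd V Ys) f g = Idt V (prd V Ys)"
      by (auto simp: is_iso_def inverse_in_def)
    show "is_product V Ys X ?pr"
      unfolding is_product_def
    proof (intro conjI allI impI ballI)
      fix y v assume y: "y \<in> Ob V" "\<forall>i<length Ys. v i \<in> Hom V y (Ys ! i)"
      obtain u where u [simp]: "u \<in> Hom V y (prd V Ys)" "\<And>i. i < length Ys \<Longrightarrow> Cmp V y (prd V Ys) (Ys ! i) (prj V Ys i) u = v i"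
        using is_product_ex[OF is_product_prd[OF Y] y(1), of v] y(2) by blast
      show "\<exists>!u. u \<in> Hom V y X \<and> (\<forall>i<length Ys. Cmp V y X (Ys ! i) (?pr i) u = v i)"
      proof (rule ex1I[of _ "Cmp V y (prd V Ys) X g u"])
        show "Cmp V y (prd V Ys) X g u \<in> Hom V y X \<and>
          (\<forall>i<length Ys. Cmp V y X (Ys ! i) (?pr i) (Cmp V y (prd V Ys) X g u) = v i)"
          by (simp add: reassoc[OF g(3)])
        fix w assume w: "w \<in> Hom V y X \<and> (\<forall>i<length Ys. Cmp V y X (Ys ! i) (?pr i) w = v i)"
        have "Cmp V y X (prd V Ys) f w = u"
          by (rule prd_ext[OF Y, of _ y]) (use w in auto)
        then show "w = Cmp V y (prd V Ys) X g u"
          using w reassoc[OF g(2), of w y] by simp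
      qed
    qed (use Y in auto) }
  { assume p: "is_product V Ys X ?pr"
    obtain e e' where e: "inverse_in V X (prd V Ys) e e'" "\<And>i. i < length Ys \<Longrightarrow> Cmp V X (prd V Ys) (Ys ! i) (prj V Ys i) e = ?pr i"
      by (rule is_product_iso[OF p is_product_prd[OF Y]], rule that)
    have "e = f"
      by (rule prd_ext[OF Y, of _ X]) (use e in \<open>auto simp: inverse_in_def\<close>)
    then show "is_iso V X (prd V Ys) f" using e by (auto simp: is_iso_def) }
qed

text \<open>The projections are the actions of the \<open>q i\<close> on the generic element of
  \<open>VHom C x b\<close>; composing them with \<open>u\<close> gives the actions on
  \<open>u\<close>. A product-preserving functor can be applied to this form, as in
  \<open>ucone_bc\<close>.\<close>

lemma ucone_iff_product:
  assumes C [simp]: "is_vcat V C" and bs: "set bs \<subseteq> VOb C" "b \<in> VOb C"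
    and q: "\<And>i. i < length bs \<Longrightarrow> q i \<in> Hom V (one V) (VHom C b (bs ! i))"
  shows "ucone V C bs b q \<longleftrightarrow> (\<forall>x\<in>VOb C. is_product V (map (VHom C x) bs) (VHom C x b)
    (\<lambda>i. post V C (VHom C x b) x b (bs ! i) (q i) (Idt V (VHom C x b))))"
proof -
  have bsi: "i < length bs \<Longrightarrow> bs ! i \<in> VOb C" for i using bs nth_mem by blast
  have "is_product V (map (VHom C x) bs) (VHom C x b) (\<lambda>i. post V C (VHom C x b) x b (bs ! i) (q i) (Idt V (VHom C x b))) \<longleftrightarrow>
    (\<forall>y\<in>Ob V. \<forall>v. (\<forall>i<length bs. v i \<in> Hom V y (VHom C x (bs ! i))) \<longrightarrow>
      (\<exists>!u. u \<in> Hom V y (VHom C x b) \<and> (\<forall>i<length bs. post V C y x b (bs ! i) (q i) u = v i)))"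
    if "x \<in> VOb C" for x
    unfolding is_product_def using that bs bsi q by (simp cong: conj_cong)
  then show ?thesis unfolding ucone_def using bs q by simp
qed

lemma hprj_in [simp]:
  assumes "is_vcat V C" "set bs \<subseteq> VOb C" "x \<in> VOb C" "i < length bs"
  shows "hprj C x bs i \<in> Hom V (hprd C x bs) (VHom C x (bs ! i))"
  using prj_in[of "map (VHom C x) bs" i] assms by simp

lemma prj_induced:
  assumes C [simp]: "is_vcat V C" "set bs \<subseteq> VOb C" "b \<in> VOb C" "x \<in> VOb C" "p \<in> Hom V (one V) (hprd C b bs)"
  shows "induced V C bs b p x \<in> Hom V (VHom C x b) (hprd C x bs)"
    "i < length bs \<Longrightarrow> Cmp V (VHom C x b) (hprd C x bs) (VHom C x (bs ! i)) (hprj C x bs i)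
      (induced V C bs b p x) = post V C (VHom C x b) x b (bs ! i) (leg C b bs p i) (Idt V (VHom C x b))"
proof -
  have [simp]: "i < length bs \<Longrightarrow> bs ! i \<in> VOb C" for i using C(2) nth_mem by blast
  let ?q = "\<lambda>i. post V C (VHom C x b) x b (bs ! i) (leg C b bs p i) (Idt V (VHom C x b))"
  have ind: "induced V C bs b p x = tuple V (VHom C x b) (map (VHom C x) bs) (map ?q [0..<length bs])"
    by (simp add: induced_def vcomp_def Let_def)
  have nth: "map ?q [0..<length bs] ! i \<in> Hom V (VHom C x b) (map (VHom C x) bs ! i)" if "i < length (map (VHom C x) bs)" for i
    using that by (simp del: vcomp_Cmp)
  show "induced V C bs b p x \<in> Hom V (VHom C x b) (hprd C x bs)"
    unfolding ind using nth by (intro tuple_in) auto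
  show "Cmp V (VHom C x b) (hprd C x bs) (VHom C x (bs ! i)) (hprj C x bs i)
      (induced V C bs b p x) = ?q i" if "i < length bs"
    unfolding ind using that prj_tuple[of "map (VHom C x) bs", OF _ _ nth] by simp
qed

lemma universal_cone_iff:
  assumes C [simp]: "is_vcat V C"
  shows "universal_cone V C bs b p \<longleftrightarrow> p \<in> Hom V (one V) (hprd C b bs) \<and> ucone V C bs b (leg C b bs p)"
proof (cases "set bs \<subseteq> VOb C \<and> b \<in> VOb C \<and> p \<in> Hom V (one V) (hprd C b bs)")
  case True
  then have bs: "set bs \<subseteq> VOb C" "b \<in> VOb C" "p \<in> Hom V (one V) (hprd C b bs)" by auto
  have "is_iso V (VHom C x b) (hprd C x bs) (induced V C bs b p x) \<longleftrightarrow>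
    is_product V (map (VHom C x) bs) (VHom C x b)
      (\<lambda>i. post V C (VHom C x b) x b (bs ! i) (leg C b bs p i) (Idt V (VHom C x b)))"
    if x: "x \<in> VOb C" for x
  proof (subst is_iso_iff_product[OF _ prj_induced(1)[OF C bs(1,2) x bs(3)]])
    show "set (map (VHom C x) bs) \<subseteq> Ob V" using bs x by simp
  qed (rule is_product_cong[OF refl refl], use prj_induced(2)[OF C bs(1,2) x bs(3)] in auto)
  then show ?thesis
    unfolding universal_cone_def using bs by (simp add: ucone_iff_product)
next
  case False
  then show ?thesis by (auto simp: universal_cone_def ucone_def)
qed

lemma ucone_tuple:
  assumes C: "is_vcat V C" and q: "ucone V C bs b q"
  shows "universal_cone V C bs b (tuple V (one V) (map (VHom C b) bs) (map q [0..<length bs]))"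
    "i < length bs \<Longrightarrow> leg C b bs (tuple V (one V) (map (VHom C b) bs) (map q [0..<length bs])) i = q i"
proof -
  let ?p = "tuple V (one V) (map (VHom C b) bs) (map q [0..<length bs])"
  have b: "set bs \<subseteq> VOb C" "b \<in> VOb C" using q by (auto simp: ucone_def)
  then have H: "set (map (VHom C b) bs) \<subseteq> Ob V" using C by auto
  have nth: "map q [0..<length bs] ! i \<in> Hom V (one V) (map (VHom C b) bs ! i)" if "i < length (map (VHom C b) bs)" for i
    using that ucone_in[OF q] by simp
  have prj: "leg C b bs ?p i = q i" if "i < length bs" for i
    using that prj_tuple[OF H _ nth] by simp
  show "i < length bs \<Longrightarrow> leg C b bs ?p i = q i"
    by (rule prj)
  show "universal_cone V C bs b ?p"
    unfolding universal_cone_iff[OF C] using tuple_in[OF H _ nth] q prj by (simp cong: ucone_cong)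
qed

lemma has_vproducts_iff:
  assumes C: "is_vcat V C"
  shows "has_vproducts V C \<longleftrightarrow> (\<forall>bs. set bs \<subseteq> VOb C \<longrightarrow> (\<exists>b q. ucone V C bs b q))"
  unfolding has_vproducts_def
  using universal_cone_iff[OF C] ucone_tuple(1)[OF C] by blast

lemma image_cone_spec:
  assumes F [simp]: "is_vfun V C D F" and bs [simp]: "set bs \<subseteq> VOb C" "b \<in> VOb C" and p [simp]: "p \<in> Hom V (one V) (hprd C b bs)"
  shows "image_cone V C D F bs b p \<in> Hom V (one V) (hprd D (vfob F b) (map (vfob F) bs))"
    "i < length bs \<Longrightarrow> Cmp V (one V) (hprd D (vfob F b) (map (vfob F) bs)) (VHom D (vfob F b) (vfob F (bs ! i)))
      (hprj D (vfob F b) (map (vfob F) bs) i) (image_cone V C D F bs b p) =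
     vact V C D F (one V) b (bs ! i) (leg C b bs p i)"
proof -
  note [simp] = vfunD[OF F]
  have bsi [simp]: "i < length bs \<Longrightarrow> bs ! i \<in> VOb C" for i using bs nth_mem by blast
  have H: "set (map (VHom C b) bs) \<subseteq> Ob V" by simp
  have K: "set (map (\<lambda>b'. VHom D (vfob F b) (vfob F b')) bs) \<subseteq> Ob V"
    using subsetD[OF bs(1)] by (auto intro!: vcat_Hom vfun_ob[OF F])
  let ?xs = "map (VHom C b) bs" and ?ys = "map (\<lambda>b'. VHom D (vfob F b) (vfob F b')) bs"
  have prj: "prj V ?xs i \<in> Hom V (prd V ?xs) (VHom C b (bs ! i))" if "i < length bs" for i
    using prj_in[OF H] that by simp
  have prj': "prj V ?ys i \<in> Hom V (prd V ?ys) (VHom D (vfob F b) (vfob F (bs ! i)))" if "i < length bs" for i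
    using prj_in[OF K] that by simp
  have nth: "map (\<lambda>i. Cmp V (prd V ?xs) (?xs ! i) (?ys ! i) (map (vfar F b) bs ! i) (prj V ?xs i)) [0..<length ?xs] ! i \<in>
    Hom V (prd V ?xs) (?ys ! i)" if "i < length ?ys" for i
    using that prj by simp
  have pm: "prod_map V ?xs ?ys (map (vfar F b) bs) \<in> Hom V (prd V ?xs) (prd V ?ys)"
    unfolding prod_map_def by (rule tuple_in[OF K _ nth]) (use prd_Ob[OF H] in auto)
  have pp: "Cmp V (prd V ?xs) (prd V ?ys) (VHom D (vfob F b) (vfob F (bs ! i))) (prj V ?ys i) (prod_map V ?xs ?ys (map (vfar F b) bs)) =
    vact V C D F (prd V ?xs) b (bs ! i) (prj V ?xs i)" if "i < length bs" for i
    unfolding prod_map_def using prj_tuple[OF K _ nth, of i] prd_Ob[OF H] that by simp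
  show "image_cone V C D F bs b p \<in> Hom V (one V) (hprd D (vfob F b) (map (vfob F) bs))"
    using pm by (simp add: image_cone_def Let_def comp_def)
  show "Cmp V (one V) (hprd D (vfob F b) (map (vfob F) bs)) (VHom D (vfob F b) (vfob F (bs ! i)))
      (hprj D (vfob F b) (map (vfob F) bs) i) (image_cone V C D F bs b p) =
     vact V C D F (one V) b (bs ! i) (leg C b bs p i)" if "i < length bs"
    using that pm prj prj' by (simp add: image_cone_def Let_def comp_def reassoc[OF pp])
qed

abbreviation image_points ::
  "('c, 'o, 'm) vcat \<Rightarrow> ('d, 'o, 'm) vcat \<Rightarrow> ('c, 'd, 'm) vfun \<Rightarrow> 'c list \<Rightarrow> 'c \<Rightarrow> (nat \<Rightarrow> 'm) \<Rightarrow> nat \<Rightarrow> 'm" where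
  "image_points C D F bs b q \<equiv> \<lambda>i. vact V C D F (one V) b (bs ! i) (q i)"

lemma preserves_vproducts_iff:
  assumes F: "is_vfun V C D F"
  shows "preserves_vproducts V C D F \<longleftrightarrow>
    (\<forall>bs b q. ucone V C bs b q \<longrightarrow> ucone V D (map (vfob F) bs) (vfob F b) (image_points C D F bs b q))"
proof -
  note [simp] = vfunD[OF F] note C = is_vfun_vcat[OF F]
  \<comment> \<open>The family \<open>q\<close> is required to agree with the legs of
    \<open>p\<close> only below the length of \<open>bs\<close>; this is all that
    \<open>ucone_tuple\<close> provides about the point that it constructs.\<close>
  have "universal_cone V D (map (vfob F) bs) (vfob F b) (image_cone V C D F bs b p) \<longleftrightarrow>
    ucone V D (map (vfob F) bs) (vfob F b) (image_points C D F bs b q)"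
    if u: "universal_cone V C bs b p" and q: "\<And>i. i < length bs \<Longrightarrow> leg C b bs p i = q i" for bs b p q
  proof -
    have h: "set bs \<subseteq> VOb C" "b \<in> VOb C" "p \<in> Hom V (one V) (hprd C b bs)"
      using u by (auto simp: universal_cone_def)
    show ?thesis
      unfolding universal_cone_iff[OF C(2)]
      by (subst ucone_cong[OF refl refl, where q' = "image_points C D F bs b q"])
        (use image_cone_spec[OF F h] q in auto)
  qed
  note * = this
  show ?thesis
  proof
    assume pr: "preserves_vproducts V C D F"
    show "\<forall>bs b q. ucone V C bs b q \<longrightarrow> ucone V D (map (vfob F) bs) (vfob F b) (image_points C D F bs b q)"
    proof (intro allI impI)
      fix bs b q assume q: "ucone V C bs b q"
      show "ucone V D (map (vfob F) bs) (vfob F b) (image_points C D F bs b q)"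
        using *[OF ucone_tuple[OF C(1) q]] ucone_tuple(1)[OF C(1) q] pr
        unfolding preserves_vproducts_def by blast
    qed
  next
    assume pr: "\<forall>bs b q. ucone V C bs b q \<longrightarrow> ucone V D (map (vfob F) bs) (vfob F b) (image_points C D F bs b q)"
    show "preserves_vproducts V C D F"
      unfolding preserves_vproducts_def
    proof (intro allI impI)
      fix bs b p assume u: "universal_cone V C bs b p"
      then have "ucone V C bs b (leg C b bs p)" by (simp add: universal_cone_iff)
      with pr have "ucone V D (map (vfob F) bs) (vfob F b) (image_points C D F bs b (leg C b bs p))" by blast
      then show "universal_cone V D (map (vfob F) bs) (vfob F b) (image_cone V C D F bs b p)"
        using *[OF u refl] by simp
    qed
  qed
qed

lemma is_pvfun_ucone:
  "is_pvfun V C D F \<Longrightarrow> ucone V C bs b q \<Longrightarrow> ucone V D (map (vfob F) bs) (vfob F b) (image_points C D F bs b q)"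
  using preserves_vproducts_iff unfolding is_pvfun_def by blast

lemma is_pvfun_id [simp]:
  assumes C [simp]: "is_vcat V C"
  shows "is_pvfun V C C (id_vfun V C)"
  unfolding is_pvfun_def preserves_vproducts_iff[OF is_vfun_id[OF C]]
proof (intro conjI allI impI)
  fix bs b q assume q: "ucone V C bs b q"
  have "map (vfob (id_vfun V C)) bs = bs" using q by (intro map_idI) (auto simp: ucone_def)
  moreover have "i < length bs \<Longrightarrow> image_points C C (id_vfun V C) bs b q i = q i" for i
    using ucone_ob[OF q] ucone_in[OF q] by simp
  ultimately show "ucone V C (map (vfob (id_vfun V C)) bs) (vfob (id_vfun V C) b) (image_points C C (id_vfun V C) bs b q)"
    using q ucone_ob[OF q] by (simp cong: ucone_cong)
qed auto

lemma is_pvfun_comp [simp]: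
  assumes F: "is_pvfun V A B F" and G: "is_pvfun V B C G"
  shows "is_pvfun V A C (comp_vfun V A B C G F)"
proof -
  note [simp] = pvfunD[OF F] pvfunD[OF G]
  have GF: "is_vfun V A C (comp_vfun V A B C G F)" by simp
  show ?thesis
    unfolding is_pvfun_def preserves_vproducts_iff[OF GF]
  proof (intro conjI allI impI)
    fix bs b q assume q: "ucone V A bs b q"
    have u: "ucone V C (map (vfob G) (map (vfob F) bs)) (vfob G (vfob F b))
      (image_points B C G (map (vfob F) bs) (vfob F b) (image_points A B F bs b q))"
      by (rule is_pvfun_ucone[OF G is_pvfun_ucone[OF F q]])
    have 1: "map (vfob (comp_vfun V A B C G F)) bs = map (vfob G) (map (vfob F) bs)"
      using q by (auto simp: ucone_def)
    have 2: "i < length bs \<Longrightarrow> image_points A C (comp_vfun V A B C G F) bs b q i =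
      image_points B C G (map (vfob F) bs) (vfob F b) (image_points A B F bs b q) i" for i
      using ucone_ob[OF q] ucone_in[OF q] by simp
    show "ucone V C (map (vfob (comp_vfun V A B C G F)) bs) (vfob (comp_vfun V A B C G F) b)
      (image_points A C (comp_vfun V A B C G F) bs b q)"
      unfolding 1 using ucone_cong[THEN iffD2, OF refl _ 2 u] ucone_ob[OF q] by simp
  qed auto
qed

text \<open>Postcomposition with \<open>e\<close> is a bijection from the elements of
  \<open>VHom C x b'\<close> to those of \<open>VHom C x b\<close> at every stage, with
  postcomposition by \<open>e'\<close> as inverse, and \<open>q' i\<close> acts on an element as
  \<open>q i\<close> acts on its image.\<close>

lemma ucone_iso:
  assumes C [simp]: "is_vcat V C" and q: "ucone V C bs b q" and b' [simp]: "b' \<in> VOb C"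
    and e [simp]: "e \<in> Hom V (one V) (VHom C b' b)" "e' \<in> Hom V (one V) (VHom C b b')"
    and ee: "vcomp V C (one V) b' b b' e' e = VIdt C b'" "vcomp V C (one V) b b' b e e' = VIdt C b"
    and q': "\<And>i. i < length bs \<Longrightarrow> q' i = vcomp V C (one V) b' b (bs ! i) (q i) e"
  shows "ucone V C bs b' q'"
proof -
  note [simp] = ucone_ob[OF q] ucone_in[OF q] q'
  have ee': "post V C y b' b b' e' (const_elt V y (VHom C b' b) e) = const_elt V y (VHom C b' b') (VIdt C b')"
    "post V C y b b' b e (const_elt V y (VHom C b b') e') = const_elt V y (VHom C b b) (VIdt C b)"
    if [simp]: "y \<in> Ob V" for y
    using arg_cong[OF ee(1), of "\<lambda>k. const_elt V y (VHom C b' b') k"]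
      arg_cong[OF ee(2), of "\<lambda>k. const_elt V y (VHom C b b) k"] by simp_all
  have c1: "post V C y x b' b e (post V C y x b b' e' u) = u"
    if [simp]: "y \<in> Ob V" "x \<in> VOb C" "u \<in> Hom V y (VHom C x b)" for x y u
    by (simp add: vcomp_reassoc[OF ee'(2)])
  have c2: "post V C y x b b' e' (post V C y x b' b e u) = u"
    if [simp]: "y \<in> Ob V" "x \<in> VOb C" "u \<in> Hom V y (VHom C x b')" for x y u
    by (simp add: vcomp_reassoc[OF ee'(1)])
  show ?thesis
  proof (rule uconeI)
    show "set bs \<subseteq> VOb C" "b' \<in> VOb C" using q by (auto simp: ucone_def)
    show "q' i \<in> Hom V (one V) (VHom C b' (bs ! i))" if "i < length bs" for i using that by simp
    fix x y assume [simp]: "x \<in> VOb C" "y \<in> Ob V"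
    fix v assume v: "\<And>i. i < length bs \<Longrightarrow> v i \<in> Hom V y (VHom C x (bs ! i))"
    obtain u where u [simp]: "u \<in> Hom V y (VHom C x b)"
      "\<And>i. i<length bs \<Longrightarrow> post V C y x b (bs ! i) (q i) u = v i"
      using ucone_ex1[OF q, of x y v] v by auto
    show "\<exists>u. u \<in> Hom V y (VHom C x b') \<and>
        (\<forall>i<length bs. post V C y x b' (bs ! i) (q' i) u = v i)"
      by (rule exI[of _ "post V C y x b b' e' u"]) (simp add: c1)
  next
    fix x y u u' assume [simp]: "x \<in> VOb C" "y \<in> Ob V" "u \<in> Hom V y (VHom C x b')" "u' \<in> Hom V y (VHom C x b')"
      and eq: "\<And>i. i < length bs \<Longrightarrow> post V C y x b' (bs ! i) (q' i) u =
        post V C y x b' (bs ! i) (q' i) u'"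
    have "post V C y x b' b e u = post V C y x b' b e u'"
      by (rule ucone_ext[OF C q, of x _ y]) (use eq in auto)
    then have "post V C y x b b' e' (post V C y x b' b e u) =
        post V C y x b b' e' (post V C y x b' b e u')"
      by (simp only:)
    then show "u = u'" by (simp add: c2)
  qed
qed

text \<open>Each universal property at stage \<open>one V\<close> yields one comparison map; their
  composites are identities because they agree with the identities on all legs.\<close>

lemma ucone_iso_ex:
  assumes C [simp]: "is_vcat V C" and q: "ucone V C bs b q" and q': "ucone V C bs b' q'"
  obtains e e' where "e \<in> Hom V (one V) (VHom C b' b)" "e' \<in> Hom V (one V) (VHom C b b')"
    "vcomp V C (one V) b' b b' e' e = VIdt C b'" "vcomp V C (one V) b b' b e e' = VIdt C b"
    "\<And>i. i < length bs \<Longrightarrow> q' i = vcomp V C (one V) b' b (bs ! i) (q i) e"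
proof -
  note [simp] = ucone_ob[OF q] ucone_in[OF q] ucone_ob(1)[OF q'] ucone_in[OF q']
  obtain e where e [simp]: "e \<in> Hom V (one V) (VHom C b' b)"
    "\<And>i. i < length bs \<Longrightarrow> vcomp V C (one V) b' b (bs ! i) (q i) e = q' i"
    using ucone_ex1[OF q, of b' "one V" q'] by auto
  obtain e' where e' [simp]: "e' \<in> Hom V (one V) (VHom C b b')"
    "\<And>i. i < length bs \<Longrightarrow> vcomp V C (one V) b b' (bs ! i) (q' i) e' = q i"
    using ucone_ex1[OF q', of b "one V" q] by auto
  have "vcomp V C (one V) b' b b' e' e = VIdt C b'"
  proof (rule ucone_ext[OF C q', of b' _ "one V"])
    fix i assume i [simp]: "i < length bs"
    show "post V C (one V) b' b' (bs ! i) (q' i) (vcomp V C (one V) b' b b' e' e) =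
      post V C (one V) b' b' (bs ! i) (q' i) (VIdt C b')"
      using vcomp_assoc[OF C, of b' b b' "bs ! i" "q' i" "one V" e' e] by simp
  qed auto
  moreover have "vcomp V C (one V) b b' b e e' = VIdt C b"
  proof (rule ucone_ext[OF C q, of b _ "one V"])
    fix i assume i [simp]: "i < length bs"
    show "post V C (one V) b b (bs ! i) (q i) (vcomp V C (one V) b b' b e e') =
      post V C (one V) b b (bs ! i) (q i) (VIdt C b)"
      using vcomp_assoc[OF C, of b b' b "bs ! i" "q i" "one V" e e'] by simp
  qed auto
  ultimately show ?thesis using that e e' by metis
qed

text \<open>Product cones over the same list are isomorphic and enriched functors preserve isomorphisms, so one cone per list suffices.\<close>

lemma is_pvfunI:
  assumes F [simp]: "is_vfun V C D F"
    and ex: "\<And>bs. set bs \<subseteq> VOb C \<Longrightarrow> \<exists>b q. ucone V C bs b q \<and>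
      ucone V D (map (vfob F) bs) (vfob F b) (image_points C D F bs b q)"
  shows "is_pvfun V C D F"
  unfolding is_pvfun_def preserves_vproducts_iff[OF F]
proof (intro conjI allI impI F)
  fix bs b' q' assume q': "ucone V C bs b' q'"
  note [simp] = vfunD[OF F] note C = is_vfun_vcat[OF F]
  obtain b q where q: "ucone V C bs b q" and FQ: "ucone V D (map (vfob F) bs) (vfob F b) (image_points C D F bs b q)"
    using ex[of bs] q' by (auto simp: ucone_def)
  note [simp] = ucone_ob[OF q] ucone_in[OF q] ucone_ob(1)[OF q'] ucone_in[OF q']
  obtain e e' where e [simp]: "e \<in> Hom V (one V) (VHom C b' b)" "e' \<in> Hom V (one V) (VHom C b b')"
    and ee: "vcomp V C (one V) b' b b' e' e = VIdt C b'" "vcomp V C (one V) b b' b e e' = VIdt C b"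
    and eq: "\<And>i. i < length bs \<Longrightarrow> q' i = vcomp V C (one V) b' b (bs ! i) (q i) e"
    using ucone_iso_ex[OF C(1) q q'] by metis
  let ?e = "vact V C D F (one V) b' b e"
  let ?e' = "vact V C D F (one V) b b' e'"
  show "ucone V D (map (vfob F) bs) (vfob F b') (image_points C D F bs b' q')"
  proof (rule ucone_iso[OF C(2) FQ, of _ ?e ?e'])
    show "vcomp V D (one V) (vfob F b') (vfob F b) (vfob F b') ?e' ?e = VIdt D (vfob F b')"
      using arg_cong[OF ee(1), of "Cmp V (one V) (VHom C b' b') (VHom D (vfob F b') (vfob F b')) (vfar F b' b')"] by simp
    show "vcomp V D (one V) (vfob F b) (vfob F b') (vfob F b) ?e ?e' = VIdt D (vfob F b)"
      using arg_cong[OF ee(2), of "Cmp V (one V) (VHom C b b) (VHom D (vfob F b) (vfob F b)) (vfar F b b)"] by simp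
  qed (use eq in auto)
qed

text \<open>Every list of objects of \<open>D\<close> lifts along \<open>vfob F\<close>, and the
  image of a product cone over the lift is again a product cone. For a theory \<open>F\<close> is
  the structure map, which is the identity on objects.\<close>

lemma has_vproducts_image:
  assumes F: "is_pvfun V C D F" and C: "has_vproducts V C" and surj: "VOb D \<subseteq> vfob F ` VOb C"
  shows "has_vproducts V D"
proof -
  note F' = is_pvfun_vfun[OF F] note CD = is_vfun_vcat[OF F']
  show ?thesis
    unfolding has_vproducts_iff[OF CD(2)]
  proof (intro allI impI)
    fix bs assume "set bs \<subseteq> VOb D"
    then have "bs \<in> lists (vfob F ` VOb C)" using surj by (auto simp: lists_eq_set)
    then have "\<exists>cs. set cs \<subseteq> VOb C \<and> bs = map (vfob F) cs"
      unfolding lists_image by (auto simp: lists_eq_set)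
    then show "\<exists>b q. ucone V D bs b q"
      using C is_pvfun_ucone[OF F] unfolding has_vproducts_iff[OF CD(1)] by blast
  qed
qed

end

section \<open>The initial enriched theory\<close>

lemma nat_digits_ex:
  assumes "\<And>i. i < m \<Longrightarrow> \<phi> i < n"
  obtains k :: nat where "k < n ^ m" "\<And>i. i < m \<Longrightarrow> k div n ^ i mod n = \<phi> i"
proof -
  have "\<exists>k<n ^ m. \<forall>i<m. k div n ^ i mod n = \<phi> i"
    using assms
  proof (induction m arbitrary: \<phi>)
    case (Suc m)
    from Suc.IH[of "\<lambda>i. \<phi> (Suc i)"] Suc.prems obtain k where
      k: "k < n ^ m" "\<And>i. i < m \<Longrightarrow> k div n ^ i mod n = \<phi> (Suc i)" by auto
    have n: "\<phi> 0 < n" using Suc.prems by simp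
    \<comment> \<open>\<open>\<phi> 0\<close> becomes the lowest digit, and division by
      \<open>n\<close> leaves the number that encodes the shifted function.\<close>
    let ?k = "\<phi> 0 + n * k"
    have "?k < n * Suc k" using n by simp
    also have "\<dots> \<le> n * n ^ m" using k(1) by (intro mult_le_mono2) simp
    finally have "?k < n ^ Suc m" by simp
    moreover have "?k div n ^ i mod n = \<phi> i" if "i < Suc m" for i
      using that n k(2) by (cases i) (auto simp: div_mult2_eq)
    ultimately show ?case by blast
  qed auto
  then show ?thesis using that by blast
qed

text \<open>As \<open>i < m\<close> makes the exponent positive, \<open>k < n ^ m\<close> excludes
  \<open>n = 0\<close>, the only case in which \<open>mod\<close> would not bound the digit.\<close>

lemma nat_digit_less: "k div n ^ i mod n < n" if "k < n ^ m" "i < m" for k n m i :: nat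
proof -
  have "n \<noteq> 0" using that by (cases "n = 0") (auto simp: zero_power)
  then show ?thesis by simp
qed

text \<open>Together with the next two lemmas: \<open>sum_list (take i bs) + j\<close> numbers the
  position \<open>j\<close> of block \<open>i\<close>, and this is a bijection onto the numbers
  below \<open>sum_list bs\<close>. It realises the disjoint union of finite sets, which becomes the
  product in \<open>A_vcat\<close>.\<close>

lemma sum_list_block:
  fixes bs :: "nat list"
  assumes "i < length bs" "j < bs ! i"
  shows "sum_list (take i bs) + j < sum_list bs"
  using assms
proof (induction bs arbitrary: i)
  case (Cons a bs)
  then show ?case by (cases i) auto
qed simp

lemma sum_list_block_ex:
  fixes bs :: "nat list"
  assumes "k < sum_list bs"
  obtains i j where "i < length bs" "j < bs ! i" "k = sum_list (take i bs) + j"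
proof -
  have "\<exists>i j. i < length bs \<and> j < bs ! i \<and> k = sum_list (take i bs) + j"
    using assms
  proof (induction bs arbitrary: k)
    case (Cons a bs)
    show ?case
    proof (cases "k < a")
      case True
      then show ?thesis by (intro exI[of _ 0] exI[of _ k]) auto
    next
      case False
      then have "k - a < sum_list bs" using Cons.prems by auto
      then obtain i j where "i < length bs" "j < bs ! i" "k - a = sum_list (take i bs) + j"
        using Cons.IH[of "k - a"] by blast
      then show ?thesis using False by (intro exI[of _ "Suc i"] exI[of _ j]) auto
    qed
  qed simp
  then show ?thesis using that by blast
qed

lemma sum_list_block_inj:
  fixes bs :: "nat list"
  assumes "i < length bs" "j < bs ! i" "i' < length bs" "j' < bs ! i'"
    "sum_list (take i bs) + j = sum_list (take i' bs) + j'"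
  shows "i = i' \<and> j = j'"
  using assms
proof (induction bs arbitrary: i i')
  case (Cons a bs)
  show ?case
  proof (cases i)
    case 0
    then show ?thesis using Cons.prems by (cases i') auto
  next
    case (Suc k)
    show ?thesis
    proof (cases i')
      case 0
      then show ?thesis using Cons.prems Suc by auto
    next
      case (Suc k')
      then show ?thesis using Cons.prems Cons.IH[of k k'] \<open>i = Suc k\<close> by simp
    qed
  qed
qed simp

definition num_map :: "('o, 'm) ebase \<Rightarrow> nat \<Rightarrow> nat \<Rightarrow> (nat \<Rightarrow> nat) \<Rightarrow> 'm" where
  "num_map V m n \<phi> = cotuple V m (num V n) (\<lambda>i. inj V n (\<phi> i))"

text \<open>The point of the exponential that names the map \<open>num_map V m n \<phi>\<close>.
  When \<open>\<phi>\<close> is the digit function of \<open>k\<close>, it is the value of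
  \<open>num_expo\<close> on the \<open>k\<close>-th injection, see
  \<open>num_expo_inj\<close>.\<close>

definition num_name :: "('o, 'm) ebase \<Rightarrow> nat \<Rightarrow> nat \<Rightarrow> (nat \<Rightarrow> nat) \<Rightarrow> 'm" where
  "num_name V m n \<phi> = curry' V (one V) (num V m) (num V n)
     (Cmp V (prd V [one V, num V m]) (num V m) (num V n) (num_map V m n \<phi>) (prj V [one V, num V m] 1))"

abbreviation npow :: "('o, 'm) ebase \<Rightarrow> nat \<Rightarrow> nat \<Rightarrow> 'o" where
  "npow V n m \<equiv> expo V (num V n) (num V m)"

text \<open>An element of \<open>npow V n m\<close> is treated as an \<open>m\<close>-tuple of
  elements of \<open>num V n\<close>; \<open>num_expo_ext\<close> says that its coordinates
  determine it.\<close>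

abbreviation coord :: "('o, 'm) ebase \<Rightarrow> 'o \<Rightarrow> nat \<Rightarrow> nat \<Rightarrow> 'm \<Rightarrow> nat \<Rightarrow> 'm" where
  "coord V y m n u i \<equiv> app V y (num V m) (num V n) u (const_elt V y (num V m) (inj V m i))"

lemma op_vcat_sel:
  "VOb (op_vcat V C) = VOb C"
  "VHom (op_vcat V C) a b = VHom C b a"
  "VIdt (op_vcat V C) = VIdt C"
  "a \<in> VOb C \<Longrightarrow> b \<in> VOb C \<Longrightarrow> c \<in> VOb C \<Longrightarrow> VCmp (op_vcat V C) a b c =
     Cmp V (prd V [VHom C c b, VHom C b a]) (prd V [VHom C b a, VHom C c b]) (VHom C c a) (VCmp C c b a)
       (tuple V (prd V [VHom C c b, VHom C b a]) [VHom C b a, VHom C c b]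
         [prj V [VHom C c b, VHom C b a] (Suc 0), prj V [VHom C c b, VHom C b a] 0])"
  by (simp_all add: op_vcat_def Let_def)

lemma N_vcat_sel:
  "VOb (N_vcat V) = UNIV"
  "VHom (N_vcat V) m n = npow V n m"
  "VIdt (N_vcat V) n = curry' V (one V) (num V n) (num V n) (prj V [one V, num V n] 1)"
  "VCmp (N_vcat V) k l n =
    (let K = num V k; L = num V l; N = num V n; NL = expo V N L; LK = expo V L K; P = prd V [NL, LK]; S = prd V [P, K]
     in curry' V P K N
       (app V S L N (Cmp V S P NL (prj V [NL, LK] 0) (prj V [P, K] 0))
         (app V S K L (Cmp V S P LK (prj V [NL, LK] 1) (prj V [P, K] 0)) (prj V [P, K] 1))))"
  unfolding N_vcat_def vcat.select_convs Let_def app_def by (rule refl)+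

lemma A_vcat_sel [simp]:
  "VOb (A_vcat V) = UNIV"
  "VHom (A_vcat V) a b = npow V a b"
  by (simp_all add: A_vcat_def op_vcat_sel N_vcat_sel)

section \<open>Names of functions and composition in \<open>A_vcat\<close>\<close>

context base
begin

lemma num_map_in [simp]: "(\<And>i. i < m \<Longrightarrow> \<phi> i < n) \<Longrightarrow> num_map V m n \<phi> \<in> Hom V (num V m) (num V n)"
  unfolding num_map_def by (rule cotuple_in) auto

lemma num_map_inj [simp]:
  assumes "\<And>i. i < m \<Longrightarrow> \<phi> i < n" "i < m"
  shows "Cmp V (one V) (num V m) (num V n) (num_map V m n \<phi>) (inj V m i) = inj V n (\<phi> i)"
  unfolding num_map_def by (rule cotuple_inj) (use assms in auto)

lemma num_map_inj_const [simp]: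
  assumes "\<And>i. i < m \<Longrightarrow> \<phi> i < n" "i < m" "y \<in> Ob V"
  shows "Cmp V y (num V m) (num V n) (num_map V m n \<phi>) (const_elt V y (num V m) (inj V m i)) =
    const_elt V y (num V n) (inj V n (\<phi> i))"
  using assms by (simp add: reassoc[OF num_map_inj])

lemma num_name_in [simp]: "(\<And>i. i < m \<Longrightarrow> \<phi> i < n) \<Longrightarrow> num_name V m n \<phi> \<in> Hom V (one V) (npow V n m)"
  unfolding num_name_def by simp

lemma app_num_name [simp]:
  assumes "\<And>i. i < m \<Longrightarrow> \<phi> i < n" "s \<in> Hom V y (num V m)" "t \<in> Hom V y (one V)"
  shows "app V y (num V m) (num V n) (Cmp V y (one V) (npow V n m) (num_name V m n \<phi>) t) s =
    Cmp V y (num V m) (num V n) (num_map V m n \<phi>) s"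
  using assms unfolding num_name_def by simp

lemma app_num_name_one [simp]:
  assumes "\<And>i. i < m \<Longrightarrow> \<phi> i < n" "s \<in> Hom V (one V) (num V m)"
  shows "app V (one V) (num V m) (num V n) (num_name V m n \<phi>) s = Cmp V (one V) (num V m) (num V n) (num_map V m n \<phi>) s"
  using app_num_name[OF assms, where t = "Idt V (one V)"] assms by simp

lemma num_expo_ext:
  assumes "u \<in> Hom V y (npow V n m)" "u' \<in> Hom V y (npow V n m)"
    and "\<And>i. i < m \<Longrightarrow> coord V y m n u i =
      coord V y m n u' i"
  shows "u = u'"
  by (rule copower_expo_ext[OF copower_num, of "num V n" _ y m]) (use assms in auto)

lemma num_name_cong:
  assumes "\<And>i. i < m \<Longrightarrow> \<phi> i < n" "\<And>i. i < m \<Longrightarrow> \<phi> i = \<psi> i"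
  shows "num_name V m n \<phi> = num_name V m n \<psi>"
proof -
  have \<psi>: "i < m \<Longrightarrow> \<psi> i < n" for i using assms by fastforce
  show ?thesis
    by (rule num_expo_ext[where y = "one V" and m = m and n = n]) (use assms \<psi> in auto)
qed

lemma A_vcat_VCmp_in: "VCmp (A_vcat V) a b c \<in>
  Hom V (prd V [npow V b c, npow V a b]) (npow V a c)"
  by (simp add: A_vcat_def op_vcat_sel N_vcat_sel Let_def)

lemma A_vcat_VIdt_in: "VIdt (A_vcat V) a \<in> Hom V (one V) (npow V a a)"
  by (simp add: A_vcat_def op_vcat_sel N_vcat_sel)

lemma app_A_VIdt:
  "s \<in> Hom V y (num V a) \<Longrightarrow> t \<in> Hom V y (one V) \<Longrightarrow>
    app V y (num V a) (num V a) (Cmp V y (one V) (npow V a a) (VIdt (A_vcat V) a) t) s = s"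
  by (simp add: A_vcat_def op_vcat_sel N_vcat_sel)

text \<open>The hom-object from \<open>b\<close> to \<open>c\<close> in \<open>A_vcat\<close>
  consists of maps from \<open>num V c\<close> to \<open>num V b\<close>, so the argument meets
  \<open>g\<close> before \<open>f\<close>.\<close>

lemma app_A_vcomp:
  assumes [simp]: "g \<in> Hom V y (npow V b c)" "f \<in> Hom V y (npow V a b)"
    "t \<in> Hom V z y" "s \<in> Hom V z (num V c)"
  shows "app V z (num V c) (num V a) (Cmp V z y (npow V a c) (vcomp V (A_vcat V) y a b c g f) t) s =
    app V z (num V b) (num V a) (Cmp V z y (npow V a b) f t)
      (app V z (num V c) (num V b) (Cmp V z y (npow V b c) g t) s)"
  by (simp add: vcomp_def A_vcat_def op_vcat_sel N_vcat_sel Let_def)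

lemma A_vcomp_in: "g \<in> Hom V y (npow V b c) \<Longrightarrow> f \<in> Hom V y (npow V a b) \<Longrightarrow>
   vcomp V (A_vcat V) y a b c g f \<in> Hom V y (npow V a c)"
  unfolding vcomp_def using A_vcat_VCmp_in by simp

text \<open>By \<open>expo_ext\<close> the laws are tested on a generic argument. There composition
  is iterated application, for which associativity and the unit laws are immediate.\<close>

lemma is_vcat_A [simp]: "is_vcat V (A_vcat V)"
proof (rule is_vcatI, goal_cases)
  case (4 a b c d y h g f)
  note [simp] = A_vcomp_in app_A_vcomp 4[unfolded A_vcat_sel]
  show ?case by (rule expo_ext[of "num V d" "num V a" _ y]) auto
next
  case (5 a b y f)
  note [simp] = A_vcomp_in app_A_vcomp 5[unfolded A_vcat_sel]
  show ?case by (rule expo_ext[of "num V b" "num V a" _ y]) (auto simp: app_A_VIdt A_vcat_VIdt_in)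
next
  case (6 a b y f)
  note [simp] = A_vcomp_in app_A_vcomp 6[unfolded A_vcat_sel]
  show ?case by (rule expo_ext[of "num V b" "num V a" _ y]) (auto simp: app_A_VIdt A_vcat_VIdt_in)
qed (use A_vcat_VCmp_in A_vcat_VIdt_in in auto)

lemma app_A_vcomp' [simp]:
  assumes "g \<in> Hom V y (npow V b c)" "f \<in> Hom V y (npow V a b)" "s \<in> Hom V y (num V c)"
  shows "app V y (num V c) (num V a) (vcomp V (A_vcat V) y a b c g f) s =
    app V y (num V b) (num V a) f (app V y (num V c) (num V b) g s)"
proof -
  have "y \<in> Ob V" using assms Hom_Ob by blast
  then show ?thesis using app_A_vcomp[OF assms(1,2) Idt_in assms(3)] assms by (simp add: A_vcomp_in)
qed

lemma A_VIdt_num_name: "VIdt (A_vcat V) a = num_name V a a (\<lambda>i. i)"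
proof (rule num_expo_ext[of _ "one V"])
  fix i assume "i < a"
  then show "coord V (one V) a a (VIdt (A_vcat V) a) i =
    coord V (one V) a a (num_name V a a (\<lambda>i. i)) i"
    using app_A_VIdt[of "inj V a i" "one V" a "Idt V (one V)"] A_vcat_VIdt_in[of a] by simp
qed (use A_vcat_VIdt_in in auto)

lemma A_vcomp_num_name:
  assumes "\<And>i. i < c \<Longrightarrow> \<phi> i < b" "\<And>i. i < b \<Longrightarrow> \<psi> i < a"
  shows "vcomp V (A_vcat V) (one V) a b c (num_name V c b \<phi>) (num_name V b a \<psi>) = num_name V c a (\<lambda>i. \<psi> (\<phi> i))"
  by (rule num_expo_ext[where y = "one V" and m = c and n = a]) (use assms in \<open>auto simp: A_vcomp_in\<close>)

text \<open>Leg \<open>i\<close> names the inclusion of block \<open>i\<close>: in the opposite of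
  finite sets the product is the disjoint union.\<close>

abbreviation A_cone :: "nat list \<Rightarrow> nat \<Rightarrow> 'm" where
  "A_cone bs \<equiv> \<lambda>i. num_name V (bs ! i) (sum_list bs) (\<lambda>j. sum_list (take i bs) + j)"

text \<open>An element of \<open>npow V x (sum_list bs)\<close> is a family of coordinates, and
  composing with leg \<open>i\<close> selects those in block \<open>i\<close>. Prescribing all
  composites therefore prescribes each coordinate exactly once.\<close>

lemma ucone_A: "ucone V (A_vcat V) bs (sum_list bs) (A_cone bs)"
proof (rule uconeI)
  note [simp] = sum_list_block
  show "A_cone bs i \<in> Hom V (one V) (VHom (A_vcat V) (sum_list bs) (bs ! i))" if "i < length bs" for i
    using that by simp
  have app: "coord V y (bs ! i) x (post V (A_vcat V) y x (sum_list bs) (bs ! i) (A_cone bs i) u) j =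
     coord V y (sum_list bs) x u (sum_list (take i bs) + j)"
    if "i < length bs" "j < bs ! i" "y \<in> Ob V" "u \<in> Hom V y (VHom (A_vcat V) x (sum_list bs))" for x y u i j
    using that by simp
  fix x y assume [simp]: "y \<in> Ob V"
  { fix v assume v: "\<And>i. i < length bs \<Longrightarrow> v i \<in> Hom V y (VHom (A_vcat V) x (bs ! i))"
    \<comment> \<open>\<open>P k g\<close> says that \<open>g\<close> is the coordinate prescribed
      at \<open>k\<close>. A relation avoids a formula for the block that contains \<open>k\<close>;
      \<open>geq\<close> shows that the choice made from it is forced.\<close>
    define P where "P k g \<longleftrightarrow> (\<exists>i j. i < length bs \<and> j < bs ! i \<and> k = sum_list (take i bs) + j \<and>
      g = coord V y (bs ! i) x (v i) j)" for k g
    have "\<exists>g. P k g" if "k < sum_list bs" for k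
      using sum_list_block_ex[OF that] unfolding P_def by metis
    then obtain g where g: "\<And>k. k < sum_list bs \<Longrightarrow> P k (g k)" by metis
    have gin: "g k \<in> Hom V y (num V x)" if "k < sum_list bs" for k
      using g[OF that] v by (auto simp: P_def)
    obtain u where u: "u \<in> Hom V y (npow V x (sum_list bs))"
      "\<And>k. k < sum_list bs \<Longrightarrow> coord V y (sum_list bs) x u k = g k"
      by (rule copower_expo_ex[OF copower_num, of "num V x" y "sum_list bs" g]) (use gin in auto)
    have geq: "g (sum_list (take i bs) + j) = coord V y (bs ! i) x (v i) j"
      if "i < length bs" "j < bs ! i" for i j
      using g[OF sum_list_block[OF that]] sum_list_block_inj[OF that] unfolding P_def by metis
    have "post V (A_vcat V) y x (sum_list bs) (bs ! i) (A_cone bs i) u = v i"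
      if i: "i < length bs" for i
    proof (rule num_expo_ext[of _ y x "bs ! i"])
      show "post V (A_vcat V) y x (sum_list bs) (bs ! i) (A_cone bs i) u
        \<in> Hom V y (npow V x (bs ! i))"
        using u i by (intro A_vcomp_in) auto
    qed (use i v u app geq in auto)
    then show "\<exists>u. u \<in> Hom V y (VHom (A_vcat V) x (sum_list bs)) \<and> (\<forall>i<length bs. post V (A_vcat V) y x (sum_list bs) (bs ! i) (A_cone bs i) u = v i)"
      using u(1) by auto }
  { fix u u' assume u: "u \<in> Hom V y (VHom (A_vcat V) x (sum_list bs))" "u' \<in> Hom V y (VHom (A_vcat V) x (sum_list bs))"
      and eq: "\<And>i. i < length bs \<Longrightarrow> post V (A_vcat V) y x (sum_list bs) (bs ! i) (A_cone bs i) u =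
        post V (A_vcat V) y x (sum_list bs) (bs ! i) (A_cone bs i) u'"
    show "u = u'"
    proof (rule num_expo_ext[of _ y x "sum_list bs"])
      fix k assume "k < sum_list bs"
      then obtain i j where ij: "i < length bs" "j < bs ! i" "k = sum_list (take i bs) + j"
        by (rule sum_list_block_ex)
      show "coord V y (sum_list bs) x u k =
         coord V y (sum_list bs) x u' k"
        unfolding ij(3) app[OF ij(1,2) \<open>y \<in> Ob V\<close> u(1), symmetric] app[OF ij(1,2) \<open>y \<in> Ob V\<close> u(2), symmetric] eq[OF ij(1)] ..
    qed (use u in auto) }
qed auto

lemma has_vproducts_A [simp]: "has_vproducts V (A_vcat V)"
  using ucone_A has_vproducts_iff[OF is_vcat_A] by blast

subsection \<open>Exponentials of finite copowers\<close>

text \<open>Iterated binary products give an object that is at once a power of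
  \<open>num V n\<close> and a copower of the terminal object. The equation records that projection
  \<open>i\<close> reads off digit \<open>i\<close> of the index; the object is identified with the
  exponential only in \<open>copower_num_name\<close>.\<close>

lemma power_copower:
  "\<exists>E pr pt. is_product V (replicate m (num V n)) E pr \<and> copower (n ^ m) E pt \<and>
    (\<forall>k<n ^ m. \<forall>i<m. Cmp V (one V) E (num V n) (pr i) (pt k) = inj V n (k div n ^ i mod n))"
proof (induction m)
  case 0
  \<comment> \<open>For \<open>m = 0\<close> there is exactly one function: the terminal object is
    the empty product and the copower on one point.\<close>
  have "copower (Suc 0) (one V) (\<lambda>_. Idt V (one V))"
    by (rule copowerI) auto
  moreover have "is_product V [] (one V) (prj V [])" by (rule is_product_prd) simp
  ultimately show ?case by auto
next
  case (Suc m)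
  then obtain E pr pt where E: "is_product V (replicate m (num V n)) E pr" and pt: "copower (n ^ m) E pt"
    and eq: "\<And>k i. k < n ^ m \<Longrightarrow> i < m \<Longrightarrow> Cmp V (one V) E (num V n) (pr i) (pt k) = inj V n (k div n ^ i mod n)" by auto
  let ?N = "num V n"
  let ?E = "prd V [?N, E]"
  have EOb [simp]: "E \<in> Ob V" by (rule is_product_Ob[OF E])
  have pr [simp]: "i < m \<Longrightarrow> pr i \<in> Hom V E ?N" for i using is_product_in[OF E, of i] by simp
  have ptin [simp]: "i < n ^ m \<Longrightarrow> pt i \<in> Hom V (one V) E" for i by (rule copower_in[OF pt])
  let ?pr = "\<lambda>i. case i of 0 \<Rightarrow> prj V [?N, E] 0 | Suc i \<Rightarrow> Cmp V ?E E ?N (pr i) (prj V [?N, E] (Suc 0))"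
  \<comment> \<open>The new factor stands first and takes the lowest digit \<open>k mod n\<close>;
    the remaining digits are those of \<open>k div n\<close>.\<close>
  let ?pt = "\<lambda>k. tuple V (one V) [?N, E] [inj V n (k mod n), pt (k div n)]"
  have "is_product V (replicate (Suc m) ?N) ?E ?pr"
    unfolding is_product_def
  proof (intro conjI allI impI ballI)
    fix i assume "i < length (replicate (Suc m) ?N)"
    then show "?pr i \<in> Hom V ?E (replicate (Suc m) ?N ! i)"
      by (cases i) auto
  next
    fix y f assume [simp]: "y \<in> Ob V" and f: "\<forall>i<length (replicate (Suc m) ?N). f i \<in> Hom V y (replicate (Suc m) ?N ! i)"
    have f0 [simp]: "f 0 \<in> Hom V y ?N" using f by (auto dest: spec[of _ 0])
    have fi [simp]: "i < m \<Longrightarrow> f (Suc i) \<in> Hom V y ?N" for i using f by (auto dest: spec[of _ "Suc i"])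
    obtain u where u [simp]: "u \<in> Hom V y E" "\<And>i. i < m \<Longrightarrow> Cmp V y E ?N (pr i) u = f (Suc i)"
      using is_product_ex[OF E, of y "\<lambda>i. f (Suc i)"] by auto
    show "\<exists>!w. w \<in> Hom V y ?E \<and> (\<forall>i<length (replicate (Suc m) ?N). Cmp V y ?E (replicate (Suc m) ?N ! i) (?pr i) w = f i)"
    proof (rule ex1I[of _ "tuple V y [?N, E] [f 0, u]"])
      show "tuple V y [?N, E] [f 0, u] \<in> Hom V y ?E \<and>
        (\<forall>i<length (replicate (Suc m) ?N). Cmp V y ?E (replicate (Suc m) ?N ! i) (?pr i) (tuple V y [?N, E] [f 0, u]) = f i)"
        by (auto simp: nth_append less_Suc_eq_0_disj)
      fix w assume "w \<in> Hom V y ?E \<and> (\<forall>i<length (replicate (Suc m) ?N). Cmp V y ?E (replicate (Suc m) ?N ! i) (?pr i) w = f i)"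
      then have w [simp]: "w \<in> Hom V y ?E"
        and wi: "\<And>i. i < Suc m \<Longrightarrow> Cmp V y ?E (replicate (Suc m) ?N ! i) (?pr i) w = f i" by auto
      have w0: "Cmp V y ?E ?N (prj V [?N, E] 0) w = f 0" using wi[of 0] by simp
      have wS: "Cmp V y E ?N (pr i) (Cmp V y ?E E (prj V [?N, E] (Suc 0)) w) = f (Suc i)" if "i < m" for i
        using wi[of "Suc i"] that by simp
      have "Cmp V y ?E E (prj V [?N, E] (Suc 0)) w = u"
        by (rule is_product_ext[OF E, of _ y]) (use wS in auto)
      then show "w = tuple V y [?N, E] [f 0, u]"
        using w0 by (intro prd2_ext[of ?N E w y]) auto
    qed
  qed auto
  moreover have "copower (n ^ Suc m) ?E ?pt"
    using copower_prd[OF copower_num pt] by simp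
  moreover have "Cmp V (one V) ?E ?N (?pr i) (?pt k) = inj V n (k div n ^ i mod n)" if k: "k < n ^ Suc m" and i: "i < Suc m" for k i
  proof -
    have 1: "k mod n < n" "k div n < n ^ m"
      using k by (cases "n = 0"; auto simp: less_mult_imp_div_less mult.commute)+
    then show ?thesis using i eq[OF 1(2)] by (cases i) (auto simp: div_mult2_eq)
  qed
  ultimately show ?case by blast
qed

text \<open>The exponential and the object of \<open>power_copower\<close> are both products of
  \<open>m\<close> copies of \<open>num V n\<close>. The isomorphism between them carries
  \<open>pt k\<close> to the \<open>k\<close>-th name, since coordinate \<open>i\<close> of either
  is the injection at digit \<open>i\<close> of \<open>k\<close>.\<close>

lemma copower_num_name: "copower (n ^ m) (npow V n m) (\<lambda>k. num_name V m n (\<lambda>i. k div n ^ i mod n))"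
proof -
  obtain E pr pt where E: "is_product V (replicate m (num V n)) E pr" and pt: "copower (n ^ m) E pt"
    and eq: "\<And>k i. k < n ^ m \<Longrightarrow> i < m \<Longrightarrow> Cmp V (one V) E (num V n) (pr i) (pt k) = inj V n (k div n ^ i mod n)"
    using power_copower by blast
  let ?X = "npow V n m"
  let ?ev = "\<lambda>i. app V ?X (num V m) (num V n) (Idt V ?X) (const_elt V ?X (num V m) (inj V m i))"
  have X: "is_product V (replicate m (num V n)) ?X ?ev"
    by (rule copower_expo_product[OF copower_num]) simp
  obtain e e' where e: "inverse_in V E ?X e e'" "\<And>i. i < m \<Longrightarrow> Cmp V E ?X (num V n) (?ev i) e = pr i"
    using is_product_iso[OF E X] by (metis length_replicate nth_replicate)
  have ein [simp]: "e \<in> Hom V E ?X" using e(1) by (simp add: inverse_in_def)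
  have ptin [simp]: "i < n ^ m \<Longrightarrow> pt i \<in> Hom V (one V) E" for i by (rule copower_in[OF pt])
  have ev_in: "i < m \<Longrightarrow> ?ev i \<in> Hom V ?X (num V n)" for i by simp
  show ?thesis
  proof (rule copower_iso[OF pt e(1)])
    fix k assume k [simp]: "k < n ^ m"
    note [simp] = nat_digit_less[OF k]
    show "num_name V m n (\<lambda>i. k div n ^ i mod n) = Cmp V (one V) E ?X e (pt k)"
    proof (rule is_product_ext[OF X, of _ "one V"])
      fix i assume i: "i < length (replicate m (num V n))"
      then have "Cmp V (one V) ?X (num V n) (?ev i) (Cmp V (one V) E ?X e (pt k)) = Cmp V (one V) E (num V n) (pr i) (pt k)"
        using ev_in by (intro reassoc[OF e(2)]) auto
      then show "Cmp V (one V) ?X (replicate m (num V n) ! i) (?ev i) (num_name V m n (\<lambda>i. k div n ^ i mod n)) =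
          Cmp V (one V) ?X (replicate m (num V n) ! i) (?ev i) (Cmp V (one V) E ?X e (pt k))"
        using i eq[OF k] by simp
    qed auto
  qed
qed

text \<open>The inverse sends the points back, and both composites fix all points.\<close>

lemma copower_inverse:
  assumes A: "copower k A p" and B: "copower k B q" and h [simp]: "h \<in> Hom V A B"
    and eq: "\<And>i. i < k \<Longrightarrow> Cmp V (one V) A B h (p i) = q i"
  obtains h' where "inverse_in V A B h h'"
proof -
  note [simp] = copower_Ob[OF A] copower_Ob[OF B] copower_in[OF A] copower_in[OF B]
  obtain h' where h' [simp]: "h' \<in> Hom V B A" "\<And>i. i < k \<Longrightarrow> Cmp V (one V) B A h' (q i) = p i"
    using copower_ex1[OF B, of p A] by auto
  have "Cmp V A B A h' h = Idt V A"
    by (rule copower_ext[OF A, of _ A]) (auto simp: eq)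
  moreover have "Cmp V B A B h h' = Idt V B"
    by (rule copower_ext[OF B, of _ B]) (auto simp: eq)
  ultimately show ?thesis by (intro that[of h']) (simp add: inverse_in_def)
qed

lemma num_expo_in [simp]: "num_expo V m n \<in> Hom V (num V (n ^ m)) (npow V n m)"
  and num_expo_inj: "k < n ^ m \<Longrightarrow> Cmp V (one V) (num V (n ^ m)) (npow V n m) (num_expo V m n) (inj V (n ^ m) k) =
    num_name V m n (\<lambda>i. k div n ^ i mod n)"
proof -
  have 1: "num_expo V m n = cotuple V (n ^ m) (npow V n m) (\<lambda>k. num_name V m n (\<lambda>i. k div n ^ i mod n))"
    by (simp add: num_expo_def num_name_def num_map_def Let_def)
  have 2: "k < n ^ m \<Longrightarrow> num_name V m n (\<lambda>i. k div n ^ i mod n) \<in> Hom V (one V) (npow V n m)" for k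
    by (rule num_name_in) (rule nat_digit_less)
  show "num_expo V m n \<in> Hom V (num V (n ^ m)) (npow V n m)"
    unfolding 1 by (rule cotuple_in) (use 2 in auto)
  show "k < n ^ m \<Longrightarrow> Cmp V (one V) (num V (n ^ m)) (npow V n m) (num_expo V m n) (inj V (n ^ m) k) =
    num_name V m n (\<lambda>i. k div n ^ i mod n)"
    unfolding 1 by (rule cotuple_inj) (use 2 in auto)
qed

abbreviation num_expo_inv :: "nat \<Rightarrow> nat \<Rightarrow> 'm" where
  "num_expo_inv m n \<equiv> inv_in V (num V (n ^ m)) (npow V n m) (num_expo V m n)"

lemma num_expo_inverse:
  "inverse_in V (num V (n ^ m)) (npow V n m) (num_expo V m n) (num_expo_inv m n)"
proof -
  obtain h where "inverse_in V (num V (n ^ m)) (npow V n m) (num_expo V m n) h"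
    by (rule copower_inverse[OF copower_num copower_num_name num_expo_in num_expo_inj])
  then show ?thesis using inv_in_eq by metis
qed

lemma num_expo_inv_in [simp]: "num_expo_inv m n \<in> Hom V (npow V n m) (num V (n ^ m))"
  and num_expo_inv_cancel [simp]:
    "Cmp V (num V (n ^ m)) (npow V n m) (num V (n ^ m)) (num_expo_inv m n) (num_expo V m n) = Idt V (num V (n ^ m))"
    "Cmp V (npow V n m) (num V (n ^ m)) (npow V n m) (num_expo V m n) (num_expo_inv m n) =
      Idt V (npow V n m)"
  using num_expo_inverse by (auto simp: inverse_in_def)

text \<open>Digit functions exhaust all functions from \<open>m\<close> to \<open>n\<close>, so the
  inverse of \<open>num_expo\<close> is known on every name, not only on those written with
  \<open>div\<close> and \<open>mod\<close>.\<close>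

lemma num_expo_inv_num_name:
  assumes "\<And>i. i < m \<Longrightarrow> \<phi> i < n"
  obtains k where "k < n ^ m" "\<And>i. i < m \<Longrightarrow> k div n ^ i mod n = \<phi> i"
    "Cmp V (one V) (npow V n m) (num V (n ^ m)) (num_expo_inv m n) (num_name V m n \<phi>) = inj V (n ^ m) k"
proof -
  obtain k where k: "k < n ^ m" "\<And>i. i < m \<Longrightarrow> k div n ^ i mod n = \<phi> i"
    by (rule nat_digits_ex[of m \<phi> n], erule assms, rule that)
  have eq: "num_name V m n \<phi> = num_name V m n (\<lambda>i. k div n ^ i mod n)"
    by (rule num_name_cong) (use assms k in auto)
  have "Cmp V (one V) (npow V n m) (num V (n ^ m)) (num_expo_inv m n)
    (Cmp V (one V) (num V (n ^ m)) (npow V n m) (num_expo V m n) (inj V (n ^ m) k)) = inj V (n ^ m) k"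
    using k by (simp add: reassoc[OF num_expo_inv_cancel(1)])
  then show ?thesis using that k eq num_expo_inj by metis
qed

text \<open>By \<open>copower_prd\<close> the product of two such exponentials is again a copower of
  the terminal object, with the pairs of names as its points. It reduces the compatibility of
  \<open>A_cmp\<close> with composition to names.\<close>

lemma A_points_ext2:
  assumes h: "h \<in> Hom V (prd V [npow V n m, npow V n' m']) X"
    "h' \<in> Hom V (prd V [npow V n m, npow V n' m']) X"
    and eq: "\<And>\<phi> \<psi>. (\<And>i. i < m \<Longrightarrow> \<phi> i < n) \<Longrightarrow> (\<And>i. i < m' \<Longrightarrow> \<psi> i < n') \<Longrightarrow>
      Cmp V (one V) (prd V [npow V n m, npow V n' m']) X h
        (tuple V (one V) [npow V n m, npow V n' m'] [num_name V m n \<phi>, num_name V m' n' \<psi>]) =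
      Cmp V (one V) (prd V [npow V n m, npow V n' m']) X h'
        (tuple V (one V) [npow V n m, npow V n' m'] [num_name V m n \<phi>, num_name V m' n' \<psi>])"
  shows "h = h'"
proof (rule copower_ext[OF copower_prd[OF copower_num_name copower_num_name] h])
  fix k assume k: "k < n ^ m * n' ^ m'"
  have "k mod n ^ m < n ^ m" "k div n ^ m < n' ^ m'"
    using k by (cases "n ^ m = 0"; auto simp: less_mult_imp_div_less mult.commute)+
  then show "Cmp V (one V) (prd V [npow V n m, npow V n' m']) X h
        (tuple V (one V) [npow V n m, npow V n' m']
          [num_name V m n (\<lambda>i. k mod n ^ m div n ^ i mod n), num_name V m' n' (\<lambda>i. k div n ^ m div n' ^ i mod n')]) =
      Cmp V (one V) (prd V [npow V n m, npow V n' m']) X h'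
        (tuple V (one V) [npow V n m, npow V n' m']
          [num_name V m n (\<lambda>i. k mod n ^ m div n ^ i mod n), num_name V m' n' (\<lambda>i. k div n ^ m div n' ^ i mod n')])"
    by (intro eq nat_digit_less)
qed

end

section \<open>Theories and models\<close>

context base
begin

lemma VMod_cat_sel:
  "\<mu> \<in> Ob (VMod_cat V T C) \<longleftrightarrow> is_pvfun V T C \<mu>"
  "\<alpha> \<in> Hom (VMod_cat V T C) \<mu> \<nu> \<longleftrightarrow> is_pvfun V T C \<mu> \<and> is_pvfun V T C \<nu> \<and> is_vnat V T C \<mu> \<nu> \<alpha>"
  "is_pvfun V T C \<mu> \<Longrightarrow> Idt (VMod_cat V T C) \<mu> = (\<lambda>n. if n \<in> VOb T then VIdt C (vfob \<mu> n) else undefined)"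
  "\<lbrakk>is_pvfun V T C \<mu>; is_pvfun V T C \<nu>; is_pvfun V T C \<xi>; is_vnat V T C \<mu> \<nu> \<alpha>; is_vnat V T C \<nu> \<xi> \<beta>\<rbrakk> \<Longrightarrow>
    Cmp (VMod_cat V T C) \<mu> \<nu> \<xi> \<beta> \<alpha> =
      (\<lambda>n. if n \<in> VOb T then vcomp V C (one V) (vfob \<mu> n) (vfob \<nu> n) (vfob \<xi> n) (\<beta> n) (\<alpha> n) else undefined)"
  by (auto simp: VMod_cat_def Let_def vcomp_def)

lemma category_VMod_cat: "category (VMod_cat V T C)"
  unfolding VMod_cat_def Let_def vcomp_def[symmetric]
proof (rule category_mk_cat, goal_cases)
  case (1 \<mu>)
  then show ?case by (simp add: is_vnat_id is_pvfun_vfun)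
next
  case (2 \<mu> \<nu> \<xi> \<alpha> \<beta>)
  then show ?case by (simp add: is_vnat_comp)
next
  case (3 \<mu> \<nu> \<alpha>)
  then have \<alpha>: "is_vnat V T C \<mu> \<nu> \<alpha>" by simp
  show ?case by (auto simp: vnatD[OF \<alpha>] vnat_undefined[OF \<alpha>])
next
  case (4 \<mu> \<nu> \<alpha>)
  then have \<alpha>: "is_vnat V T C \<mu> \<nu> \<alpha>" by simp
  show ?case by (auto simp: vnatD[OF \<alpha>] vnat_undefined[OF \<alpha>])
next
  case (5 \<mu> \<nu> \<xi> \<rho> \<alpha> \<beta> \<gamma>)
  then have \<alpha>: "is_vnat V T C \<mu> \<nu> \<alpha>" and \<beta>: "is_vnat V T C \<nu> \<xi> \<beta>" and \<gamma>: "is_vnat V T C \<xi> \<rho> \<gamma>" by simp_all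
  show ?case by (auto simp: vnatD[OF \<alpha>] vnatD[OF \<beta>] vnatD[OF \<gamma>])
qed

lemma is_vnat_whisker:
  assumes f: "is_vfun V T' T f" and g: "is_vfun V C C' g" and \<alpha>: "is_vnat V T C \<mu> \<nu> \<alpha>"
  shows "is_vnat V T' C' (comp_vfun V T' C C' g (comp_vfun V T' T C \<mu> f)) (comp_vfun V T' C C' g (comp_vfun V T' T C \<nu> f))
    (whisker V T' C C' f g \<mu> \<nu> \<alpha>)"
proof -
  note [simp] = f g \<alpha> vnatD[OF \<alpha>] vfunD[OF f] vfunD[OF g]
  show ?thesis
  proof (rule is_vnatI, goal_cases)
    case (4 a b)
    note [simp] = 4
    let ?y = "VHom T' a b"
    \<comment> \<open>\<open>g\<close> is applied to the naturality of \<open>\<alpha>\<close> at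
      the element \<open>vfar f a b\<close> of stage \<open>VHom T' a b\<close>.\<close>
    have "vact V C C' g ?y (vfob \<mu> (vfob f a)) (vfob \<nu> (vfob f b)) l = vact V C C' g ?y (vfob \<mu> (vfob f a)) (vfob \<nu> (vfob f b)) r"
      if "l = r" for l r
      using that by simp
    note this[OF vnat_natural[OF \<alpha>, of "vfob f a" "vfob f b" "vfar f a b" ?y]]
    then show ?case by (simp add: whisker_def Let_def)
  qed (auto simp: whisker_def Let_def)
qed

abbreviation VMod_map where
  "VMod_map T C T' C' f g \<equiv> mk_fun (VMod_cat V T C)
    (\<lambda>\<mu>. comp_vfun V T' C C' g (comp_vfun V T' T C \<mu> f)) (\<lambda>\<mu> \<nu> \<alpha>. whisker V T' C C' f g \<mu> \<nu> \<alpha>)"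

lemma is_functor_VMod_map:
  assumes f: "is_pvfun V T' T f" and g: "is_pvfun V C C' g"
  shows "is_functor (VMod_cat V T C) (VMod_cat V T' C') (VMod_map T C T' C' f g)"
proof (rule is_functor_mk_fun, goal_cases)
  note f' = is_pvfun_vfun[OF f] note g' = is_pvfun_vfun[OF g]
  note [simp] = f g f' g' vfunD[OF f'] vfunD[OF g']
  {
    case 1
    show ?case by (rule category_VMod_cat)
  next
    case 2
    show ?case by (rule category_VMod_cat)
  next
    case (3 \<mu>)
    then show ?case by (simp add: VMod_cat_sel)
  next
    case (4 \<mu> \<nu> \<alpha>)
    then show ?case using is_vnat_whisker[OF f' g'] by (simp add: VMod_cat_sel)
  next
    case (5 \<mu>)
    then have \<mu>: "is_pvfun V T C \<mu>" by (simp add: VMod_cat_sel)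
    note [simp] = \<mu> pvfunD[OF \<mu>]
    show ?case by (simp add: VMod_cat_sel whisker_def Let_def fun_eq_iff)
  next
    case (6 \<mu> \<nu> \<xi> \<alpha> \<beta>)
    then have \<alpha>: "is_vnat V T C \<mu> \<nu> \<alpha>" and \<beta>: "is_vnat V T C \<nu> \<xi> \<beta>"
      and pv [simp]: "is_pvfun V T C \<mu>" "is_pvfun V T C \<nu>" "is_pvfun V T C \<xi>"
      by (auto simp: VMod_cat_sel)
    note [simp] = \<alpha> \<beta> vnatD[OF \<alpha>] vnatD[OF \<beta>] is_vnat_whisker[OF f' g' \<alpha>] is_vnat_whisker[OF f' g' \<beta>]
    show ?case
      by (subst VMod_cat_sel(4); simp add: VMod_cat_sel(4)) (simp add: whisker_def Let_def fun_eq_iff)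
  }
qed

section \<open>Theories, enriched categories with products, and the functor of models\<close>

lemma is_theory_iff: "is_theory V (T, \<tau>) \<longleftrightarrow> VOb T = UNIV \<and> vfob \<tau> = (\<lambda>n. n) \<and> is_pvfun V (A_vcat V) T \<tau>"
  by (simp add: is_theory_def)

lemma theory_vcat: "is_theory V (T, \<tau>) \<Longrightarrow> is_vcat V T"
  unfolding is_theory_iff using is_vfun_vcat(2)[OF is_pvfun_vfun] by blast

lemma theory_vproducts: "is_theory V (T, \<tau>) \<Longrightarrow> has_vproducts V T"
  by (rule has_vproducts_image[of "A_vcat V" T \<tau>]) (auto simp: is_theory_iff)

lemma VLaw_sel:
  "t \<in> Ob (VLaw V) \<longleftrightarrow> is_theory V t"
  "f \<in> Hom (VLaw V) (T, \<tau>) (T', \<tau>') \<longleftrightarrow> is_theory V (T, \<tau>) \<and> is_theory V (T', \<tau>') \<and>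
    is_pvfun V T T' f \<and> comp_vfun V (A_vcat V) T T' f \<tau> = \<tau>'"
  "is_theory V (T, \<tau>) \<Longrightarrow> Idt (VLaw V) (T, \<tau>) = id_vfun V T"
  "f \<in> Hom (VLaw V) (T0, \<tau>0) (T1, \<tau>1) \<Longrightarrow> g \<in> Hom (VLaw V) (T1, \<tau>1) (T2, \<tau>2) \<Longrightarrow>
    Cmp (VLaw V) (T0, \<tau>0) (T1, \<tau>1) (T2, \<tau>2) g f = comp_vfun V T0 T1 T2 g f"
  by (auto simp: VLaw_def split: if_splits)

lemma category_VLaw: "category (VLaw V)"
  unfolding VLaw_def
proof (rule category_mk_cat, goal_cases)
  case (1 t)
  obtain T \<tau> where [simp]: "t = (T, \<tau>)" by (cases t)
  have "is_theory V (T, \<tau>)" using 1 by simp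
  then show ?case
    using theory_vcat[of T \<tau>] by (simp add: is_theory_iff comp_vfun_unit is_pvfun_vfun)
next
  case (2 t0 t1 t2 f g)
  obtain T0 \<tau>0 T1 \<tau>1 T2 \<tau>2 where [simp]: "t0 = (T0, \<tau>0)" "t1 = (T1, \<tau>1)" "t2 = (T2, \<tau>2)" by (metis prod.exhaust)
  have f: "is_pvfun V T0 T1 f" "comp_vfun V (A_vcat V) T0 T1 f \<tau>0 = \<tau>1" and g: "is_pvfun V T1 T2 g" "comp_vfun V (A_vcat V) T1 T2 g \<tau>1 = \<tau>2"
    and t: "is_theory V (T0, \<tau>0)"
    using 2 by simp_all
  have "comp_vfun V (A_vcat V) T0 T2 (comp_vfun V T0 T1 T2 g f) \<tau>0 = comp_vfun V (A_vcat V) T1 T2 g (comp_vfun V (A_vcat V) T0 T1 f \<tau>0)"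
    using t f(1) g(1) by (simp add: is_theory_iff comp_vfun_assoc is_pvfun_vfun)
  then show ?case using f g by simp
qed (auto simp: comp_vfun_unit is_pvfun_vfun comp_vfun_assoc)

lemma VCon_sel:
  "C \<in> Ob (VCon V) \<longleftrightarrow> is_vcat V C \<and> has_vproducts V C"
  "f \<in> Hom (VCon V) C D \<longleftrightarrow> has_vproducts V C \<and> has_vproducts V D \<and> is_pvfun V C D f"
  "is_vcat V C \<Longrightarrow> has_vproducts V C \<Longrightarrow> Idt (VCon V) C = id_vfun V C"
  "f \<in> Hom (VCon V) C D \<Longrightarrow> g \<in> Hom (VCon V) D E \<Longrightarrow> Cmp (VCon V) C D E g f = comp_vfun V C D E g f"
  by (auto simp: VCon_def split: if_splits dest: is_vfun_vcat[OF is_pvfun_vfun])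

lemma category_VCon: "category (VCon V)"
  unfolding VCon_def
  by (rule category_mk_cat) (auto simp: comp_vfun_unit is_pvfun_vfun comp_vfun_assoc)

lemma category_VMod_dom: "category (VMod_dom V)"
  unfolding VMod_dom_def by (intro category_prod_cat category_op_cat category_VLaw category_VCon)

lemmas VMod_dom_sel = prod_cat_sel[OF category_op_cat[OF category_VLaw] category_VCon, folded VMod_dom_def]
lemmas op_VLaw_sel = op_cat_sel[OF category_VLaw]

lemma VMod_sel:
  "is_theory V (T, \<tau>) \<Longrightarrow> is_vcat V C \<Longrightarrow> has_vproducts V C \<Longrightarrow> fob (VMod V) ((T, \<tau>), C) = VMod_cat V T C"
  "(f, g) \<in> Hom (VMod_dom V) ((T, \<tau>), C) ((T', \<tau>'), C') \<Longrightarrow>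
    far (VMod V) ((T, \<tau>), C) ((T', \<tau>'), C') (f, g) = VMod_map T C T' C' f g"
  by (simp_all add: VMod_def VMod_dom_sel op_VLaw_sel VLaw_sel VCon_sel)

lemma VMod_map_id:
  assumes [simp]: "is_vcat V T" "is_vcat V C"
  shows "VMod_map T C T C (id_vfun V T) (id_vfun V C) = id_fun (VMod_cat V T C)"
  unfolding id_fun_def
proof (rule mk_fun_cong; (unfold VMod_cat_sel)?)
  fix \<mu> assume "is_pvfun V T C \<mu>"
  then show "comp_vfun V T C C (id_vfun V C) (comp_vfun V T T C \<mu> (id_vfun V T)) = \<mu>"
    by (simp add: comp_vfun_unit is_pvfun_vfun)
next
  fix \<mu> \<nu> \<alpha> assume "is_pvfun V T C \<mu> \<and> is_pvfun V T C \<nu> \<and> is_vnat V T C \<mu> \<nu> \<alpha>"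
  then have \<alpha>: "is_vnat V T C \<mu> \<nu> \<alpha>" by simp
  note [simp] = vnatD[OF \<alpha>] vnat_undefined[OF \<alpha>]
  show "whisker V T C C (id_vfun V T) (id_vfun V C) \<mu> \<nu> \<alpha> = \<alpha>"
    by (auto simp: whisker_def Let_def)
qed

text \<open>A functor to \<open>Cat\<close> requires equal composites, and
  \<open>comp_vfun_assoc\<close> supplies them. On transformations both sides apply first
  \<open>g\<close> and then \<open>g'\<close> to the component at the image of the object under
  \<open>f'\<close> and \<open>f\<close>.\<close>

lemma VMod_map_comp:
  assumes f: "is_pvfun V T1 T0 f" and f': "is_pvfun V T2 T1 f'" and g: "is_pvfun V C0 C1 g" and g': "is_pvfun V C1 C2 g'"
  shows "VMod_map T0 C0 T2 C2 (comp_vfun V T2 T1 T0 f f') (comp_vfun V C0 C1 C2 g' g) =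
    comp_fun (VMod_cat V T0 C0) (VMod_map T1 C1 T2 C2 f' g') (VMod_map T0 C0 T1 C1 f g)"
  unfolding comp_fun_def
proof (rule mk_fun_cong; (unfold VMod_cat_sel)?)
  note [simp] = f f' g g' pvfunD[OF f] pvfunD[OF f'] pvfunD[OF g] pvfunD[OF g']
  { fix \<mu> assume \<mu> [simp]: "is_pvfun V T0 C0 \<mu>"
    note [simp] = is_pvfun_vfun[OF \<mu>]
    have "comp_vfun V T2 C0 C2 (comp_vfun V C0 C1 C2 g' g) (comp_vfun V T2 T0 C0 \<mu> (comp_vfun V T2 T1 T0 f f')) =
      comp_vfun V T2 C1 C2 g' (comp_vfun V T2 T1 C1 (comp_vfun V T1 C0 C1 g (comp_vfun V T1 T0 C0 \<mu> f)) f')"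
      by (simp flip: comp_vfun_assoc)
    then show "comp_vfun V T2 C0 C2 (comp_vfun V C0 C1 C2 g' g) (comp_vfun V T2 T0 C0 \<mu> (comp_vfun V T2 T1 T0 f f')) =
      fob (VMod_map T1 C1 T2 C2 f' g') (fob (VMod_map T0 C0 T1 C1 f g) \<mu>)"
      by (simp add: VMod_cat_sel) }
  { fix \<mu> \<nu> \<alpha> assume "is_pvfun V T0 C0 \<mu> \<and> is_pvfun V T0 C0 \<nu> \<and> is_vnat V T0 C0 \<mu> \<nu> \<alpha>"
    then have \<alpha> [simp]: "is_vnat V T0 C0 \<mu> \<nu> \<alpha>" and [simp]: "is_pvfun V T0 C0 \<mu>" "is_pvfun V T0 C0 \<nu>" by simp_all
    note [simp] = vnatD[OF \<alpha>]
      is_vnat_whisker[OF is_pvfun_vfun[OF f] is_pvfun_vfun[OF g] \<alpha>]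
    have "whisker V T2 C0 C2 (comp_vfun V T2 T1 T0 f f') (comp_vfun V C0 C1 C2 g' g) \<mu> \<nu> \<alpha> =
      whisker V T2 C1 C2 f' g' (comp_vfun V T1 C0 C1 g (comp_vfun V T1 T0 C0 \<mu> f))
        (comp_vfun V T1 C0 C1 g (comp_vfun V T1 T0 C0 \<nu> f)) (whisker V T1 C0 C1 f g \<mu> \<nu> \<alpha>)"
      by (simp add: whisker_def Let_def fun_eq_iff)
    then show "whisker V T2 C0 C2 (comp_vfun V T2 T1 T0 f f') (comp_vfun V C0 C1 C2 g' g) \<mu> \<nu> \<alpha> =
       far (VMod_map T1 C1 T2 C2 f' g') (fob (VMod_map T0 C0 T1 C1 f g) \<mu>)
        (fob (VMod_map T0 C0 T1 C1 f g) \<nu>) (far (VMod_map T0 C0 T1 C1 f g) \<mu> \<nu> \<alpha>)"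
      by (simp add: VMod_cat_sel) }
qed

lemma is_functor_VMod: "is_functor (VMod_dom V) Cat (VMod V)"
  unfolding VMod_def
proof (rule is_functor_mk_fun, goal_cases)
  case 1
  show ?case by (rule category_VMod_dom)
next
  case 2
  show ?case by (rule category_Cat)
next
  case (3 a)
  show ?case by (auto simp: category_VMod_cat split: prod.splits)
next
  case (4 a b h)
  then show ?case
    by (auto simp: VMod_dom_sel op_VLaw_sel VLaw_sel VCon_sel is_functor_VMod_map split: prod.splits)
next
  case (5 a)
  obtain T \<tau> C where a [simp]: "a = ((T, \<tau>), C)" by (metis prod.exhaust)
  have t: "is_theory V (T, \<tau>)" and C: "is_vcat V C" "has_vproducts V C"
    using 5 by (auto simp: VMod_dom_sel op_VLaw_sel VLaw_sel VCon_sel)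
  show ?case
    using t C theory_vcat[OF t]
    by (simp add: VMod_dom_sel op_VLaw_sel VLaw_sel VCon_sel VMod_map_id category_VMod_cat)
next
  case (6 a b c h k)
  obtain T0 \<tau>0 C0 T1 \<tau>1 C1 T2 \<tau>2 C2 f g f' g' where eqs [simp]: "a = ((T0, \<tau>0), C0)" "b = ((T1, \<tau>1), C1)" "c = ((T2, \<tau>2), C2)"
    "h = (f, g)" "k = (f', g')" by (metis prod.exhaust)
  have h: "f \<in> Hom (VLaw V) (T1, \<tau>1) (T0, \<tau>0)" "g \<in> Hom (VCon V) C0 C1"
    and k: "f' \<in> Hom (VLaw V) (T2, \<tau>2) (T1, \<tau>1)" "g' \<in> Hom (VCon V) C1 C2"
    using 6 by (auto simp: VMod_dom_sel op_VLaw_sel)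
  have cmp: "Cmp (VMod_dom V) a b c k h = (comp_vfun V T2 T1 T0 f f', comp_vfun V C0 C1 C2 g' g)"
    using h k by (simp add: VMod_dom_sel op_VLaw_sel VLaw_sel(4) VCon_sel(4))
  have pv: "is_pvfun V T1 T0 f" "is_pvfun V T2 T1 f'" "is_pvfun V C0 C1 g" "is_pvfun V C1 C2 g'"
    using h k by (auto simp: VLaw_sel VCon_sel)
  show ?case
    unfolding cmp by (simp add: VMod_map_comp[OF pv] is_functor_VMod_map pv)
qed

section \<open>The category of models over one base in explicit terms\<close>

lemma category_int_VMod: "category (int_VMod V)"
  unfolding int_VMod_def by (rule category_groth[OF is_functor_VMod])

lemma int_VMod_Ob:
  "(((T, \<tau>), C), \<mu>) \<in> Ob (int_VMod V) \<longleftrightarrow>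
    is_theory V (T, \<tau>) \<and> is_vcat V C \<and> has_vproducts V C \<and> is_pvfun V T C \<mu>"
  unfolding int_VMod_def groth_sel[OF is_functor_VMod]
  by (auto simp: VMod_dom_sel op_VLaw_sel VLaw_sel VCon_sel VMod_sel VMod_cat_sel)

text \<open>The theory component runs from \<open>T'\<close> to \<open>T\<close> because
  \<open>VMod_dom\<close> uses the opposite of \<open>VLaw\<close>.\<close>

lemma int_VMod_Hom:
  "((f, g), \<alpha>) \<in> Hom (int_VMod V) (((T, \<tau>), C), \<mu>) (((T', \<tau>'), C'), \<mu>') \<longleftrightarrow>
    (((T, \<tau>), C), \<mu>) \<in> Ob (int_VMod V) \<and> (((T', \<tau>'), C'), \<mu>') \<in> Ob (int_VMod V) \<and>
    is_pvfun V T' T f \<and> comp_vfun V (A_vcat V) T' T f \<tau>' = \<tau> \<and> is_pvfun V C C' g \<and>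
    is_vnat V T' C' (comp_vfun V T' C C' g (comp_vfun V T' T C \<mu> f)) \<mu>' \<alpha>" (is "?l \<longleftrightarrow> ?r")
proof
  have dom: "(f, g) \<in> Hom (VMod_dom V) ((T, \<tau>), C) ((T', \<tau>'), C') \<longleftrightarrow>
    is_theory V (T', \<tau>') \<and> is_theory V (T, \<tau>) \<and> is_pvfun V T' T f \<and> comp_vfun V (A_vcat V) T' T f \<tau>' = \<tau> \<and>
    has_vproducts V C \<and> has_vproducts V C' \<and> is_pvfun V C C' g"
    by (auto simp: VMod_dom_sel op_VLaw_sel VLaw_sel VCon_sel)
  { assume l: ?l
    then have 1: "(f, g) \<in> Hom (VMod_dom V) ((T, \<tau>), C) ((T', \<tau>'), C')"
      unfolding int_VMod_def groth_sel[OF is_functor_VMod] by simp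
    have "is_vcat V C" "is_vcat V C'" using 1 dom is_vfun_vcat[OF is_pvfun_vfun] by blast+
    have "\<mu> \<in> Ob (VMod_cat V T C)" "\<alpha> \<in> Hom (VMod_cat V T' C') (fob (VMod_map T C T' C' f g) \<mu>) \<mu>'"
      using l \<open>is_vcat V C\<close> \<open>is_vcat V C'\<close> 1[unfolded dom]
      unfolding int_VMod_def groth_sel[OF is_functor_VMod] VMod_sel(2)[OF 1] by (elim conjE; simp add: VMod_sel)+
    then show ?r
      using \<open>is_vcat V C\<close> \<open>is_vcat V C'\<close> 1[unfolded dom] unfolding int_VMod_Ob VMod_cat_sel(2)
      by (simp add: VMod_cat_sel) }
  { assume r: ?r
    then have 1: "(f, g) \<in> Hom (VMod_dom V) ((T, \<tau>), C) ((T', \<tau>'), C')"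
      unfolding dom int_VMod_Ob by simp
    show ?l
      using r 1 unfolding int_VMod_Ob unfolding int_VMod_def groth_sel[OF is_functor_VMod]
      by (simp add: VMod_sel VMod_cat_sel) }
qed

lemma int_VMod_Idt:
  assumes "(((T, \<tau>), C), \<mu>) \<in> Ob (int_VMod V)"
  shows "Idt (int_VMod V) (((T, \<tau>), C), \<mu>) =
    ((id_vfun V T, id_vfun V C), \<lambda>n. VIdt C (vfob \<mu> n))"
proof -
  have *: "is_theory V (T, \<tau>)" "is_vcat V C" "has_vproducts V C" "is_pvfun V T C \<mu>" "VOb T = UNIV"
    using assms by (auto simp: int_VMod_Ob is_theory_iff)
  show ?thesis
    unfolding int_VMod_def
    by (subst groth_sel(3)[OF is_functor_VMod])
      (simp_all add: * VMod_dom_sel op_VLaw_sel VLaw_sel VCon_sel VMod_sel VMod_cat_sel)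
qed

text \<open>The second component is \<open>\<alpha>'\<close> after \<open>\<alpha>\<close> whiskered
  by \<open>f'\<close> and \<open>g'\<close>. It has no \<open>undefined\<close> case, as every
  natural number is an object of a theory.\<close>

lemma int_VMod_Cmp:
  assumes m: "((f, g), \<alpha>) \<in> Hom (int_VMod V) (((T0, \<tau>0), C0), \<mu>0) (((T1, \<tau>1), C1), \<mu>1)"
    and m': "((f', g'), \<alpha>') \<in> Hom (int_VMod V) (((T1, \<tau>1), C1), \<mu>1) (((T2, \<tau>2), C2), \<mu>2)"
  shows "Cmp (int_VMod V) (((T0, \<tau>0), C0), \<mu>0) (((T1, \<tau>1), C1), \<mu>1) (((T2, \<tau>2), C2), \<mu>2) ((f', g'), \<alpha>') ((f, g), \<alpha>) =
    ((comp_vfun V T2 T1 T0 f f', comp_vfun V C0 C1 C2 g' g),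
     \<lambda>n. vcomp V C2 (one V) (vfob g' (vfob g (vfob \<mu>0 (vfob f (vfob f' n))))) (vfob g' (vfob \<mu>1 (vfob f' n))) (vfob \<mu>2 n) (\<alpha>' n)
       (vact V C1 C2 g' (one V) (vfob g (vfob \<mu>0 (vfob f (vfob f' n)))) (vfob \<mu>1 (vfob f' n)) (\<alpha> (vfob f' n))))"
proof -
  have th: "is_theory V (T0, \<tau>0)" "is_theory V (T1, \<tau>1)" "is_theory V (T2, \<tau>2)"
    and C: "is_vcat V C0" "is_vcat V C1" "is_vcat V C2" "has_vproducts V C0" "has_vproducts V C1" "has_vproducts V C2"
    and \<mu>: "is_pvfun V T0 C0 \<mu>0" "is_pvfun V T1 C1 \<mu>1" "is_pvfun V T2 C2 \<mu>2"
    and f: "is_pvfun V T1 T0 f" "is_pvfun V T2 T1 f'" "comp_vfun V (A_vcat V) T1 T0 f \<tau>1 = \<tau>0" "comp_vfun V (A_vcat V) T2 T1 f' \<tau>2 = \<tau>1"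
    and g: "is_pvfun V C0 C1 g" "is_pvfun V C1 C2 g'"
    and \<alpha>: "is_vnat V T1 C1 (comp_vfun V T1 C0 C1 g (comp_vfun V T1 T0 C0 \<mu>0 f)) \<mu>1 \<alpha>"
      "is_vnat V T2 C2 (comp_vfun V T2 C1 C2 g' (comp_vfun V T2 T1 C1 \<mu>1 f')) \<mu>2 \<alpha>'"
    using m m' unfolding int_VMod_Hom int_VMod_Ob by auto
  have U: "VOb T0 = UNIV" "VOb T1 = UNIV" "VOb T2 = UNIV" using th by (auto simp: is_theory_iff)
  have dom: "(f, g) \<in> Hom (VMod_dom V) ((T0, \<tau>0), C0) ((T1, \<tau>1), C1)"
    "(f', g') \<in> Hom (VMod_dom V) ((T1, \<tau>1), C1) ((T2, \<tau>2), C2)"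
    by (simp_all add: VMod_dom_sel op_VLaw_sel VLaw_sel VCon_sel th C f g)
  have law: "f \<in> Hom (VLaw V) (T1, \<tau>1) (T0, \<tau>0)" "f' \<in> Hom (VLaw V) (T2, \<tau>2) (T1, \<tau>1)"
    and con: "g \<in> Hom (VCon V) C0 C1" "g' \<in> Hom (VCon V) C1 C2"
    using dom by (auto simp: VMod_dom_sel op_VLaw_sel)
  let ?\<mu>0 = "comp_vfun V T1 C0 C1 g (comp_vfun V T1 T0 C0 \<mu>0 f)"
  have \<mu>0: "is_pvfun V T1 C1 ?\<mu>0" using \<mu> f g by simp
  have vw: "is_vnat V T2 C2 (comp_vfun V T2 C1 C2 g' (comp_vfun V T2 T1 C1 ?\<mu>0 f')) (comp_vfun V T2 C1 C2 g' (comp_vfun V T2 T1 C1 \<mu>1 f'))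
     (whisker V T2 C1 C2 f' g' ?\<mu>0 \<mu>1 \<alpha>)"
    by (rule is_vnat_whisker[OF is_pvfun_vfun[OF f(2)] is_pvfun_vfun[OF g(2)] \<alpha>(1)])
  have 1: "Cmp (int_VMod V) (((T0, \<tau>0), C0), \<mu>0) (((T1, \<tau>1), C1), \<mu>1) (((T2, \<tau>2), C2), \<mu>2) ((f', g'), \<alpha>') ((f, g), \<alpha>) =
    (Cmp (VMod_dom V) ((T0, \<tau>0), C0) ((T1, \<tau>1), C1) ((T2, \<tau>2), C2) (f', g') (f, g),
     Cmp (VMod_cat V T2 C2) (comp_vfun V T2 C1 C2 g' (comp_vfun V T2 T1 C1 ?\<mu>0 f')) (comp_vfun V T2 C1 C2 g' (comp_vfun V T2 T1 C1 \<mu>1 f')) \<mu>2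
       \<alpha>' (whisker V T2 C1 C2 f' g' ?\<mu>0 \<mu>1 \<alpha>))"
    using m m' unfolding int_VMod_def
    by (subst groth_sel(4)[OF is_functor_VMod]) (simp_all add: VMod_sel dom th C \<mu> \<mu>0 VMod_cat_sel(1,2) \<alpha>)
  show ?thesis
    unfolding 1 using f g \<mu> \<mu>0 \<alpha> vw
    by (simp add: VMod_dom_sel law con op_VLaw_sel VLaw_sel(4) VCon_sel(4) VMod_cat_sel U whisker_def Let_def fun_eq_iff)
qed

end

section \<open>Change of base\<close>

lemma bc_vcat_sel [simp]:
  "VOb (bc_vcat V W F C) = VOb C"
  "a \<in> VOb C \<Longrightarrow> b \<in> VOb C \<Longrightarrow> VHom (bc_vcat V W F C) a b = fob F (VHom C a b)"
  "a \<in> VOb C \<Longrightarrow> VIdt (bc_vcat V W F C) a = bc_point V W F (VHom C a a) (VIdt C a)"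
  by (simp_all add: bc_vcat_def)

lemma bc_vfun_sel [simp]:
  "a \<in> VOb C \<Longrightarrow> vfob (bc_vfun F C D f) a = vfob f a"
  "a \<in> VOb C \<Longrightarrow> b \<in> VOb C \<Longrightarrow> vfar (bc_vfun F C D f) a b =
    far F (VHom C a b) (VHom D (vfob f a) (vfob f b)) (vfar f a b)"
  by (simp_all add: bc_vfun_def)

lemma bc_vnat_sel [simp]:
  "a \<in> VOb C \<Longrightarrow> bc_vnat V W F C D f g \<alpha> a = bc_point V W F (VHom D (vfob f a) (vfob g a)) (\<alpha> a)"
  by (simp add: bc_vnat_def)

locale base_change = V: base V + W: base W for V W :: "('o, 'm) ebase" +
  fixes F :: "('o, 'm, 'o, 'm) fnctr"
  assumes base_functor: "is_base_functor V W F"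
begin

lemma F: "is_functor V W F"
  using base_functor by (simp add: is_base_functor_def)

lemmas F_Ob [simp] = is_functor_fob[OF F]
  and F_in [simp] = is_functor_far[OF F]
  and F_Idt [simp] = is_functor_Idt[OF F]
  and F_Cmp [simp] = is_functor_Cmp[OF F]

lemma F_product:
  "is_product V xs p pr \<Longrightarrow> is_product W (map (fob F) xs) (fob F p) (\<lambda>i. far F p (xs ! i) (pr i))"
  using base_functor by (simp add: is_base_functor_def preserves_products_def)

text \<open>The image of a chosen product is a product of the images, in general not the chosen one
  of \<open>W\<close>; \<open>prod_cmp\<close> mediates between the two.\<close>

lemma F_prd:
  "set xs \<subseteq> Ob V \<Longrightarrow>
    is_product W (map (fob F) xs) (fob F (prd V xs)) (\<lambda>i. far F (prd V xs) (xs ! i) (prj V xs i))"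
  by (intro F_product V.is_product_prd)

lemma prod_cmp_spec:
  assumes xs: "set xs \<subseteq> Ob V"
  shows "prod_cmp V W F xs \<in> Hom W (prd W (map (fob F) xs)) (fob F (prd V xs)) \<and>
    (\<forall>i<length xs. Cmp W (prd W (map (fob F) xs)) (fob F (prd V xs)) (fob F (xs ! i))
       (far F (prd V xs) (xs ! i) (prj V xs i)) (prod_cmp V W F xs) = prj W (map (fob F) xs) i)"
proof -
  have Fxs: "set (map (fob F) xs) \<subseteq> Ob W" using xs by auto
  have "\<exists>!u. u \<in> Hom W (prd W (map (fob F) xs)) (fob F (prd V xs)) \<and>
    (\<forall>i<length (map (fob F) xs). Cmp W (prd W (map (fob F) xs)) (fob F (prd V xs)) (map (fob F) xs ! i)
       (far F (prd V xs) (xs ! i) (prj V xs i)) u = prj W (map (fob F) xs) i)"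
    using W.prj_in[OF Fxs] W.prd_Ob[OF Fxs] by (intro W.is_product_ex1[OF F_prd[OF xs]]) auto
  then have "\<exists>!u. u \<in> Hom W (prd W (map (fob F) xs)) (fob F (prd V xs)) \<and>
    (\<forall>i<length xs. Cmp W (prd W (map (fob F) xs)) (fob F (prd V xs)) (fob F (xs ! i))
       (far F (prd V xs) (xs ! i) (prj V xs i)) u = prj W (map (fob F) xs) i)"
    by (simp cong: conj_cong)
  then show ?thesis unfolding prod_cmp_def by (rule theI')
qed

lemma prod_cmp_in: "set xs \<subseteq> Ob V \<Longrightarrow> prod_cmp V W F xs \<in> Hom W (prd W (map (fob F) xs)) (fob F (prd V xs))"
  using prod_cmp_spec by simp

lemma prj_prod_cmp: "set xs \<subseteq> Ob V \<Longrightarrow> i < length xs \<Longrightarrow>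
  Cmp W (prd W (map (fob F) xs)) (fob F (prd V xs)) (fob F (xs ! i))
       (far F (prd V xs) (xs ! i) (prj V xs i)) (prod_cmp V W F xs) = prj W (map (fob F) xs) i"
  using prod_cmp_spec by simp

lemma F_prd_ext:
  assumes xs: "set xs \<subseteq> Ob V" and u: "u \<in> Hom W y (fob F (prd V xs))" "u' \<in> Hom W y (fob F (prd V xs))"
    and "\<And>i. i < length xs \<Longrightarrow> Cmp W y (fob F (prd V xs)) (fob F (xs ! i)) (far F (prd V xs) (xs ! i) (prj V xs i)) u =
      Cmp W y (fob F (prd V xs)) (fob F (xs ! i)) (far F (prd V xs) (xs ! i) (prj V xs i)) u'"
  shows "u = u'"
  by (rule W.is_product_ext[OF F_prd[OF xs] u]) (use assms in auto)

text \<open>Preservation of the empty product makes the image of the terminal object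
  terminal.\<close>

lemma F_one_unique: "u \<in> Hom W y (fob F (one V)) \<Longrightarrow> u' \<in> Hom W y (fob F (one V)) \<Longrightarrow> u = u'"
  by (rule F_prd_ext[of "[]"]) auto

lemma prod_cmp_Nil_in [simp]: "prod_cmp V W F [] \<in> Hom W (one W) (fob F (one V))"
  using prod_cmp_in[of "[]"] by simp

lemma prod_cmp2_in [simp]:
  "a \<in> Ob V \<Longrightarrow> b \<in> Ob V \<Longrightarrow> prod_cmp V W F [a, b] \<in> Hom W (prd W [fob F a, fob F b]) (fob F (prd V [a, b]))"
  using prod_cmp_in[of "[a, b]"] by simp

lemma prj_prod_cmp2 [simp]:
  assumes "a \<in> Ob V" "b \<in> Ob V"
  shows "Cmp W (prd W [fob F a, fob F b]) (fob F (prd V [a, b])) (fob F a) (far F (prd V [a, b]) a (prj V [a, b] 0)) (prod_cmp V W F [a, b]) =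
      prj W [fob F a, fob F b] 0"
    "Cmp W (prd W [fob F a, fob F b]) (fob F (prd V [a, b])) (fob F b) (far F (prd V [a, b]) b (prj V [a, b] (Suc 0))) (prod_cmp V W F [a, b]) =
      prj W [fob F a, fob F b] (Suc 0)"
  using prj_prod_cmp[of "[a, b]" 0] prj_prod_cmp[of "[a, b]" "Suc 0"] assms by simp_all

section \<open>Base change of enriched categories, functors and transformations\<close>

abbreviation F_act :: "'o \<Rightarrow> 'o \<Rightarrow> 'o \<Rightarrow> 'm \<Rightarrow> 'm \<Rightarrow> 'm" where
  "F_act y x z g t \<equiv> Cmp W y (fob F x) (fob F z) (far F x z g) t"

abbreviation bc :: "('c, 'o, 'm) vcat \<Rightarrow> ('c, 'o, 'm) vcat" where
  "bc \<equiv> bc_vcat V W F"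

abbreviation bc_pt :: "'o \<Rightarrow> 'm \<Rightarrow> 'm" where
  "bc_pt \<equiv> bc_point V W F"

text \<open>The comparison absorbs the difference between pairing in \<open>W\<close> and the image
  of pairing in \<open>V\<close>: both sides have the same components under the images of the
  projections.\<close>

lemma F_tuple2:
  assumes [simp]: "f \<in> Hom V x a" "g \<in> Hom V x b" "t \<in> Hom W y (fob F x)"
  shows "Cmp W y (prd W [fob F a, fob F b]) (fob F (prd V [a, b])) (prod_cmp V W F [a, b])
      (tuple W y [fob F a, fob F b] [F_act y x a f t, F_act y x b g t]) =
    F_act y x (prd V [a, b]) (tuple V x [a, b] [f, g]) t"
    (is "?l = ?r")
proof (rule F_prd_ext[of "[a, b]"])
  have [simp]: "a \<in> Ob V" "b \<in> Ob V" "x \<in> Ob V" using V.Hom_Ob assms by blast+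
  show "set [a, b] \<subseteq> Ob V" "?l \<in> Hom W y (fob F (prd V [a, b]))" "?r \<in> Hom W y (fob F (prd V [a, b]))" by simp_all
  fix i assume "i < length [a, b]"
  then consider "i = 0" | "i = Suc 0" by force
  then show "F_act y (prd V [a, b]) ([a, b] ! i) (prj V [a, b] i) ?l =
      F_act y (prd V [a, b]) ([a, b] ! i) (prj V [a, b] i) ?r"
    by cases (simp_all add: W.reassoc[OF prj_prod_cmp2(1)] W.reassoc[OF prj_prod_cmp2(2)] W.reassoc[OF F_Cmp[symmetric]] del: F_Cmp)
qed

lemma F_factor:
  assumes "\<And>i. i < length xs \<Longrightarrow> s i \<in> Hom W y (fob F (xs ! i))" "y \<in> Ob W" "set xs \<subseteq> Ob V"
  obtains t where "t \<in> Hom W y (fob F (prd V xs))"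
    "\<And>i. i < length xs \<Longrightarrow> s i = F_act y (prd V xs) (xs ! i) (prj V xs i) t"
proof -
  obtain t where "t \<in> Hom W y (fob F (prd V xs))"
    "\<And>i. i < length (map (fob F) xs) \<Longrightarrow>
      Cmp W y (fob F (prd V xs)) (map (fob F) xs ! i) (far F (prd V xs) (xs ! i) (prj V xs i)) t = s i"
    by (rule W.is_product_ex[OF F_prd[OF assms(3)] assms(2), of s]) (use assms(1) in auto)
  then show ?thesis by (intro that[of t]) auto
qed

lemma bc_point_in [simp]: "p \<in> Hom V (one V) x \<Longrightarrow> bc_pt x p \<in> Hom W (one W) (fob F x)"
  unfolding bc_point_def by simp

lemma bc_point_Cmp [simp]:
  assumes "p \<in> Hom V (one V) x" "h \<in> Hom V x x'"
  shows "bc_pt x' (Cmp V (one V) x x' h p) = F_act (one W) x x' h (bc_pt x p)"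
  using assms unfolding bc_point_def by simp

text \<open>As the image of the terminal object is terminal, the right side does not depend on
  \<open>t\<close>. Whatever \<open>t\<close> the other arguments need, the constant element can
  thus be brought to the form that \<open>bc_vcomp\<close> expects.\<close>

lemma bc_const_elt:
  assumes p [simp]: "p \<in> Hom V (one V) x" and t [simp]: "t \<in> Hom W y (fob F z)" and z [simp]: "z \<in> Ob V"
  shows "const_elt W y (fob F x) (bc_pt x p) =
    F_act y z x (const_elt V z x p) t"
proof -
  have [simp]: "y \<in> Ob W" using W.Hom_Ob t by blast
  have "const_elt W y (fob F (one V)) (prod_cmp V W F []) =
    F_act y z (one V) (bang V z) t"
    by (rule F_one_unique[of _ y]) auto
  then show ?thesis by (simp add: bc_point_def)
qed

text \<open>Composition in the base change can be computed in \<open>V\<close> as soon as both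
  arguments are images taken at one element \<open>t\<close>; \<open>F_factor\<close> provides such
  a \<open>t\<close>.\<close>

lemma bc_vcomp:
  assumes [simp]: "is_vcat V C" "a \<in> VOb C" "b \<in> VOb C" "c \<in> VOb C"
    "g \<in> Hom V x (VHom C b c)" "f \<in> Hom V x (VHom C a b)" "t \<in> Hom W y (fob F x)"
  shows "vcomp W (bc C) y a b c
      (F_act y x (VHom C b c) g t)
      (F_act y x (VHom C a b) f t) =
    F_act y x (VHom C a c) (vcomp V C x a b c g f) t"
proof -
  have [simp]: "x \<in> Ob V" using V.Hom_Ob(1)[OF assms(5)] .
  show ?thesis
    by (simp add: vcomp_def bc_vcat_def Let_def F_tuple2)
qed

lemma bc_vcomp0:
  assumes [simp]: "is_vcat V C" "a \<in> VOb C" "b \<in> VOb C" "c \<in> VOb C"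
    "g \<in> Hom V x (VHom C b c)" "f \<in> Hom V x (VHom C a b)"
  shows "vcomp W (bc C) (fob F x) a b c (far F x (VHom C b c) g) (far F x (VHom C a b) f) =
    far F x (VHom C a c) (vcomp V C x a b c g f)"
proof -
  have [simp]: "x \<in> Ob V" using V.Hom_Ob(1)[OF assms(5)] .
  show ?thesis
    using bc_vcomp[OF assms W.Idt_in[of "fob F x"]] by simp
qed

lemma bc_vcomp_point:
  assumes [simp]: "is_vcat V C" "a \<in> VOb C" "b \<in> VOb C" "c \<in> VOb C"
    "g \<in> Hom V (one V) (VHom C b c)" "f \<in> Hom V (one V) (VHom C a b)"
  shows "vcomp W (bc C) (one W) a b c (bc_pt (VHom C b c) g) (bc_pt (VHom C a b) f) =
    bc_pt (VHom C a c) (vcomp V C (one V) a b c g f)"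
  unfolding bc_point_def by (rule bc_vcomp) auto

lemma is_vcat_bc [simp]:
  assumes C [simp]: "is_vcat V C"
  shows "is_vcat W (bc C)"
proof (rule W.is_vcatI, goal_cases)
  case (4 a b c d y h g f)
  then have y: "y \<in> Ob W" and h: "h \<in> Hom W y (VHom (bc C) c d)" "g \<in> Hom W y (VHom (bc C) b c)" "f \<in> Hom W y (VHom (bc C) a b)"
    and ob [simp]: "a \<in> VOb C" "b \<in> VOb C" "c \<in> VOb C" "d \<in> VOb C" by simp_all
  let ?xs = "[VHom C c d, VHom C b c, VHom C a b]"
  let ?P = "prd V ?xs"
  have xs: "set ?xs \<subseteq> Ob V" by simp
  have PO [simp]: "?P \<in> Ob V" by (rule V.prd_Ob[OF xs])
  have prj: "prj V ?xs 0 \<in> Hom V ?P (VHom C c d)" "prj V ?xs 1 \<in> Hom V ?P (VHom C b c)" "prj V ?xs 2 \<in> Hom V ?P (VHom C a b)"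
    using V.prj_in[OF xs, of 0] V.prj_in[OF xs, of 1] V.prj_in[OF xs, of 2] by simp_all
  obtain t where t: "t \<in> Hom W y (fob F ?P)"
    and eq: "\<And>i. i < length ?xs \<Longrightarrow> [h, g, f] ! i = F_act y ?P (?xs ! i) (prj V ?xs i) t"
    by (rule F_factor[of ?xs "(!) [h, g, f]" y]) (use h y xs in \<open>auto simp: less_Suc_eq\<close>)
  have eqs: "h = F_act y ?P (VHom C c d) (prj V ?xs 0) t"
    "g = F_act y ?P (VHom C b c) (prj V ?xs 1) t"
    "f = F_act y ?P (VHom C a b) (prj V ?xs 2) t"
    using eq[of 0] eq[of 1] eq[of 2] by simp_all
  show ?case
    unfolding eqs using prj t by (simp add: bc_vcomp del: One_nat_def)
next
  case (5 a b y f)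
  then have [simp]: "a \<in> VOb C" "b \<in> VOb C" "f \<in> Hom W y (fob F (VHom C a b))" by simp_all
  \<comment> \<open>A single element is the image of an identity taken at itself, so
    \<open>t = f\<close> serves for both arguments of the composition.\<close>
  have f1: "f = F_act y (VHom C a b) (VHom C a b) (Idt V (VHom C a b)) f" by simp
  show ?case
    by (simp add: bc_const_elt[where z = "VHom C a b" and t = f] del: F_Cmp, subst (2) f1, subst bc_vcomp) (simp_all del: F_Cmp)
next
  case (6 a b y f)
  then have [simp]: "a \<in> VOb C" "b \<in> VOb C" "f \<in> Hom W y (fob F (VHom C a b))" by simp_all
  have f1: "f = F_act y (VHom C a b) (VHom C a b) (Idt V (VHom C a b)) f" by simp
  show ?case
    by (simp add: bc_const_elt[where z = "VHom C a b" and t = f] del: F_Cmp, subst (1) f1, subst bc_vcomp) (simp_all del: F_Cmp)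
qed (auto simp: bc_vcat_def Let_def)

lemma is_vfun_bc [simp]:
  assumes f: "is_vfun V C D f"
  shows "is_vfun W (bc C) (bc D) (bc_vfun F C D f)"
proof -
  note [simp] = f V.vfunD[OF f]
  show ?thesis
  proof (rule W.is_vfunI, goal_cases)
    case (5 a)
    then have [simp]: "a \<in> VOb C" by simp
    show ?case by (simp flip: bc_point_Cmp)
  next
    case (6 a b c y g h)
    then have y: "y \<in> Ob W" and h: "g \<in> Hom W y (VHom (bc C) b c)" "h \<in> Hom W y (VHom (bc C) a b)"
      and ob [simp]: "a \<in> VOb C" "b \<in> VOb C" "c \<in> VOb C" by simp_all
    let ?xs = "[VHom C b c, VHom C a b]"
    let ?P = "prd V ?xs"
    obtain t where t [simp]: "t \<in> Hom W y (fob F ?P)"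
      and eq: "\<And>i. i < length ?xs \<Longrightarrow> [g, h] ! i = F_act y ?P (?xs ! i) (prj V ?xs i) t"
      by (rule F_factor[of ?xs "(!) [g, h]" y]) (use h y in \<open>auto simp: less_Suc_eq\<close>)
    have eqs: "g = F_act y ?P (VHom C b c) (prj V ?xs 0) t"
      "h = F_act y ?P (VHom C a b) (prj V ?xs (Suc 0)) t"
      using eq[of 0] eq[of "Suc 0"] by simp_all
    have "vcomp W (bc D) y (vfob f a) (vfob f b) (vfob f c)
        (F_act y ?P (VHom D (vfob f b) (vfob f c)) (vact V C D f ?P b c (prj V ?xs 0)) t)
        (F_act y ?P (VHom D (vfob f a) (vfob f b)) (vact V C D f ?P a b (prj V ?xs (Suc 0))) t) =
      F_act y ?P (VHom D (vfob f a) (vfob f c)) (vact V C D f ?P a c (vcomp V C ?P a b c (prj V ?xs 0) (prj V ?xs (Suc 0)))) t"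
      by (subst bc_vcomp) (simp_all del: F_Cmp)
    then show ?case
      unfolding eqs by (simp add: bc_vcomp del: V.vfun_vcomp)
  qed (auto simp: bc_vfun_def mk_vfun_def)
qed

lemma is_vnat_bc:
  assumes \<alpha>: "is_vnat V C D f g \<alpha>"
  shows "is_vnat W (bc C) (bc D) (bc_vfun F C D f) (bc_vfun F C D g) (bc_vnat V W F C D f g \<alpha>)"
proof -
  note [simp] = \<alpha> V.vnatD[OF \<alpha>]
  show ?thesis
  proof (rule W.is_vnatI, goal_cases)
    case (4 a b)
    then have [simp]: "a \<in> VOb C" "b \<in> VOb C" by simp_all
    let ?H = "VHom C a b"
    have k: "const_elt W (fob F ?H) (fob F x) (bc_pt x p) = far F ?H x (const_elt V ?H x p)"
      if "p \<in> Hom V (one V) x" for x p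
      using that bc_const_elt[OF that W.Idt_in[of "fob F ?H"]] by (simp del: F_Cmp)
    have "post V D ?H (vfob f a) (vfob f b) (vfob g b) (\<alpha> b) (vfar f a b) =
        vcomp V D ?H (vfob f a) (vfob g a) (vfob g b) (vfar g a b) (const_elt V ?H (VHom D (vfob f a) (vfob g a)) (\<alpha> a))"
      using V.vnat_natural[OF \<alpha>, of a b "Idt V ?H" ?H] by simp
    then show ?case
      by (simp add: k bc_vcomp0 del: F_Cmp)
  qed (auto simp: bc_vnat_def)
qed

text \<open>\<open>ucone_iff_product\<close> turns the cone into products of hom-objects, one for
  each \<open>x\<close>, and \<open>F\<close> preserves these. Read back in \<open>W\<close>, the
  image projections are the actions of the image points.\<close>

lemma ucone_bc:
  assumes C [simp]: "is_vcat V C" and q: "ucone V C bs b q"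
  shows "ucone W (bc C) bs b (\<lambda>i. bc_pt (VHom C b (bs ! i)) (q i))"
proof -
  note [simp] = V.ucone_ob[OF q] V.ucone_in[OF q]
  have bs: "set bs \<subseteq> VOb C" using q by (simp add: ucone_def)
  { fix x y assume [simp]: "x \<in> VOb C"
    let ?H = "VHom C x b"
    let ?pr = "\<lambda>i. post V C ?H x b (bs ! i) (q i) (Idt V ?H)"
    have "is_product W (map (fob F) (map (VHom C x) bs)) (fob F ?H) (\<lambda>i. far F ?H (map (VHom C x) bs ! i) (?pr i))"
      by (rule F_product, rule V.ucone_iff_product[THEN iffD1, rule_format, OF C bs _ _ q]) auto
    then have p: "is_product W (map (\<lambda>c. fob F (VHom C x c)) bs) (fob F ?H) (\<lambda>i. far F ?H (map (VHom C x) bs ! i) (?pr i))"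
      by (simp add: comp_def)
    have eq: "F_act y ?H (VHom C x (bs ! i)) (?pr i) u =
      vcomp W (bc C) y x b (bs ! i) (const_elt W y (fob F (VHom C b (bs ! i))) (bc_pt (VHom C b (bs ! i)) (q i))) u"
      if [simp]: "i < length bs" "u \<in> Hom W y (fob F ?H)" for i u
    proof -
      have "F_act y ?H (VHom C x (bs ! i)) (?pr i) u =
        vcomp W (bc C) y x b (bs ! i)
          (F_act y ?H (VHom C b (bs ! i)) (const_elt V ?H (VHom C b (bs ! i)) (q i)) u)
          (F_act y ?H ?H (Idt V ?H) u)"
        by (rule bc_vcomp[symmetric]) auto
      also have "F_act y ?H ?H (Idt V ?H) u = u" by simp
      finally show ?thesis by (simp add: bc_const_elt[where z = ?H and t = u] del: F_Cmp)
    qed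
    have "\<exists>!u. u \<in> Hom W y (fob F ?H) \<and> (\<forall>i<length bs. vcomp W (bc C) y x b (bs ! i)
       (const_elt W y (fob F (VHom C b (bs ! i))) (bc_pt (VHom C b (bs ! i)) (q i))) u = v i)"
      if "y \<in> Ob W" "\<And>i. i < length bs \<Longrightarrow> v i \<in> Hom W y (fob F (VHom C x (bs ! i)))" for v
      using W.is_product_ex1[OF p that(1), of v] that(2) by (simp add: eq cong: conj_cong) }
  then show ?thesis
    unfolding ucone_def using bs by simp
qed

lemma has_vproducts_bc: "is_vcat V C \<Longrightarrow> has_vproducts V C \<Longrightarrow> has_vproducts W (bc C)"
  unfolding V.has_vproducts_iff W.has_vproducts_iff[OF is_vcat_bc] using ucone_bc by (metis bc_vcat_sel(1))

text \<open>By \<open>is_pvfunI\<close> one cone for each list is enough, and the image of a cone of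
  \<open>C\<close> is taken; \<open>has_vproducts V C\<close> guarantees that there is one.\<close>

lemma is_pvfun_bc:
  assumes f: "is_pvfun V C D f" and C: "has_vproducts V C"
  shows "is_pvfun W (bc C) (bc D) (bc_vfun F C D f)"
proof (rule W.is_pvfunI)
  note f' = is_pvfun_vfun[OF f]
  note [simp] = f' V.vfunD[OF f']
  show "is_vfun W (bc C) (bc D) (bc_vfun F C D f)" by simp
  fix bs assume "set bs \<subseteq> VOb (bc C)"
  then have bs: "set bs \<subseteq> VOb C" by simp
  then obtain b q where q: "ucone V C bs b q" using C unfolding V.has_vproducts_iff[OF V.vfunD(1)[OF f']] by blast
  note [simp] = V.ucone_ob[OF q] V.ucone_in[OF q]
  let ?q = "\<lambda>i. bc_pt (VHom C b (bs ! i)) (q i)"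
  have 1: "ucone W (bc C) bs b ?q" by (rule ucone_bc[OF _ q]) simp
  have 2: "ucone W (bc D) (map (vfob f) bs) (vfob f b)
     (\<lambda>i. bc_pt (VHom D (vfob f b) (map (vfob f) bs ! i)) (V.image_points C D f bs b q i))"
    by (rule ucone_bc[OF _ V.is_pvfun_ucone[OF f q]]) simp
  have 3: "map (vfob (bc_vfun F C D f)) bs = map (vfob f) bs" using bs by auto
  have "ucone W (bc D) (map (vfob (bc_vfun F C D f)) bs) (vfob (bc_vfun F C D f) b)
      (W.image_points (bc C) (bc D) (bc_vfun F C D f) bs b ?q)"
    unfolding 3 by (rule W.ucone_cong[THEN iffD2, OF refl _ _ 2]) auto
  then show "\<exists>b q. ucone W (bc C) bs b q \<and>
     ucone W (bc D) (map (vfob (bc_vfun F C D f)) bs) (vfob (bc_vfun F C D f) b)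
      (W.image_points (bc C) (bc D) (bc_vfun F C D f) bs b q)"
    using 1 by blast
qed

lemma bc_vfun_comp:
  assumes f: "is_vfun V A B f" and g: "is_vfun V B C g"
  shows "bc_vfun F A C (comp_vfun V A B C g f) =
    comp_vfun W (bc A) (bc B) (bc C) (bc_vfun F B C g) (bc_vfun F A B f)"
proof -
  note [simp] = f g V.vfunD[OF f] V.vfunD[OF g]
  show ?thesis
    by (rule vfun_eqI[where V = W and C = "bc A" and D = "bc C" and D' = "bc C"]) auto
qed

lemma bc_vfun_id:
  assumes [simp]: "is_vcat V C"
  shows "bc_vfun F C C (id_vfun V C) = id_vfun W (bc C)"
  by (rule vfun_eqI[where V = W and C = "bc C" and D = "bc C" and D' = "bc C"]) auto

section \<open>The comparison of the two initial theories\<close>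

lemma F_num [simp]: "fob F (num V n) = num W n"
  and bc_point_inj: "i < n \<Longrightarrow> bc_pt (num V n) (inj V n i) = inj W n i"
  using base_functor by (simp_all add: is_base_functor_def preserves_nums_def bc_point_def)

lemma A_cmp_sel [simp]:
  "vfob (A_cmp V W F) n = n"
  "vfar (A_cmp V W F) n m = Cmp W (npow W n m) (num W (n ^ m)) (fob F (npow V n m))
    (far F (num V (n ^ m)) (npow V n m) (num_expo V m n)) (W.num_expo_inv m n)"
  by (simp_all add: A_cmp_def Let_def)

lemma F_num_expo_in [simp]: "far F (num V (n ^ m)) (npow V n m) (num_expo V m n) \<in>
  Hom W (num W (n ^ m)) (fob F (npow V n m))"
  using F_in[OF V.num_expo_in] by simp

text \<open>The inverse of \<open>num_expo\<close> in \<open>W\<close> sends the name to an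
  injection, \<open>F\<close> preserves injections, and the image of \<open>num_expo\<close> in
  \<open>V\<close> sends this injection to a name again. Both passages use the digits of the same
  \<open>k\<close>, so the function named is the same.\<close>

lemma A_cmp_num_name:
  assumes \<phi>: "\<And>i. i < m \<Longrightarrow> \<phi> i < n"
  shows "Cmp W (one W) (npow W n m) (fob F (npow V n m)) (vfar (A_cmp V W F) n m) (num_name W m n \<phi>) =
    bc_pt (npow V n m) (num_name V m n \<phi>)"
proof -
  obtain k where k: "k < n ^ m" "\<And>i. i < m \<Longrightarrow> k div n ^ i mod n = \<phi> i"
    and inv: "Cmp W (one W) (npow W n m) (num W (n ^ m)) (W.num_expo_inv m n) (num_name W m n \<phi>) = inj W (n ^ m) k"
    by (rule W.num_expo_inv_num_name[of m \<phi> n], erule \<phi>, rule that)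
  have num_name: "num_name V m n (\<lambda>i. k div n ^ i mod n) = num_name V m n \<phi>"
    by (rule V.num_name_cong) (use \<phi> k in auto)
  have "bc_pt (npow V n m) (num_name V m n \<phi>) =
      F_act (one W) (num V (n ^ m)) (npow V n m) (num_expo V m n) (bc_pt (num V (n ^ m)) (inj V (n ^ m) k))"
    using k(1) unfolding num_name[symmetric] V.num_expo_inj[OF k(1), symmetric] by (intro bc_point_Cmp) auto
  then show ?thesis
    using \<phi> k(1) by (simp add: inv bc_point_inj)
qed

lemma is_vfun_A_cmp [simp]: "is_vfun W (A_vcat W) (bc (A_vcat V)) (A_cmp V W F)"
proof (rule W.is_vfunI, goal_cases)
  case (5 a)
  show ?case
    using A_cmp_num_name[of a "\<lambda>i. i" a] by (simp add: V.A_VIdt_num_name W.A_VIdt_num_name del: A_cmp_sel(2))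
next
  case (6 a b c y g f)
  then have gf [simp]: "g \<in> Hom W y (npow W b c)" "f \<in> Hom W y (npow W a b)" by simp_all
  let ?A = "A_vcat W" and ?B = "bc (A_vcat V)"
  let ?bc = "npow W b c" and ?ab = "npow W a b" and ?ac = "npow W a c"
  let ?P = "prd W [?bc, ?ab]" and ?X = "fob F (npow V a c)"
  let ?\<kappa> = "\<lambda>n m. vfar (A_cmp V W F) n m"
  have \<kappa> [simp]: "?\<kappa> n m \<in> Hom W (npow W n m) (fob F (npow V n m))" for n m by simp
  note [simp del] = A_cmp_sel(2)
  \<comment> \<open>This and the next facts restate general rules with the hom-objects written as
    \<open>npow\<close> and its images, the form in which the simplifier meets them.\<close>
  have in1: "vcomp W ?A ?P a b c (prj W [?bc, ?ab] 0) (prj W [?bc, ?ab] (Suc 0)) \<in> Hom W ?P ?ac"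
    by (rule W.A_vcomp_in) auto
  have Acomp: "Cmp W z z' ?ac (vcomp W ?A z' a b c u v) w = vcomp W ?A z a b c (Cmp W z z' ?bc u w) (Cmp W z z' ?ab v w)"
    if "u \<in> Hom W z' ?bc" "v \<in> Hom W z' ?ab" "w \<in> Hom W z z'" for z z' u v w
    using W.vcomp_Cmp[OF W.is_vcat_A, of a b c u z' v w z] that by simp
  have Bin: "vcomp W ?B z a b c u v \<in> Hom W z ?X"
    if "u \<in> Hom W z (fob F (npow V b c))" "v \<in> Hom W z (fob F (npow V a b))" for z u v
    using W.vcomp_in[of ?B a b c u z v] that by simp
  have Bcomp: "Cmp W z z' ?X (vcomp W ?B z' a b c u v) w =
      vcomp W ?B z a b c (Cmp W z z' (fob F (npow V b c)) u w) (Cmp W z z' (fob F (npow V a b)) v w)"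
    if "u \<in> Hom W z' (fob F (npow V b c))" "v \<in> Hom W z' (fob F (npow V a b))" "w \<in> Hom W z z'" for z z' u v w
    using W.vcomp_Cmp[of ?B a b c u z' v w z] that by simp
  \<comment> \<open>\<open>?h\<close> and \<open>?h'\<close> are the two sides of the functor law at
    the generic pair of arrows; \<open>g\<close> and \<open>f\<close> are substituted once these
    agree.\<close>
  let ?h = "Cmp W ?P ?ac ?X (?\<kappa> a c) (vcomp W ?A ?P a b c (prj W [?bc, ?ab] 0) (prj W [?bc, ?ab] (Suc 0)))"
  let ?h' = "vcomp W ?B ?P a b c (Cmp W ?P ?bc (fob F (npow V b c)) (?\<kappa> b c) (prj W [?bc, ?ab] 0))
    (Cmp W ?P ?ab (fob F (npow V a b)) (?\<kappa> a b) (prj W [?bc, ?ab] (Suc 0)))"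
  have "?h = ?h'"
  proof (rule W.A_points_ext2)
    show "?h \<in> Hom W ?P ?X" using in1 by simp
    show "?h' \<in> Hom W ?P ?X" by (rule Bin) auto
    fix \<phi> \<psi> assume \<phi>: "\<And>i. i < c \<Longrightarrow> \<phi> i < b" and \<psi>: "\<And>i. i < b \<Longrightarrow> \<psi> i < a"
    note nms = V.num_name_in[of c \<phi> b, OF \<phi>] V.num_name_in[of b \<psi> a, OF \<psi>] W.num_name_in[of c \<phi> b, OF \<phi>] W.num_name_in[of b \<psi> a, OF \<psi>]
    let ?t = "tuple W (one W) [?bc, ?ab] [num_name W c b \<phi>, num_name W b a \<psi>]"
    have t: "?t \<in> Hom W (one W) ?P" using nms by simp
    have "Cmp W (one W) ?P ?X ?h ?t = Cmp W (one W) ?ac ?X (?\<kappa> a c) (vcomp W ?A (one W) a b c (num_name W c b \<phi>) (num_name W b a \<psi>))"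
      using in1 t nms by (simp add: Acomp)
    also have "\<dots> = Cmp W (one W) ?ac ?X (?\<kappa> a c) (num_name W c a (\<lambda>i. \<psi> (\<phi> i)))"
      using W.A_vcomp_num_name[of c \<phi> b \<psi> a] \<phi> \<psi> by simp
    also have "\<dots> = bc_pt (npow V a c) (num_name V c a (\<lambda>i. \<psi> (\<phi> i)))"
      by (rule A_cmp_num_name) (use \<phi> \<psi> in auto)
    also have "\<dots> = bc_pt (npow V a c) (vcomp V (A_vcat V) (one V) a b c (num_name V c b \<phi>) (num_name V b a \<psi>))"
      using V.A_vcomp_num_name[of c \<phi> b \<psi> a] \<phi> \<psi> by simp
    also have "\<dots> = vcomp W ?B (one W) a b c (bc_pt (npow V b c) (num_name V c b \<phi>)) (bc_pt (npow V a b) (num_name V b a \<psi>))"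
      using bc_vcomp_point[of "A_vcat V" a b c "num_name V c b \<phi>" "num_name V b a \<psi>"] nms by simp
    also have "\<dots> = Cmp W (one W) ?P ?X ?h' ?t"
      using t nms A_cmp_num_name[of c \<phi> b, OF \<phi>] A_cmp_num_name[of b \<psi> a, OF \<psi>] by (simp add: Bcomp)
    finally show "Cmp W (one W) ?P ?X ?h ?t = Cmp W (one W) ?P ?X ?h' ?t" .
  qed
  then have "Cmp W y ?P ?X ?h (tuple W y [?bc, ?ab] [g, f]) = Cmp W y ?P ?X ?h' (tuple W y [?bc, ?ab] [g, f])" by (simp only:)
  then show ?case
    using in1 by (simp add: Acomp Bcomp)
qed auto

text \<open>The legs of \<open>A_cone\<close> are names, so \<open>A_cmp\<close> sends them to the
  image points of the corresponding cone of \<open>A_vcat V\<close>, and that image is universal by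
  \<open>ucone_bc\<close>.\<close>

lemma is_pvfun_A_cmp [simp]: "is_pvfun W (A_vcat W) (bc (A_vcat V)) (A_cmp V W F)"
proof (rule W.is_pvfunI[OF is_vfun_A_cmp])
  fix bs :: "nat list"
  note [simp] = sum_list_block
  have u: "ucone W (bc (A_vcat V)) bs (sum_list bs)
     (\<lambda>i. bc_pt (VHom (A_vcat V) (sum_list bs) (bs ! i)) (V.A_cone bs i))"
    by (rule ucone_bc[OF V.is_vcat_A V.ucone_A])
  have "ucone W (bc (A_vcat V)) (map (vfob (A_cmp V W F)) bs) (vfob (A_cmp V W F) (sum_list bs))
        (W.image_points (A_vcat W) (bc (A_vcat V)) (A_cmp V W F) bs (sum_list bs) (W.A_cone bs))"
  proof (rule W.ucone_cong[THEN iffD2, OF _ _ _ u])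
    fix i assume i: "i < length bs"
    show "W.image_points (A_vcat W) (bc (A_vcat V)) (A_cmp V W F) bs (sum_list bs) (W.A_cone bs) i =
      bc_pt (VHom (A_vcat V) (sum_list bs) (bs ! i)) (V.A_cone bs i)"
      using A_cmp_num_name[of "bs ! i" "\<lambda>j. sum_list (take i bs) + j" "sum_list bs"] i by (simp del: A_cmp_sel(2))
  qed (auto intro: map_idI)
  then show "\<exists>b q. ucone W (A_vcat W) bs b q \<and> ucone W (bc (A_vcat V)) (map (vfob (A_cmp V W F)) bs) (vfob (A_cmp V W F) b)
        (W.image_points (A_vcat W) (bc (A_vcat V)) (A_cmp V W F) bs b q)"
    using W.ucone_A by blast
qed

section \<open>Base change of theories and models\<close>

lemma is_theory_bc:
  assumes t: "is_theory V (T, \<tau>)"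
  shows "is_theory W (bc_theory V W F (T, \<tau>))"
proof -
  have \<tau>: "VOb T = UNIV" "vfob \<tau> = (\<lambda>n. n)" "is_pvfun V (A_vcat V) T \<tau>"
    using t by (auto simp: V.is_theory_iff)
  have "is_pvfun W (bc (A_vcat V)) (bc T) (bc_vfun F (A_vcat V) T \<tau>)"
    by (rule is_pvfun_bc[OF \<tau>(3)]) simp
  then show ?thesis
    using \<tau>(1,2) by (simp add: bc_theory_def W.is_theory_iff fun_eq_iff)
qed

lemma bc_model_Ob:
  assumes "X \<in> Ob (int_VMod V)"
  shows "bc_model V W F X \<in> Ob (int_VMod W)"
proof -
  obtain T \<tau> C \<mu> where X: "X = (((T, \<tau>), C), \<mu>)" by (metis prod.exhaust)
  have *: "is_theory V (T, \<tau>)" "is_vcat V C" "has_vproducts V C" "is_pvfun V T C \<mu>"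
    using assms unfolding X V.int_VMod_Ob by auto
  have "is_theory W (bc T, snd (bc_theory V W F (T, \<tau>)))"
    using is_theory_bc[OF *(1)] by (simp add: bc_theory_def)
  then show ?thesis
    using * is_pvfun_bc[OF *(4) V.theory_vproducts[OF *(1)]] has_vproducts_bc
    by (simp add: X bc_model_def bc_theory_def W.int_VMod_Ob)
qed

lemma bc_model_ar_Hom:
  assumes m: "m \<in> Hom (int_VMod V) X Y"
  shows "bc_model_ar V W F X Y m \<in> Hom (int_VMod W) (bc_model V W F X) (bc_model V W F Y)"
proof -
  obtain T \<tau> C \<mu> where X: "X = (((T, \<tau>), C), \<mu>)" by (metis prod.exhaust)
  obtain T' \<tau>' C' \<mu>' where Y: "Y = (((T', \<tau>'), C'), \<mu>')" by (metis prod.exhaust)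
  obtain f g \<alpha> where mm: "m = ((f, g), \<alpha>)" by (metis prod.exhaust)
  have XY: "X \<in> Ob (int_VMod V)" "Y \<in> Ob (int_VMod V)"
    and f: "is_pvfun V T' T f" "comp_vfun V (A_vcat V) T' T f \<tau>' = \<tau>" and g: "is_pvfun V C C' g"
    and \<alpha>: "is_vnat V T' C' (comp_vfun V T' C C' g (comp_vfun V T' T C \<mu> f)) \<mu>' \<alpha>"
    using m unfolding X Y mm V.int_VMod_Hom by auto
  have *: "is_theory V (T', \<tau>')" "is_theory V (T, \<tau>)" "has_vproducts V C" "is_pvfun V T C \<mu>" "is_vcat V C"
    using XY unfolding X Y V.int_VMod_Ob by auto
  note funs [simp] = is_pvfun_vfun[OF f(1)] is_pvfun_vfun[OF g] is_pvfun_vfun[OF *(4)]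
  have \<tau>' [simp]: "is_vfun V (A_vcat V) T' \<tau>'"
    using *(1) by (simp add: V.is_theory_iff is_pvfun_vfun)
  \<comment> \<open>\<open>A_cmp\<close> is a common right factor of both structure maps; what
    remains is the image of the equation that makes \<open>f\<close> a morphism of theories.\<close>
  have 1: "comp_vfun W (A_vcat W) (bc T') (bc T) (bc_vfun F T' T f)
      (comp_vfun W (A_vcat W) (bc (A_vcat V)) (bc T') (bc_vfun F (A_vcat V) T' \<tau>') (A_cmp V W F)) =
     comp_vfun W (A_vcat W) (bc (A_vcat V)) (bc T) (bc_vfun F (A_vcat V) T \<tau>) (A_cmp V W F)"
    by (subst W.comp_vfun_assoc; simp flip: bc_vfun_comp add: f(2))
  \<comment> \<open>The source of the image transformation is the base change of a composite, while
    \<open>int_VMod_Hom\<close> asks for the composite of base changes.\<close>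
  have 2: "bc_vfun F T' C' (comp_vfun V T' C C' g (comp_vfun V T' T C \<mu> f)) =
     comp_vfun W (bc T') (bc C) (bc C') (bc_vfun F C C' g)
       (comp_vfun W (bc T') (bc T) (bc C) (bc_vfun F T C \<mu>) (bc_vfun F T' T f))"
    by (simp add: bc_vfun_comp)
  show ?thesis
    using bc_model_Ob[OF XY(1)] bc_model_Ob[OF XY(2)] is_pvfun_bc[OF f(1) V.theory_vproducts[OF *(1)]]
      is_pvfun_bc[OF g *(3)] is_vnat_bc[OF \<alpha>] 1
    unfolding 2 by (simp add: X Y mm bc_model_def bc_theory_def bc_model_ar_def W.int_VMod_Hom)
qed

lemma is_functor_bc_model:
  "is_functor (int_VMod V) (int_VMod W) (mk_fun (int_VMod V) (bc_model V W F) (bc_model_ar V W F))"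
proof (rule is_functor_mk_fun)
  show "category (int_VMod V)" "category (int_VMod W)" by (rule V.category_int_VMod W.category_int_VMod)+
  show "bc_model V W F X \<in> Ob (int_VMod W)" if "X \<in> Ob (int_VMod V)" for X by (rule bc_model_Ob[OF that])
  show "bc_model_ar V W F X Y m \<in> Hom (int_VMod W) (bc_model V W F X) (bc_model V W F Y)"
    if "m \<in> Hom (int_VMod V) X Y" for X Y m by (rule bc_model_ar_Hom[OF that])
next
  fix X assume X: "X \<in> Ob (int_VMod V)"
  obtain T \<tau> C \<mu> where X': "X = (((T, \<tau>), C), \<mu>)" by (metis prod.exhaust)
  have *: "is_theory V (T, \<tau>)" "is_vcat V C" "has_vproducts V C" "is_pvfun V T C \<mu>" "VOb T = UNIV"
    using X unfolding X' by (auto simp: V.int_VMod_Ob V.is_theory_iff)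
  note \<mu> = is_pvfun_vfun[OF *(4)]
  note [simp] = *(2) \<mu> V.vfunD[OF \<mu>]
  have "bc_model V W F X \<in> Ob (int_VMod W)" by (rule bc_model_Ob[OF X])
  then show "bc_model_ar V W F X X (Idt (int_VMod V) X) = Idt (int_VMod W) (bc_model V W F X)"
    using X unfolding X' bc_model_def bc_theory_def
    by (simp add: V.int_VMod_Idt W.int_VMod_Idt bc_model_ar_def bc_vfun_id V.comp_vfun_unit fun_eq_iff *(5))
next
  fix X Y Z m m' assume m: "m \<in> Hom (int_VMod V) X Y" and m': "m' \<in> Hom (int_VMod V) Y Z"
  obtain T0 \<tau>0 C0 \<mu>0 where X: "X = (((T0, \<tau>0), C0), \<mu>0)" by (metis prod.exhaust)
  obtain T1 \<tau>1 C1 \<mu>1 where Y: "Y = (((T1, \<tau>1), C1), \<mu>1)" by (metis prod.exhaust)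
  obtain T2 \<tau>2 C2 \<mu>2 where Z: "Z = (((T2, \<tau>2), C2), \<mu>2)" by (metis prod.exhaust)
  obtain f g \<alpha> where mm: "m = ((f, g), \<alpha>)" by (metis prod.exhaust)
  obtain f' g' \<alpha>' where mm': "m' = ((f', g'), \<alpha>')" by (metis prod.exhaust)
  have XY: "X \<in> Ob (int_VMod V)" "Y \<in> Ob (int_VMod V)" "Z \<in> Ob (int_VMod V)"
    and f: "is_pvfun V T1 T0 f" and g: "is_pvfun V C0 C1 g"
    and f': "is_pvfun V T2 T1 f'" and g': "is_pvfun V C1 C2 g'"
    and \<alpha>: "is_vnat V T1 C1 (comp_vfun V T1 C0 C1 g (comp_vfun V T1 T0 C0 \<mu>0 f)) \<mu>1 \<alpha>"
    and \<alpha>': "is_vnat V T2 C2 (comp_vfun V T2 C1 C2 g' (comp_vfun V T2 T1 C1 \<mu>1 f')) \<mu>2 \<alpha>'"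
    using m m' unfolding X Y Z mm mm' V.int_VMod_Hom by auto
  have *: "VOb T0 = UNIV" "VOb T1 = UNIV" "VOb T2 = UNIV" "is_pvfun V T0 C0 \<mu>0" "is_pvfun V T1 C1 \<mu>1" "is_pvfun V T2 C2 \<mu>2"
    using XY unfolding X Y Z V.int_VMod_Ob by (auto simp: V.is_theory_iff)
  note funs = is_pvfun_vfun[OF f] is_pvfun_vfun[OF g] is_pvfun_vfun[OF f'] is_pvfun_vfun[OF g'] is_pvfun_vfun[OF *(4)] is_pvfun_vfun[OF *(5)] is_pvfun_vfun[OF *(6)]
  note [simp] = funs V.vfunD[OF funs(1)] V.vfunD[OF funs(2)] V.vfunD[OF funs(3)] V.vfunD[OF funs(4)] V.vfunD[OF funs(5)] V.vfunD[OF funs(6)] V.vfunD[OF funs(7)]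
  have \<alpha>1: "\<alpha> n \<in> Hom V (one V) (VHom C1 (vfob g (vfob \<mu>0 (vfob f n))) (vfob \<mu>1 n))" for n
    using V.vnat_in[OF \<alpha>, of n] by (simp add: *)
  have \<alpha>2: "\<alpha>' n \<in> Hom V (one V) (VHom C2 (vfob g' (vfob \<mu>1 (vfob f' n))) (vfob \<mu>2 n))" for n
    using V.vnat_in[OF \<alpha>', of n] by (simp add: *)
  have ob: "vfob \<mu>0 n \<in> VOb C0" "vfob \<mu>1 n \<in> VOb C1" "vfob \<mu>2 n \<in> VOb C2" for n
    using V.vfun_ob[OF funs(5), of n] V.vfun_ob[OF funs(6), of n] V.vfun_ob[OF funs(7), of n] by (simp_all add: *)
  let ?a' = "\<lambda>n. vfob g (vfob \<mu>0 (vfob f (vfob f' n)))" and ?b' = "\<lambda>n. vfob \<mu>1 (vfob f' n)"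
  let ?a = "\<lambda>n. vfob g' (?a' n)" and ?b = "\<lambda>n. vfob g' (?b' n)" and ?c = "vfob \<mu>2"
  have act_in: "vact V C1 C2 g' (one V) (?a' n) (?b' n) (\<alpha> (vfob f' n))
     \<in> Hom V (one V) (VHom C2 (?a n) (?b n))" for n
    using \<alpha>1[of "vfob f' n"] ob by simp
  \<comment> \<open>The component is kept as a composite of two image points instead of being
    expanded by \<open>bc_point_Cmp\<close>; \<open>bc_vcomp_point\<close> then recognises it as the
    image of the composite in \<open>V\<close>.\<close>
  have 1: "Cmp (int_VMod W) (bc_model V W F X) (bc_model V W F Y) (bc_model V W F Z) (bc_model_ar V W F Y Z m') (bc_model_ar V W F X Y m) =
    ((comp_vfun W (bc T2) (bc T1) (bc T0) (bc_vfun F T1 T0 f) (bc_vfun F T2 T1 f'),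
      comp_vfun W (bc C0) (bc C1) (bc C2) (bc_vfun F C1 C2 g') (bc_vfun F C0 C1 g)),
     \<lambda>n. vcomp W (bc C2) (one W) (?a n) (?b n) (?c n)
       (bc_pt (VHom C2 (?b n) (?c n)) (\<alpha>' n))
       (bc_pt (VHom C2 (?a n) (?b n))
        (vact V C1 C2 g' (one V) (?a' n) (?b' n) (\<alpha> (vfob f' n)))))"
    using bc_model_ar_Hom[OF m] bc_model_ar_Hom[OF m']
    unfolding X Y Z mm mm' bc_model_def bc_theory_def bc_model_ar_def
    by (simp add: W.int_VMod_Cmp * ob \<alpha>1)
  show "bc_model_ar V W F X Z (Cmp (int_VMod V) X Y Z m' m) =
     Cmp (int_VMod W) (bc_model V W F X) (bc_model V W F Y) (bc_model V W F Z) (bc_model_ar V W F Y Z m') (bc_model_ar V W F X Y m)"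
    unfolding 1 using m m' unfolding X Y Z mm mm'
    by (simp add: V.int_VMod_Cmp bc_model_ar_def bc_vfun_comp fun_eq_iff * ob bc_vcomp_point act_in \<alpha>2 del: bc_point_Cmp)
qed

end

section \<open>Functoriality of change of base\<close>

lemma vcat_eqI:
  assumes "is_vcat V C" "is_vcat V D" "VOb C = VOb D"
    "\<And>a b. a \<in> VOb C \<Longrightarrow> b \<in> VOb C \<Longrightarrow> VHom C a b = VHom D a b"
    "\<And>a. a \<in> VOb C \<Longrightarrow> VIdt C a = VIdt D a"
    "\<And>a b c. a \<in> VOb C \<Longrightarrow> b \<in> VOb C \<Longrightarrow> c \<in> VOb C \<Longrightarrow> VCmp C a b c = VCmp D a b c"
  shows "C = D"
proof -
  have "VHom C = VHom D" "VIdt C = VIdt D" "VCmp C = VCmp D"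
    using assms unfolding is_vcat_def Let_def fun_eq_iff by metis+
  then show ?thesis using assms(3) by simp
qed

section \<open>Base change along an identity\<close>

context base
begin

lemma is_base_functor_id: "is_base_functor V V (id_fun V)"
  unfolding is_base_functor_def
proof (intro conjI)
  show "is_functor V V (id_fun V)" by (rule is_functor_id_fun[OF category])
  show "preserves_products V V (id_fun V)"
    unfolding preserves_products_def
  proof (intro allI impI)
    fix xs p pr assume p: "is_product V xs p pr"
    have "map (fob (id_fun V)) xs = xs" using p by (intro map_idI) (auto simp: is_product_def)
    then show "is_product V (map (fob (id_fun V)) xs) (fob (id_fun V) p) (\<lambda>i. far (id_fun V) p (xs ! i) (pr i))"
      by (intro is_product_cong[THEN iffD2, OF _ _ _ p]) (use p is_product_Ob[OF p] is_product_in[OF p] in auto)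
  qed
  have "prod_cmp V V (id_fun V) [] = Idt V (one V)"
    unfolding prod_cmp_def by (rule the_equality) (auto dest: bang_unique)
  then show "preserves_nums V V (id_fun V)" by (simp add: preserves_nums_def)
qed

lemma base_change_id: "base_change V V (id_fun V)"
  by (intro base_change.intro base_change_axioms.intro is_base_functor_id base_axioms)

lemma prod_cmp_id: "set xs \<subseteq> Ob V \<Longrightarrow> prod_cmp V V (id_fun V) xs = Idt V (prd V xs)"
proof -
  assume xs: "set xs \<subseteq> Ob V"
  have map: "map (fob (id_fun V)) xs = xs" using xs by (intro map_idI) auto
  interpret I: base_change V V "id_fun V" by (rule base_change_id)
  show ?thesis
  proof (rule prd_ext[OF xs, of _ "prd V xs"])
    show "prod_cmp V V (id_fun V) xs \<in> Hom V (prd V xs) (prd V xs)"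
      using I.prod_cmp_in[OF xs] xs unfolding map by simp
    fix i assume i: "i < length xs"
    show "Cmp V (prd V xs) (prd V xs) (xs ! i) (prj V xs i) (prod_cmp V V (id_fun V) xs) =
      Cmp V (prd V xs) (prd V xs) (xs ! i) (prj V xs i) (Idt V (prd V xs))"
      using I.prj_prod_cmp[OF xs i] xs i nth_mem[OF i] unfolding map by (simp add: subsetD)
  qed (use xs in simp)
qed

lemma bc_point_id: "p \<in> Hom V (one V) x \<Longrightarrow> bc_point V V (id_fun V) x p = p"
  using Hom_Ob[of p "one V" x] by (simp add: bc_point_def prod_cmp_id)

lemma bc_vcat_id:
  assumes C: "is_vcat V C"
  shows "bc_vcat V V (id_fun V) C = C"
proof -
  interpret I: base_change V V "id_fun V" by (rule base_change_id)
  show ?thesis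
  proof (rule vcat_eqI[where V = V])
    fix a b c assume "a \<in> VOb (bc_vcat V V (id_fun V) C)" "b \<in> VOb (bc_vcat V V (id_fun V) C)" "c \<in> VOb (bc_vcat V V (id_fun V) C)"
    then show "VCmp (bc_vcat V V (id_fun V) C) a b c = VCmp C a b c"
      using C by (simp add: bc_vcat_def prod_cmp_id Let_def)
  qed (use C in \<open>auto simp: bc_point_id\<close>)
qed

lemma bc_vfun_id_fun:
  assumes f: "is_vfun V C D f"
  shows "bc_vfun (id_fun V) C D f = f"
proof -
  interpret I: base_change V V "id_fun V" by (rule base_change_id)
  note [simp] = f vfunD[OF f]
  have "is_vfun V C D (bc_vfun (id_fun V) C D f)"
    using I.is_vfun_bc[OF f] by (simp add: bc_vcat_id)
  then show ?thesis
    by (rule vfun_eqI[where V = V and C = C and D = D and D' = D]) auto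
qed

lemma bc_theory_id:
  assumes t: "is_theory V (T, \<tau>)"
  shows "bc_theory V V (id_fun V) (T, \<tau>) = (T, \<tau>)"
proof -
  interpret I: base_change V V "id_fun V" by (rule base_change_id)
  have \<tau>: "is_vfun V (A_vcat V) T \<tau>" using t by (simp add: is_theory_iff is_pvfun_vfun)
  \<comment> \<open>For the identity functor \<open>num_expo\<close> meets its own inverse on each
    hom-object.\<close>
  have "A_cmp V V (id_fun V) = id_vfun V (A_vcat V)"
    by (rule vfun_eqI[where V = V and C = "A_vcat V" and D = "A_vcat V" and D' = "A_vcat V"])
      (use I.is_vfun_A_cmp in \<open>auto simp: bc_vcat_id\<close>)
  then show ?thesis
    by (simp add: bc_theory_def bc_vcat_id bc_vfun_id_fun[OF \<tau>] theory_vcat[OF t] comp_vfun_unit[OF \<tau>])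
qed

lemma bc_model_id:
  "mk_fun (int_VMod V) (bc_model V V (id_fun V)) (bc_model_ar V V (id_fun V)) = id_fun (int_VMod V)"
  unfolding id_fun_def[of "int_VMod V"]
proof (rule mk_fun_cong)
  fix X assume X: "X \<in> Ob (int_VMod V)"
  obtain T \<tau> C \<mu> where X': "X = (((T, \<tau>), C), \<mu>)" by (metis prod.exhaust)
  have "is_theory V (T, \<tau>)" "is_vcat V C" "is_vfun V T C \<mu>"
    using X unfolding X' by (auto simp: int_VMod_Ob is_pvfun_vfun)
  then show "bc_model V V (id_fun V) X = X"
    by (simp add: X' bc_model_def bc_theory_id bc_vcat_id bc_vfun_id_fun)
next
  fix X Y m assume m: "m \<in> Hom (int_VMod V) X Y"
  obtain T \<tau> C \<mu> where X: "X = (((T, \<tau>), C), \<mu>)" by (metis prod.exhaust)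
  obtain T' \<tau>' C' \<mu>' where Y: "Y = (((T', \<tau>'), C'), \<mu>')" by (metis prod.exhaust)
  obtain f g \<alpha> where mm: "m = ((f, g), \<alpha>)" by (metis prod.exhaust)
  have f: "is_pvfun V T' T f" and g: "is_pvfun V C C' g"
    and \<alpha>: "is_vnat V T' C' (comp_vfun V T' C C' g (comp_vfun V T' T C \<mu> f)) \<mu>' \<alpha>"
    using m unfolding X Y mm int_VMod_Hom by auto
  have "bc_vnat V V (id_fun V) T' C' (comp_vfun V T' C C' g (comp_vfun V T' T C \<mu> f)) \<mu>' \<alpha> = \<alpha>"
    using vnat_in[OF \<alpha>] vnat_undefined[OF \<alpha>] by (auto simp: bc_vnat_def fun_eq_iff bc_point_id simp del: comp_vfun_sel)
  then show "bc_model_ar V V (id_fun V) X Y m = m"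
    using f g by (simp add: X Y mm bc_model_ar_def bc_vfun_id_fun is_pvfun_vfun)
qed

end

section \<open>Base change along a composite\<close>

locale base_change2 = F: base_change U V F + G: base_change V W G
  for U V W :: "('o, 'm) ebase" and F G :: "('o, 'm, 'o, 'm) fnctr"
begin

abbreviation GF :: "('o, 'm, 'o, 'm) fnctr" where "GF \<equiv> comp_fun U G F"

lemma map_GF: "set xs \<subseteq> Ob U \<Longrightarrow> map (fob GF) xs = map (fob G) (map (fob F) xs)"
  by auto

text \<open>Both sides have the same composites with the images of the projections, which form a
  product in \<open>W\<close>. The definition of \<open>prod_cmp\<close> is used directly, since the
  facts of \<open>base_change\<close> for the composite functor become available only through
  \<open>is_base_functor_comp\<close>, which rests on this lemma.\<close>

lemma prod_cmp_comp:
  assumes xs: "set xs \<subseteq> Ob U"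
  shows "prod_cmp U W GF xs = Cmp W (prd W (map (fob G) (map (fob F) xs))) (fob G (prd V (map (fob F) xs))) (fob G (fob F (prd U xs)))
    (far G (prd V (map (fob F) xs)) (fob F (prd U xs)) (prod_cmp U V F xs)) (prod_cmp V W G (map (fob F) xs))"
    (is "_ = ?u")
proof -
  let ?Fs = "map (fob F) xs" and ?Hs = "map (fob GF) xs"
  let ?Gs = "map (fob G) ?Fs" and ?P = "prd U xs" and ?Q = "prd V ?Fs"
  let ?FP = "fob F ?P" and ?GQ = "fob G ?Q" and ?R = "prd W ?Gs"
  let ?GFP = "fob G ?FP" and ?f = "\<lambda>i. far F ?P (xs ! i) (prj U xs i)"
  have Fxs: "set ?Fs \<subseteq> Ob V" using xs by auto
  have GFxs: "set ?Gs \<subseteq> Ob W" using Fxs by auto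
  note [simp] = F.prod_cmp_in[OF xs] G.prod_cmp_in[OF Fxs] F.V.prd_Ob[OF xs] F.V.prj_in[OF xs] F.W.prd_Ob[OF Fxs]
    G.W.prd_Ob[OF GFxs]
  have xi [simp]: "i < length xs \<Longrightarrow> xs ! i \<in> Ob U" for i using xs nth_mem by blast
  have eq: "Cmp W (prd W ?Hs) (fob GF ?P) (fob GF (xs ! i)) (far GF ?P (xs ! i) (prj U xs i)) ?u =
    prj W ?Hs i" if i [simp]: "i < length xs" for i
  proof -
    have 1: "Cmp W ?GQ ?GFP (fob G (fob F (xs ! i)))
      (far G ?FP (fob F (xs ! i)) (?f i))
      (far G ?Q ?FP (prod_cmp U V F xs)) =
      far G ?Q (fob F (xs ! i)) (prj V ?Fs i)"
      using F.prj_prod_cmp[OF xs i] by (simp flip: G.F_Cmp)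
    have 2: "Cmp W ?R ?GQ (fob G (fob F (xs ! i)))
      (far G ?Q (fob F (xs ! i)) (prj V ?Fs i)) (prod_cmp V W G ?Fs) =
      prj W ?Gs i"
      using G.prj_prod_cmp[OF Fxs, of i] by simp
    show ?thesis
      unfolding map_GF[OF xs] using 2 by (simp del: map_map add: G.W.reassoc[OF 1])
  qed
  have u: "?u \<in> Hom W ?R ?GFP"
    by (rule G.W.Cmp_in) (simp_all del: map_map)
  have p: "is_product W ?Gs ?GFP
    (\<lambda>i. far G ?FP (?Fs ! i) (?f i))"
    using G.F_product[OF F.F_prd[OF xs]] .
  show ?thesis
    unfolding prod_cmp_def[of U W]
  proof (rule the_equality)
    show "?u \<in> Hom W (prd W ?Hs) (fob GF ?P) \<and>
      (\<forall>i<length xs. Cmp W (prd W ?Hs) (fob GF ?P) (fob GF (xs ! i))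
         (far GF ?P (xs ! i) (prj U xs i)) ?u = prj W ?Hs i)"
      using u eq unfolding map_GF[OF xs] by simp
    fix w assume w: "w \<in> Hom W (prd W ?Hs) (fob GF ?P) \<and>
      (\<forall>i<length xs. Cmp W (prd W ?Hs) (fob GF ?P) (fob GF (xs ! i))
         (far GF ?P (xs ! i) (prj U xs i)) w = prj W ?Hs i)"
    show "w = ?u"
    proof (rule G.W.is_product_ext[OF p _ u])
      show "w \<in> Hom W ?R ?GFP"
        using w unfolding map_GF[OF xs] by simp
      fix i assume "i < length ?Gs"
      then have i [simp]: "i < length xs" by simp
      have "Cmp W (prd W ?Hs) (fob GF ?P) (fob GF (xs ! i)) (far GF ?P (xs ! i) (prj U xs i)) w =
        Cmp W (prd W ?Hs) (fob GF ?P) (fob GF (xs ! i)) (far GF ?P (xs ! i) (prj U xs i)) ?u"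
        by (rule trans[OF conjunct2[OF w, rule_format, OF i] eq[OF i, symmetric]])
      then show "Cmp W ?R ?GFP (?Gs ! i)
        (far G ?FP (?Fs ! i) (?f i)) w =
        Cmp W ?R ?GFP (?Gs ! i)
        (far G ?FP (?Fs ! i) (?f i)) ?u"
        unfolding map_GF[OF xs] by simp
    qed
  qed
qed

lemma bc_point_comp:
  "p \<in> Hom U (one U) x \<Longrightarrow> bc_point U W GF x p = bc_point V W G (fob F x) (bc_point U V F x p)"
  using F.V.Hom_Ob[of p "one U" x] prod_cmp_comp[of "[]"] by (simp add: bc_point_def)

lemma is_base_functor_comp: "is_base_functor U W GF"
  unfolding is_base_functor_def
proof (intro conjI)
  show "is_functor U W GF" by (rule is_functor_comp_fun[OF F.F G.F])
  show "preserves_products U W GF"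
    unfolding preserves_products_def
  proof (intro allI impI)
    fix xs p pr assume p: "is_product U xs p pr"
    have xs: "set xs \<subseteq> Ob U" using p by (simp add: is_product_def)
    have GFp: "is_product W (map (fob G) (map (fob F) xs)) (fob G (fob F p))
      (\<lambda>i. far G (fob F p) (map (fob F) xs ! i) (far F p (xs ! i) (pr i)))"
      by (rule G.F_product[OF F.F_product[OF p]])
    show "is_product W (map (fob GF) xs) (fob GF p) (\<lambda>i. far GF p (xs ! i) (pr i))"
      by (rule is_product_cong[THEN iffD2, OF _ _ _ GFp])
        (use map_GF[OF xs] F.V.is_product_Ob[OF p] F.V.is_product_in[OF p] in auto)
  qed
  show "preserves_nums U W GF"
  proof -
    \<comment> \<open>Preservation of the injections is a statement about \<open>bc_point\<close>,
      which contains the comparison of terminal objects; in this form it passes to composites by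
      \<open>bc_point_comp\<close>.\<close>
    have "bc_point U W GF (num U n) (inj U n i) = inj W n i" if "i < n" for i n
      using that by (simp add: bc_point_comp F.bc_point_inj G.bc_point_inj)
    then show ?thesis
      unfolding preserves_nums_def bc_point_def by simp
  qed
qed

sublocale GF: base_change U W GF
  by unfold_locales (rule is_base_functor_comp)

lemma bc_vcat_comp:
  assumes C [simp]: "is_vcat U C"
  shows "bc_vcat U W GF C = bc_vcat V W G (bc_vcat U V F C)"
proof (rule vcat_eqI[where V = W])
  fix a b c assume "a \<in> VOb (bc_vcat U W GF C)" "b \<in> VOb (bc_vcat U W GF C)" "c \<in> VOb (bc_vcat U W GF C)"
  then have [simp]: "a \<in> VOb C" "b \<in> VOb C" "c \<in> VOb C" by simp_all
  show "VCmp (bc_vcat U W GF C) a b c = VCmp (bc_vcat V W G (bc_vcat U V F C)) a b c"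
    using prod_cmp_comp[of "[VHom C b c, VHom C a b]"] by (simp add: bc_vcat_def Let_def)
qed (auto simp: bc_point_comp)

lemma bc_vfun_comp_fun:
  assumes f: "is_vfun U C D f"
  shows "bc_vfun GF C D f = bc_vfun G (bc_vcat U V F C) (bc_vcat U V F D) (bc_vfun F C D f)"
proof -
  note [simp] = f F.V.vfunD[OF f]
  have "is_vfun W (bc_vcat U W GF C) (bc_vcat U W GF D) (bc_vfun GF C D f)" by (rule GF.is_vfun_bc[OF f])
  moreover have "is_vfun W (bc_vcat U W GF C) (bc_vcat U W GF D) (bc_vfun G (bc_vcat U V F C) (bc_vcat U V F D) (bc_vfun F C D f))"
    using G.is_vfun_bc[OF F.is_vfun_bc[OF f]] by (simp add: bc_vcat_comp)
  ultimately show ?thesis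
    by (rule vfun_eqI) auto
qed

text \<open>In the composite, the image under \<open>G\<close> of the inverse of
  \<open>num_expo\<close> in \<open>V\<close> meets the image of \<open>num_expo\<close> itself. The
  two cancel, and a single passage through \<open>num W (n ^ m)\<close> remains.\<close>

lemma A_cmp_comp:
  "A_cmp U W GF = comp_vfun W (A_vcat W) (bc_vcat V W G (A_vcat V)) (bc_vcat V W G (bc_vcat U V F (A_vcat U)))
    (bc_vfun G (A_vcat V) (bc_vcat U V F (A_vcat U)) (A_cmp U V F)) (A_cmp V W G)"
proof (rule vfun_eqI)
  show "is_vfun W (A_vcat W) (bc_vcat U W GF (A_vcat U)) (A_cmp U W GF)" by simp
  show "is_vfun W (A_vcat W) (bc_vcat V W G (bc_vcat U V F (A_vcat U)))
    (comp_vfun W (A_vcat W) (bc_vcat V W G (A_vcat V)) (bc_vcat V W G (bc_vcat U V F (A_vcat U)))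
    (bc_vfun G (A_vcat V) (bc_vcat U V F (A_vcat U)) (A_cmp U V F)) (A_cmp V W G))" by (simp del: F.A_cmp_sel G.A_cmp_sel)
  fix n m :: nat
  have inv: "Cmp W (num W (n ^ m)) (fob G (npow V n m)) (num W (n ^ m))
    (far G (npow V n m) (num V (n ^ m)) (F.W.num_expo_inv m n))
    (far G (num V (n ^ m)) (npow V n m) (num_expo V m n)) = Idt W (num W (n ^ m))"
    using G.F_Cmp[OF F.W.num_expo_in F.W.num_expo_inv_in, of n m] by simp
  have "far G (npow V n m) (num V (n ^ m)) (F.W.num_expo_inv m n) \<in> Hom W (fob G (npow V n m)) (num W (n ^ m))"
    using G.F_in[OF F.W.num_expo_inv_in, of n m] by simp
  moreover have "far G (num V (n ^ m)) (fob F (npow U n m)) (far F (num U (n ^ m)) (npow U n m) (num_expo U m n))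
     \<in> Hom W (num W (n ^ m)) (fob G (fob F (npow U n m)))"
    using G.F_in[OF F.F_in[OF F.V.num_expo_in], of n m] by simp
  ultimately show "vfar (A_cmp U W GF) n m = vfar (comp_vfun W (A_vcat W) (bc_vcat V W G (A_vcat V)) (bc_vcat V W G (bc_vcat U V F (A_vcat U)))
    (bc_vfun G (A_vcat V) (bc_vcat U V F (A_vcat U)) (A_cmp U V F)) (A_cmp V W G)) n m"
    by (simp add: G.W.reassoc[OF inv])
qed auto

text \<open>After \<open>A_cmp_comp\<close> the comparison for \<open>F\<close> appears under
  \<open>G\<close>, where it combines with the image of \<open>\<tau>\<close> to the structure map
  of the theory changed along \<open>F\<close>.\<close>

lemma bc_theory_comp:
  assumes t: "is_theory U (T, \<tau>)"
  shows "bc_theory U W GF (T, \<tau>) = bc_theory V W G (bc_theory U V F (T, \<tau>))"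
proof -
  have \<tau> [simp]: "is_vfun U (A_vcat U) T \<tau>" using t by (simp add: F.V.is_theory_iff is_pvfun_vfun)
  note [simp] = F.V.theory_vcat[OF t]
  show ?thesis
    by (simp add: bc_theory_def bc_vcat_comp bc_vfun_comp_fun A_cmp_comp G.bc_vfun_comp[OF F.is_vfun_A_cmp F.is_vfun_bc[OF \<tau>]]
        G.W.comp_vfun_assoc[OF G.is_vfun_A_cmp G.is_vfun_bc[OF F.is_vfun_A_cmp] G.is_vfun_bc[OF F.is_vfun_bc[OF \<tau>]]])
qed

lemma bc_model_comp:
  "mk_fun (int_VMod U) (bc_model U W GF) (bc_model_ar U W GF) =
   comp_fun (int_VMod U) (mk_fun (int_VMod V) (bc_model V W G) (bc_model_ar V W G))
     (mk_fun (int_VMod U) (bc_model U V F) (bc_model_ar U V F))"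
  unfolding comp_fun_def[of "int_VMod U"]
proof (rule mk_fun_cong)
  fix X assume X: "X \<in> Ob (int_VMod U)"
  obtain T \<tau> C \<mu> where X': "X = (((T, \<tau>), C), \<mu>)" by (metis prod.exhaust)
  have "is_theory U (T, \<tau>)" "is_vcat U C" "is_vfun U T C \<mu>"
    using X unfolding X' by (auto simp: F.V.int_VMod_Ob is_pvfun_vfun)
  moreover have "is_vcat U T" using F.V.theory_vcat calculation(1) .
  ultimately have "bc_model U W GF X = bc_model V W G (bc_model U V F X)"
    using bc_theory_comp[of T \<tau>] by (simp add: X' bc_model_def bc_vcat_comp bc_vfun_comp_fun bc_theory_def)
  then show "bc_model U W GF X = fob (mk_fun (int_VMod V) (bc_model V W G) (bc_model_ar V W G)) (fob (mk_fun (int_VMod U) (bc_model U V F) (bc_model_ar U V F)) X)"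
    using X F.bc_model_Ob[OF X] by simp
next
  fix X Y m assume m: "m \<in> Hom (int_VMod U) X Y"
  obtain T \<tau> C \<mu> where X: "X = (((T, \<tau>), C), \<mu>)" by (metis prod.exhaust)
  obtain T' \<tau>' C' \<mu>' where Y: "Y = (((T', \<tau>'), C'), \<mu>')" by (metis prod.exhaust)
  obtain f g \<alpha> where mm: "m = ((f, g), \<alpha>)" by (metis prod.exhaust)
  have XY: "X \<in> Ob (int_VMod U)" "Y \<in> Ob (int_VMod U)"
    and f: "is_pvfun U T' T f" and g: "is_pvfun U C C' g"
    and \<alpha>: "is_vnat U T' C' (comp_vfun U T' C C' g (comp_vfun U T' T C \<mu> f)) \<mu>' \<alpha>"
    using m unfolding X Y mm F.V.int_VMod_Hom by auto
  have *: "is_pvfun U T C \<mu>" "is_pvfun U T' C' \<mu>'"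
    using XY unfolding X Y F.V.int_VMod_Ob by auto
  note funs = is_pvfun_vfun[OF f] is_pvfun_vfun[OF g] is_pvfun_vfun[OF *(1)] is_pvfun_vfun[OF *(2)]
  note [simp] = funs F.V.vfunD[OF funs(1)] F.V.vfunD[OF funs(2)] F.V.vfunD[OF funs(3)] F.V.vfunD[OF funs(4)]
  have \<alpha>1: "\<alpha> n \<in> Hom U (one U) (VHom C' (vfob g (vfob \<mu> (vfob f n))) (vfob \<mu>' n))" if "n \<in> VOb T'" for n
    using F.V.vnat_in[OF \<alpha> that] that by simp
  have "bc_model_ar U W GF X Y m = bc_model_ar V W G (bc_model U V F X) (bc_model U V F Y) (bc_model_ar U V F X Y m)"
    by (simp add: X Y mm bc_model_ar_def bc_model_def bc_theory_def bc_vfun_comp_fun bc_vnat_def fun_eq_iff bc_point_comp \<alpha>1)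
  then show "bc_model_ar U W GF X Y m = far (mk_fun (int_VMod V) (bc_model V W G) (bc_model_ar V W G))
      (fob (mk_fun (int_VMod U) (bc_model U V F) (bc_model_ar U V F)) X) (fob (mk_fun (int_VMod U) (bc_model U V F) (bc_model_ar U V F)) Y)
      (far (mk_fun (int_VMod U) (bc_model U V F) (bc_model_ar U V F)) X Y m)"
    using m XY F.bc_model_ar_Hom[OF m] by simp
qed

end

lemma base_changeI: "enriching_base V \<Longrightarrow> enriching_base W \<Longrightarrow> is_base_functor V W F \<Longrightarrow> base_change V W F"
  by (intro base_change.intro base.intro base_change_axioms.intro)

lemma base_change2I:
  "enriching_base U \<Longrightarrow> enriching_base V \<Longrightarrow> enriching_base W \<Longrightarrow> is_base_functor U V F \<Longrightarrow> is_base_functor V W G \<Longrightarrow>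
    base_change2 U V W F G"
  by (intro base_change2.intro base_changeI)

section \<open>The functor \<open>Mod\<close> and its Grothendieck construction\<close>

lemma category_Enr: "category Enr"
  unfolding Enr_def
proof (rule category_mk_cat, goal_cases)
  case (1 V)
  then show ?case by (simp add: base.is_base_functor_id base_def)
next
  case (2 U V W F G)
  then show ?case by (auto intro: base_change2.is_base_functor_comp[OF base_change2I])
qed (auto simp: is_base_functor_def comp_fun_unit comp_fun_assoc)

lemma Enr_sel:
  "V \<in> Ob Enr \<longleftrightarrow> enriching_base V"
  "F \<in> Hom Enr V W \<longleftrightarrow> enriching_base V \<and> enriching_base W \<and> is_base_functor V W F"
  "enriching_base V \<Longrightarrow> Idt Enr V = id_fun V"
  "F \<in> Hom Enr U V \<Longrightarrow> G \<in> Hom Enr V W \<Longrightarrow> Cmp Enr U V W G F = comp_fun U G F"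
  by (auto simp: Enr_def split: if_splits)

lemma is_functor_Mod: "is_functor Enr Cat Mod"
  unfolding Mod_def
proof (rule is_functor_mk_fun, goal_cases)
  case 1
  show ?case by (rule category_Enr)
next
  case 2
  show ?case by (rule category_Cat)
next
  case (3 V)
  then show ?case by (simp add: Enr_sel base.category_int_VMod base_def)
next
  case (4 V W F)
  then show ?case by (simp add: Enr_sel base_change.is_functor_bc_model base_changeI)
next
  case (5 V)
  then show ?case by (simp add: Enr_sel base.category_int_VMod base.bc_model_id base_def)
next
  case (6 U V W F G)
  then have "base_change2 U V W F G" "base_change U V F" "base_change V W G"
    by (auto simp: Enr_sel intro: base_change2I base_changeI)
  then show ?case
    using 6 by (simp add: Enr_sel(4) base_change2.bc_model_comp base_change.is_functor_bc_model)
qed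

theorem theorem11:
  "let M = (Mod :: (('o, 'm) ebase, ('o, 'm, 'o, 'm) fnctr,
                    ('c, 'o, 'm) int_VMod_t, ('c, 'o, 'm) int_VMod_fun_t) fnctr);
       IntMod = groth Enr M
   in is_functor Enr Cat M \<and>
      category IntMod \<and>
      Ob IntMod =
        {(V, (((T, \<tau>), C), \<mu>)) | V T \<tau> C \<mu>.
           enriching_base V \<and> is_theory V (T, \<tau>) \<and>
           is_vcat V C \<and> has_vproducts V C \<and> is_pvfun V T C \<mu>} \<and>
      (\<forall>V T \<tau> C \<mu> W T' \<tau>' C' \<mu>'.
         (V, (((T, \<tau>), C), \<mu>)) \<in> Ob IntMod \<longrightarrow> (W, (((T', \<tau>'), C'), \<mu>')) \<in> Ob IntMod \<longrightarrow>
         Hom IntMod (V, (((T, \<tau>), C), \<mu>)) (W, (((T', \<tau>'), C'), \<mu>')) =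
           {(F, ((f, g), \<alpha>)) | F f g \<alpha>.
              is_base_functor V W F \<and>
              ((f, g), \<alpha>) \<in> Hom (int_VMod W)
                 ((bc_theory V W F (T, \<tau>), bc_vcat V W F C), bc_vfun F T C \<mu>)
                 (((T', \<tau>'), C'), \<mu>')})"
proof -
  let ?M = "Mod :: (('o, 'm) ebase, ('o, 'm, 'o, 'm) fnctr, ('c, 'o, 'm) int_VMod_t, ('c, 'o, 'm) int_VMod_fun_t) fnctr"
  \<comment> \<open>\<open>Mod\<close> is built with \<open>mk_fun\<close>, so its values are
    accessible only on objects and arrows of \<open>Enr\<close>; hence the hypotheses here and in
    \<open>farM\<close>.\<close>
  have fobM: "fob ?M V = int_VMod V" if "enriching_base V" for V
    using that by (simp add: Mod_def Enr_sel)
  have farM: "far ?M V W F = mk_fun (int_VMod V) (bc_model V W F) (bc_model_ar V W F)"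
    if "enriching_base V" "enriching_base W" "is_base_functor V W F" for V W F
    using that by (simp add: Mod_def Enr_sel)
  have Ob: "(V, (((T, \<tau>), C), \<mu>)) \<in> Ob (groth Enr ?M) \<longleftrightarrow> enriching_base V \<and> is_theory V (T, \<tau>) \<and>
           is_vcat V C \<and> has_vproducts V C \<and> is_pvfun V T C \<mu>" for V T \<tau> C \<mu>
    unfolding groth_sel(1)[OF is_functor_Mod] Enr_sel
    using fobM[of V] base.int_VMod_Ob[of V T \<tau> C \<mu>] by (auto simp: base_def)
  have Hom: "(F, ((f, g), \<alpha>)) \<in> Hom (groth Enr ?M) (V, (((T, \<tau>), C), \<mu>)) (W, (((T', \<tau>'), C'), \<mu>')) \<longleftrightarrow>
      is_base_functor V W F \<and>
      ((f, g), \<alpha>) \<in> Hom (int_VMod W) ((bc_theory V W F (T, \<tau>), bc_vcat V W F C), bc_vfun F T C \<mu>) (((T', \<tau>'), C'), \<mu>')"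
    if o: "(V, (((T, \<tau>), C), \<mu>)) \<in> Ob (groth Enr ?M)" "(W, (((T', \<tau>'), C'), \<mu>')) \<in> Ob (groth Enr ?M)"
    for V T \<tau> C \<mu> W T' \<tau>' C' \<mu>' F f g \<alpha>
  proof -
    \<comment> \<open>Membership of the source in the fibre over \<open>V\<close> allows the object
      part of the functor for \<open>F\<close> to be unfolded to \<open>bc_model\<close>.\<close>
    have e: "enriching_base V" "enriching_base W" "(((T, \<tau>), C), \<mu>) \<in> Ob (fob ?M V)"
      using o Ob groth_sel(1)[OF is_functor_Mod] by blast+
    then have "(((T, \<tau>), C), \<mu>) \<in> Ob (int_VMod V)" using fobM by simp
    then show ?thesis
      unfolding groth_sel(2)[OF is_functor_Mod] Enr_sel
      using e by (auto simp: fobM farM bc_model_def)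
  qed
  show ?thesis
    unfolding Let_def using Ob Hom by (intro conjI is_functor_Mod category_groth[OF is_functor_Mod]) auto
qed

end
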